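(* Let $2\leq n<\infty$. Let $\{r_k\}_{k=1}^\infty$ be a sequence of positive integers, and put $R_1:=0$ and $R_k:=\sum_{j=1}^{k-1}r_j$ for $k\geq2$. For each $k\ge1$ let $0<c_k<1$ be such that $\prod_{k=1}^\infty c_k=0$. For each $k\geq 1$ let $d_k$ be a unitary in $\varphi^{R_k}(\mathcal{D}_n^{r_k})$ and let $U_k$ be a unitary in $\varphi^{R_k}(\mathcal{F}_n^{r_k})$ such that $$\|\Phi_{\mathcal{D}_n}(U_kd_kU_k^* )\|_2\leq c_k .$$ Let $\mathcal{A}$ be the $C^*$-subalgebra of $\mathcal{O}_n$ generated by $\bigcup_{k\geq1}U_k\varphi^{R_k}(\mathcal{D}_n^{r_k})U_k^*$. Then $\mathcal{A}$ is a MASA (maximal abelian subalgebra) in $\mathcal{O}_n$ that is not inner conjugate to $\mathcal{D}_n$, i.e. there is no unitary $w\in\mathcal{O}_n$ with $w\mathcal{A}w^*=\mathcal{D}_n$.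
   Context: $\mathcal{O}_n$ is the Cuntz algebra, the universal unital $C^*$-algebra generated by isometries $S_1,\dots,S_n$ with $\sum_{i=1}^nS_iS_i^*=1$. For a word $\mu=(\mu_1,\dots,\mu_k)$ over $\{1,\dots,n\}$, of length $|\mu|=k$, $S_\mu=S_{\mu_1}\cdots S_{\mu_k}$ (and $S_\emptyset=1$). $\mathcal{D}_n^k=\mathrm{span}\{S_\mu S_\mu^*:|\mu|=k\}$, and the diagonal MASA $\mathcal{D}_n$ is the norm closure of $\bigcup_k\mathcal{D}_n^k$. $\mathcal{F}_n^k=\mathrm{span}\{S_\mu S_\nu^*:|\mu|=|\nu|=k\}\cong M_{n^k}(\mathbb{C})$, and the core UHF-subalgebra $\mathcal{F}_n$ is the norm closure of $\bigcup_k\mathcal{F}_n^k$. The shift is the injective unital endomorphism $\varphi(x)=\sum_{i=1}^nS_ixS_i^*$ of $\mathcal{O}_n$. $\Phi_{\mathcal{D}_n}:\mathcal{O}_n\to\mathcal{D}_n$ is the faithful conditional expectation with $\Phi_{\mathcal{D}_n}(S_\mu S_\nu^* )=0$ for $\mu\neq\nu$. $\tau$ is the canonical (unique) tracial state on $\mathcal{F}_n$, $\tau(S_\mu S_\nu^* )=\delta_{\mu,\nu}n^{-k}$ for $|\mu|=|\nu|=k$, and $\|a\|_2=\tau(a^*a)^{1/2}$ for $a\in\mathcal{F}_n$. *)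

theory Defs
  imports "HOL-Analysis.Analysis"
begin

section \<open>Unital C*-algebras\<close>

text \<open>
  Nonzero unital C*-algebras: the library class \<open>real_normed_algebra_1\<close> contains \<open>norm 1 = 1\<close>.
  The complex scalar action extends the real one.
\<close>

class cstar_algebra = real_normed_algebra_1 + banach +
  fixes scaleC :: "complex \<Rightarrow> 'a \<Rightarrow> 'a" (infixr "*\<^sub>C" 75)
    and star :: "'a \<Rightarrow> 'a"
  assumes scaleC_add_right: "c *\<^sub>C (x + y) = c *\<^sub>C x + c *\<^sub>C y"
    and scaleC_add_left: "(c + d) *\<^sub>C x = c *\<^sub>C x + d *\<^sub>C x"
    and scaleC_scaleC: "c *\<^sub>C (d *\<^sub>C x) = (c * d) *\<^sub>C x"
    and scaleC_of_real: "complex_of_real t *\<^sub>C x = t *\<^sub>R x"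
    and scaleC_mult_left: "(c *\<^sub>C x) * y = c *\<^sub>C (x * y)"
    and scaleC_mult_right: "x * (c *\<^sub>C y) = c *\<^sub>C (x * y)"
    and norm_scaleC: "norm (c *\<^sub>C x) = cmod c * norm x"
    and star_star: "star (star x) = x"
    and star_add: "star (x + y) = star x + star y"
    and star_scaleC: "star (c *\<^sub>C x) = cnj c *\<^sub>C star x"
    and star_mult: "star (x * y) = star y * star x"
    and cstar_identity: "norm (star x * x) = (norm x)\<^sup>2"

lemma scaleC_one: "1 *\<^sub>C x = (x :: 'a::cstar_algebra)"
  using scaleC_of_real[of 1 x] by simp

global_interpretation complex_vector:
  vector_space "scaleC :: complex \<Rightarrow> 'a \<Rightarrow> 'a::cstar_algebra"
  by unfold_locales
    (simp_all add: scaleC_add_right scaleC_add_left scaleC_scaleC scaleC_one)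

definition unitary :: "'a::cstar_algebra \<Rightarrow> bool" where
  "unitary u \<longleftrightarrow> star u * u = 1 \<and> u * star u = 1"

definition cstar_subalgebra :: "'a::cstar_algebra set \<Rightarrow> bool" where
  "cstar_subalgebra B \<longleftrightarrow> complex_vector.subspace B \<and> closed B \<and>
     (\<forall>x\<in>B. \<forall>y\<in>B. x * y \<in> B) \<and> (\<forall>x\<in>B. star x \<in> B)"

abbreviation cstar_generated :: "'a::cstar_algebra set \<Rightarrow> 'a set" where
  "cstar_generated X \<equiv> cstar_subalgebra hull X"

definition abelian :: "'a::cstar_algebra set \<Rightarrow> bool" where
  "abelian B \<longleftrightarrow> (\<forall>x\<in>B. \<forall>y\<in>B. x * y = y * x)"

definition masa :: "'a::cstar_algebra set \<Rightarrow> bool" where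
  "masa A \<longleftrightarrow> cstar_subalgebra A \<and> abelian A \<and>
     (\<forall>B. cstar_subalgebra B \<and> abelian B \<and> A \<subseteq> B \<longrightarrow> B = A)"

definition inner_conjugate :: "'a::cstar_algebra set \<Rightarrow> 'a set \<Rightarrow> bool" where
  "inner_conjugate A B \<longleftrightarrow> (\<exists>w. unitary w \<and> (\<lambda>a. w * a * star w) ` A = B)"

definition conditional_expectation ::
  "'a::cstar_algebra set \<Rightarrow> ('a \<Rightarrow> 'a) \<Rightarrow> bool" where
  "conditional_expectation B E \<longleftrightarrow>
     Vector_Spaces.linear scaleC scaleC E \<and>
     range E \<subseteq> B \<and> (\<forall>b\<in>B. E b = b) \<and>
     (\<forall>x. norm (E x) \<le> norm x) \<and>
     (\<forall>x. \<exists>y. E (star x * x) = star y * y) \<and>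
     (\<forall>a\<in>B. \<forall>b\<in>B. \<forall>x. E (a * x * b) = a * E x * b)"

definition faithful :: "('a::cstar_algebra \<Rightarrow> 'a) \<Rightarrow> bool" where
  "faithful E \<longleftrightarrow> (\<forall>x. E (star x * x) = 0 \<longrightarrow> x = 0)"


section \<open>Unital C*-algebra structures on subsets of a type\<close>

text \<open>
  These are the test objects for the universal property of the Cuntz algebra, which cannot
  quantify over the types of class \<open>cstar_algebra\<close>. The zero algebra is allowed here.
\<close>

record 'b cstar_struct =
  elems :: "'b set"
  add_of :: "'b \<Rightarrow> 'b \<Rightarrow> 'b"
  zero_of :: 'b
  mult_of :: "'b \<Rightarrow> 'b \<Rightarrow> 'b"
  one_of :: 'b
  scale_of :: "complex \<Rightarrow> 'b \<Rightarrow> 'b"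
  star_of :: "'b \<Rightarrow> 'b"
  norm_of :: "'b \<Rightarrow> real"

locale cstar_structure =
  fixes B :: "'b cstar_struct"
  assumes zero_closed: "zero_of B \<in> elems B"
    and one_closed: "one_of B \<in> elems B"
    and add_closed: "\<lbrakk>x \<in> elems B; y \<in> elems B\<rbrakk> \<Longrightarrow> add_of B x y \<in> elems B"
    and mult_closed: "\<lbrakk>x \<in> elems B; y \<in> elems B\<rbrakk> \<Longrightarrow> mult_of B x y \<in> elems B"
    and scale_closed: "x \<in> elems B \<Longrightarrow> scale_of B c x \<in> elems B"
    and star_closed: "x \<in> elems B \<Longrightarrow> star_of B x \<in> elems B"
    and add_assoc: "\<lbrakk>x \<in> elems B; y \<in> elems B; z \<in> elems B\<rbrakk> \<Longrightarrow>
          add_of B (add_of B x y) z = add_of B x (add_of B y z)"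
    and add_commute: "\<lbrakk>x \<in> elems B; y \<in> elems B\<rbrakk> \<Longrightarrow> add_of B x y = add_of B y x"
    and add_zero: "x \<in> elems B \<Longrightarrow> add_of B x (zero_of B) = x"
    and add_neg: "x \<in> elems B \<Longrightarrow> add_of B x (scale_of B (-1) x) = zero_of B"
    and mult_assoc: "\<lbrakk>x \<in> elems B; y \<in> elems B; z \<in> elems B\<rbrakk> \<Longrightarrow>
          mult_of B (mult_of B x y) z = mult_of B x (mult_of B y z)"
    and mult_one_left: "x \<in> elems B \<Longrightarrow> mult_of B (one_of B) x = x"
    and mult_one_right: "x \<in> elems B \<Longrightarrow> mult_of B x (one_of B) = x"
    and distrib_left: "\<lbrakk>x \<in> elems B; y \<in> elems B; z \<in> elems B\<rbrakk> \<Longrightarrow>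
          mult_of B x (add_of B y z) = add_of B (mult_of B x y) (mult_of B x z)"
    and distrib_right: "\<lbrakk>x \<in> elems B; y \<in> elems B; z \<in> elems B\<rbrakk> \<Longrightarrow>
          mult_of B (add_of B x y) z = add_of B (mult_of B x z) (mult_of B y z)"
    and scale_one: "x \<in> elems B \<Longrightarrow> scale_of B 1 x = x"
    and scale_scale: "x \<in> elems B \<Longrightarrow> scale_of B c (scale_of B d x) = scale_of B (c * d) x"
    and scale_add_left: "x \<in> elems B \<Longrightarrow>
          scale_of B (c + d) x = add_of B (scale_of B c x) (scale_of B d x)"
    and scale_add_right: "\<lbrakk>x \<in> elems B; y \<in> elems B\<rbrakk> \<Longrightarrow>
          scale_of B c (add_of B x y) = add_of B (scale_of B c x) (scale_of B c y)"
    and scale_mult_left: "\<lbrakk>x \<in> elems B; y \<in> elems B\<rbrakk> \<Longrightarrow>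
          mult_of B (scale_of B c x) y = scale_of B c (mult_of B x y)"
    and scale_mult_right: "\<lbrakk>x \<in> elems B; y \<in> elems B\<rbrakk> \<Longrightarrow>
          mult_of B x (scale_of B c y) = scale_of B c (mult_of B x y)"
    and star_star: "x \<in> elems B \<Longrightarrow> star_of B (star_of B x) = x"
    and star_add: "\<lbrakk>x \<in> elems B; y \<in> elems B\<rbrakk> \<Longrightarrow>
          star_of B (add_of B x y) = add_of B (star_of B x) (star_of B y)"
    and star_scale: "x \<in> elems B \<Longrightarrow>
          star_of B (scale_of B c x) = scale_of B (cnj c) (star_of B x)"
    and star_mult: "\<lbrakk>x \<in> elems B; y \<in> elems B\<rbrakk> \<Longrightarrow>
          star_of B (mult_of B x y) = mult_of B (star_of B y) (star_of B x)"
    and norm_nonneg: "x \<in> elems B \<Longrightarrow> 0 \<le> norm_of B x"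
    and norm_eq_zero: "x \<in> elems B \<Longrightarrow> norm_of B x = 0 \<longleftrightarrow> x = zero_of B"
    and norm_triangle: "\<lbrakk>x \<in> elems B; y \<in> elems B\<rbrakk> \<Longrightarrow>
          norm_of B (add_of B x y) \<le> norm_of B x + norm_of B y"
    and norm_scale: "x \<in> elems B \<Longrightarrow> norm_of B (scale_of B c x) = cmod c * norm_of B x"
    and norm_mult: "\<lbrakk>x \<in> elems B; y \<in> elems B\<rbrakk> \<Longrightarrow>
          norm_of B (mult_of B x y) \<le> norm_of B x * norm_of B y"
    and norm_cstar: "x \<in> elems B \<Longrightarrow>
          norm_of B (mult_of B (star_of B x) x) = (norm_of B x)\<^sup>2"
    and complete: "Metric_space.mcomplete (elems B)
          (\<lambda>x y. norm_of B (add_of B x (scale_of B (-1) y)))"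

definition unital_star_hom :: "('a::cstar_algebra \<Rightarrow> 'b) \<Rightarrow> 'b cstar_struct \<Rightarrow> bool" where
  "unital_star_hom h B \<longleftrightarrow>
     range h \<subseteq> elems B \<and> h 1 = one_of B \<and>
     (\<forall>x y. h (x + y) = add_of B (h x) (h y)) \<and>
     (\<forall>x y. h (x * y) = mult_of B (h x) (h y)) \<and>
     (\<forall>c x. h (c *\<^sub>C x) = scale_of B c (h x)) \<and>
     (\<forall>x. h (star x) = star_of B (h x))"

definition cuntz_family_in :: "'b cstar_struct \<Rightarrow> nat \<Rightarrow> (nat \<Rightarrow> 'b) \<Rightarrow> bool" where
  "cuntz_family_in B n T \<longleftrightarrow>
     (\<forall>i\<in>{1..n}. T i \<in> elems B \<and> mult_of B (star_of B (T i)) (T i) = one_of B) \<and>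
     foldr (add_of B) (map (\<lambda>i. mult_of B (T i) (star_of B (T i))) [1..<Suc n]) (zero_of B)
       = one_of B"


section \<open>The Cuntz algebra\<close>

text \<open>
  \<open>cuntz_algebra n S\<close> says that the whole type \<open>'a\<close> is the universal unital C*-algebra generated by
  isometries \<open>S 1, \<dots>, S n\<close> whose range projections add up to \<open>1\<close>.

  The universal property ranges over the C*-algebras \<open>B\<close> with elements in \<open>'a\<close> itself. This loses
  no generality: a C*-algebra generated by finitely many elements is separable, hence has
  at most continuum many elements, while \<open>'a\<close>, being a nonzero complex vector space, has at least
  continuum many. So every such algebra is isomorphic to one carried by a subset of \<open>'a\<close>.
\<close>

definition cuntz_algebra :: "nat \<Rightarrow> (nat \<Rightarrow> 'a::cstar_algebra) \<Rightarrow> bool" where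
  "cuntz_algebra n S \<longleftrightarrow>
     (\<forall>i\<in>{1..n}. star (S i) * S i = 1) \<and>
     (\<Sum>i=1..n. S i * star (S i)) = 1 \<and>
     cstar_generated (S ` {1..n}) = UNIV \<and>
     (\<forall>(B :: 'a cstar_struct) T. cstar_structure B \<and> cuntz_family_in B n T \<longrightarrow>
        (\<exists>!h. unital_star_hom h B \<and> (\<forall>i\<in>{1..n}. h (S i) = T i)))"

definition words :: "nat \<Rightarrow> nat list set" where
  "words n = lists {1..n}"

definition words_of_length :: "nat \<Rightarrow> nat \<Rightarrow> nat list set" where
  "words_of_length n k = {\<mu> \<in> words n. length \<mu> = k}"

definition S_word :: "(nat \<Rightarrow> 'a::cstar_algebra) \<Rightarrow> nat list \<Rightarrow> 'a" where
  "S_word S \<mu> = prod_list (map S \<mu>)"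

definition diag_level :: "nat \<Rightarrow> (nat \<Rightarrow> 'a::cstar_algebra) \<Rightarrow> nat \<Rightarrow> 'a set" where
  "diag_level n S k =
     complex_vector.span {S_word S \<mu> * star (S_word S \<mu>) | \<mu>. \<mu> \<in> words_of_length n k}"

definition diag_masa :: "nat \<Rightarrow> (nat \<Rightarrow> 'a::cstar_algebra) \<Rightarrow> 'a set" where
  "diag_masa n S = closure (\<Union>k. diag_level n S k)"

definition core_level :: "nat \<Rightarrow> (nat \<Rightarrow> 'a::cstar_algebra) \<Rightarrow> nat \<Rightarrow> 'a set" where
  "core_level n S k =
     complex_vector.span {S_word S \<mu> * star (S_word S \<nu>) | \<mu> \<nu>.
       \<mu> \<in> words_of_length n k \<and> \<nu> \<in> words_of_length n k}"

definition core :: "nat \<Rightarrow> (nat \<Rightarrow> 'a::cstar_algebra) \<Rightarrow> 'a set" where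
  "core n S = closure (\<Union>k. core_level n S k)"

definition shift :: "nat \<Rightarrow> (nat \<Rightarrow> 'a::cstar_algebra) \<Rightarrow> 'a \<Rightarrow> 'a" where
  "shift n S x = (\<Sum>i=1..n. S i * x * star (S i))"

definition diag_expectation :: "nat \<Rightarrow> (nat \<Rightarrow> 'a::cstar_algebra) \<Rightarrow> ('a \<Rightarrow> 'a) \<Rightarrow> bool" where
  "diag_expectation n S \<Phi> \<longleftrightarrow>
     conditional_expectation (diag_masa n S) \<Phi> \<and> faithful \<Phi> \<and>
     (\<forall>\<mu>\<in>words n. \<forall>\<nu>\<in>words n. \<mu> \<noteq> \<nu> \<longrightarrow> \<Phi> (S_word S \<mu> * star (S_word S \<nu>)) = 0)"

text \<open>
  The trace is a function on the whole type that is only constrained on the core.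
\<close>

definition canonical_trace :: "nat \<Rightarrow> (nat \<Rightarrow> 'a::cstar_algebra) \<Rightarrow> ('a \<Rightarrow> complex) \<Rightarrow> bool" where
  "canonical_trace n S \<tau> \<longleftrightarrow>
     (\<forall>a\<in>core n S. \<forall>b\<in>core n S. \<tau> (a + b) = \<tau> a + \<tau> b) \<and>
     (\<forall>c. \<forall>a\<in>core n S. \<tau> (c *\<^sub>C a) = c * \<tau> a) \<and>
     (\<forall>a\<in>core n S. Im (\<tau> (star a * a)) = 0 \<and> 0 \<le> Re (\<tau> (star a * a))) \<and>
     \<tau> 1 = 1 \<and>
     (\<forall>a\<in>core n S. \<forall>b\<in>core n S. \<tau> (a * b) = \<tau> (b * a)) \<and>
     (\<forall>k. \<forall>\<mu>\<in>words_of_length n k. \<forall>\<nu>\<in>words_of_length n k.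
        \<tau> (S_word S \<mu> * star (S_word S \<nu>)) = (if \<mu> = \<nu> then 1 / of_nat n ^ k else 0))"

definition two_norm :: "('a::cstar_algebra \<Rightarrow> complex) \<Rightarrow> 'a \<Rightarrow> real" where
  "two_norm \<tau> a = sqrt (Re (\<tau> (star a * a)))"

end

theory Submission
  imports Defs
begin

text \<open>
  All estimates are made with the state \<open>\<psi>\<close> on the Cuntz algebra that extends the trace and kills
  \<open>S\<^sub>\<alpha> S\<^sub>\<beta>\<^sup>*\<close> for \<open>\<alpha> \<noteq> \<beta>\<close>; it is the norm limit of the iterates of
  \<open>x \<mapsto> 1/n \<Sum> S\<^sub>i\<^sup>* x S\<^sub>i\<close>, and the core lies in its centralizer.

  Maximality: write \<open>V\<^sub>m = U\<^sub>1 \<cdots> U\<^sub>m\<close>. The contractions \<open>x \<mapsto> V\<^sub>m \<Phi>(V\<^sub>m\<^sup>* x V\<^sub>m) V\<^sub>m\<^sup>*\<close> converge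
  pointwise to a map \<open>C\<close> into \<open>A\<close>. If \<open>x\<close> commutes with \<open>A\<close>, its Fourier coefficients of nonzero
  degree vanish: it commutes with symmetries \<open>g \<in> A\<close> arbitrarily far out, these are asymptotically
  independent of \<open>x\<close>, and \<open>g\<close> can be chosen far from its own shifts. Those of degree zero agree with the
  coefficients of \<open>C x\<close>. Hence \<open>\<psi>(y (x - C x)) = 0\<close> for all \<open>y\<close>, and \<open>x = C x\<close> since \<open>\<Phi>\<close> is faithful.

  Non-conjugacy: if \<open>w A w\<^sup>*\<close> is the diagonal, then the products \<open>v\<close> of the
  \<open>U\<^sub>k d\<^sub>k U\<^sub>k\<^sup>*\<close> over long blocks of large \<open>k\<close> satisfy \<open>\<parallel>\<Phi>(w v w\<^sup>*)\<parallel>\<^sub>2 = 1\<close>.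
  But approximating \<open>w\<close> by a polynomial in the generators bounds this norm, up to a small error, by a
  constant multiple of \<open>\<parallel>\<Phi>(v)\<parallel>\<^sub>2\<close>, which is at most the product of the \<open>c\<^sub>k\<close> over the block.
\<close>

section \<open>C*-algebra preliminaries\<close>

text \<open>The Cuntz algebra has no tracial state, so 2-norm arguments for MASAs would stop at the
  core; \<open>\<psi>\<close> takes over. It is tracial up to powers of \<open>n\<close>, and these
  cancel in degree zero, where all \<open>U\<^sub>k\<close> and \<open>d\<^sub>k\<close> live. The
  products \<open>V\<^sub>m\<close> need not converge, and conjugation by them is eventually
  constant only on finite core levels. On monomials of nonzero degree \<open>C\<close> is zero
  because \<open>\<Phi>\<close> kills them, so \<open>C\<close> says nothing about the nonzero
  degrees of \<open>x\<close>; hence the separate argument for those coefficients. A symmetry may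
  lie close to its own shift, so it is chosen for the given difference of word lengths: random signs
  leave \<open>n^r\<close> diagonal terms of at most \<open>1 / (2 * n^r)\<close> each. The
  resulting bound 1/2 matters only in being below 1. In the non-conjugacy part the constant depends
  on the polynomial approximating \<open>w\<close>. The block must therefore be chosen after that
  polynomial and start beyond the lengths of its words, which is possible because every tail of the
  product of the \<open>c\<^sub>k\<close> also tends to 0.\<close>

lemma star_zero [simp]: "star (0 :: 'a::cstar_algebra) = 0"
  using star_add[of "0::'a" 0] by simp

lemma star_scaleR: "star (r *\<^sub>R x) = r *\<^sub>R star (x :: 'a::cstar_algebra)"
  by (metis scaleC_of_real star_scaleC complex_cnj_complex_of_real)

lemma norm_star [simp]: "norm (star x) = norm (x :: 'a::cstar_algebra)"
proof -
  have le: "norm x \<le> norm (star x)" for x :: 'a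
  proof (cases "x = 0")
    case False
    have "norm x * norm x \<le> norm (star x) * norm x"
      using cstar_identity[of x] norm_mult_ineq[of "star x" x] by (simp add: power2_eq_square)
    then show ?thesis using False by simp
  qed simp
  from le[of x] le[of "star x"] show ?thesis by (simp add: star_star)
qed

lemma bounded_linear_star: "bounded_linear (star :: 'a::cstar_algebra \<Rightarrow> 'a)"
  by (rule bounded_linear_intro[where K=1]) (simp_all add: star_add star_scaleR)

lemma bounded_linear_scaleC: "bounded_linear (\<lambda>x :: 'a::cstar_algebra. c *\<^sub>C x)"
proof (rule bounded_linear_intro[where K="cmod c"])
  show "c *\<^sub>C (r *\<^sub>R x) = r *\<^sub>R (c *\<^sub>C x)" for r and x :: 'a
    by (metis scaleC_of_real scaleC_scaleC mult.commute)
qed (simp_all add: scaleC_add_right norm_scaleC mult.commute)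

lemmas star_sum = linear_sum[OF bounded_linear.linear[OF bounded_linear_star]]
lemmas star_diff = linear_diff[OF bounded_linear.linear[OF bounded_linear_star]]
lemmas tendsto_star = bounded_linear.tendsto[OF bounded_linear_star]
lemmas tendsto_scaleC = bounded_linear.tendsto[OF bounded_linear_scaleC]
lemmas continuous_on_star = bounded_linear.continuous_on[OF bounded_linear_star]

lemma star_one [simp]: "star (1 :: 'a::cstar_algebra) = 1"
  by (metis mult_1 mult.right_neutral star_mult star_star)

lemma scaleC_zero [simp]: "c *\<^sub>C (0 :: 'a::cstar_algebra) = 0" "0 *\<^sub>C (x :: 'a::cstar_algebra) = 0"
  by (simp_all add: complex_vector.scale_zero_left)

lemma scaleC_sum_right: "c *\<^sub>C (\<Sum>i\<in>I. f i) = (\<Sum>i\<in>I. c *\<^sub>C (f i :: 'a::cstar_algebra))"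
  by (rule complex_vector.scale_sum_right)

lemma norm_scaleC_one [simp]: "norm (c *\<^sub>C (1 :: 'a::cstar_algebra)) = cmod c"
  by (simp add: norm_scaleC)

lemma scaleC_one_inject [simp]: "c *\<^sub>C (1 :: 'a::cstar_algebra) = d *\<^sub>C 1 \<longleftrightarrow> c = d"
  by (metis complex_vector.scale_right_imp_eq zero_neq_one)

lemma norm_isometry: "star x * x = 1 \<Longrightarrow> norm (x :: 'a::cstar_algebra) = 1"
  using cstar_identity[of x] norm_ge_zero[of x] by (metis norm_one power2_eq_1_iff
    zero_le_one neg_0_le_iff_le not_one_le_zero)

lemma norm_unitary: "unitary u \<Longrightarrow> norm u = 1"
  unfolding unitary_def by (blast intro: norm_isometry)

lemma unitary_star: "unitary u \<Longrightarrow> unitary (star u)"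
  by (simp add: unitary_def star_star)

lemma unitary_mult: "unitary u \<Longrightarrow> unitary v \<Longrightarrow> unitary (u * v)"
  unfolding unitary_def star_mult
  by (metis (no_types, opaque_lifting) mult.assoc mult.left_neutral)

lemma unitary_cancel:
  assumes "unitary u"
  shows "star u * (u * x) = x" "u * (star u * x) = x" "star u * u = 1" "u * star u = 1"
  using assms unfolding unitary_def by (simp_all flip: mult.assoc)

lemma norm_conj_unitary_le: "unitary u \<Longrightarrow> norm (u * x * star u) \<le> norm x"
  by (metis mult.left_neutral mult.right_neutral norm_mult_ineq norm_star norm_unitary order_trans)

lemma norm_selfadjoint_idempotent:
  assumes "star p = p" "p * p = (p :: 'a::cstar_algebra)"
  shows "norm p \<le> 1"
  using cstar_identity[of p] assms
  by (metis dual_order.refl mult_cancel_right1 norm_zero norm_eq_zero power2_eq_square zero_le_one)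

lemma cstar_subalgebra_generated: "cstar_subalgebra (cstar_generated X)"
proof (rule hull_in)
  fix \<T> :: "'a set set"
  assume "Ball \<T> cstar_subalgebra"
  then show "cstar_subalgebra (\<Inter>\<T>)"
    unfolding cstar_subalgebra_def complex_vector.subspace_def by auto
qed

section \<open>Commutants and limits of contractions\<close>

definition commutant :: "'a::cstar_algebra set \<Rightarrow> 'a set" where
  "commutant X = {y. \<forall>x\<in>X. x * y = y * x}"

lemma cstar_subalgebra_commutant:
  assumes "\<And>x. x \<in> X \<Longrightarrow> star x \<in> X"
  shows "cstar_subalgebra (commutant X)"
  unfolding cstar_subalgebra_def
proof (intro conjI ballI)
  show "complex_vector.subspace (commutant X)"
    unfolding complex_vector.subspace_def commutant_def
    by (simp add: distrib_left distrib_right scaleC_mult_left scaleC_mult_right)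
  have "commutant X = (\<Inter>x\<in>X. {y. x * y = y * x})"
    by (auto simp: commutant_def)
  also have "closed \<dots>"
    by (intro closed_INT ballI closed_Collect_eq continuous_intros)
  finally show "closed (commutant X)" .
  show "y * z \<in> commutant X" if "y \<in> commutant X" "z \<in> commutant X" for y z
  proof -
    have "x * (y * z) = y * z * x" if "x \<in> X" for x
    proof -
      have "x * y = y * x" "x * z = z * x"
        using that \<open>y \<in> commutant X\<close> \<open>z \<in> commutant X\<close> by (auto simp: commutant_def)
      then show ?thesis by (metis mult.assoc)
    qed
    then show ?thesis by (simp add: commutant_def)
  qed
  show "star y \<in> commutant X" if "y \<in> commutant X" for y
  proof -
    have "x * star y = star y * x" if "x \<in> X" for x
    proof -
      have "star x * y = y * star x"
        using \<open>y \<in> commutant X\<close> assms[OF that] by (simp add: commutant_def)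
      then have "star (star x * y) = star (y * star x)" by simp
      then show ?thesis by (simp add: star_mult star_star)
    qed
    then show ?thesis by (simp add: commutant_def)
  qed
qed

text \<open>Two passes through commutants, each a C*-subalgebra because its set is closed under
  \<open>star\<close>: \<open>X\<close> lies in its commutant, so \<open>?A\<close> does; hence
  \<open>X\<close> lies in the commutant of \<open>?A\<close>, and so does
  \<open>?A\<close>.\<close>

lemma abelian_generated:
  assumes star: "\<And>x. x \<in> X \<Longrightarrow> star x \<in> X"
    and comm: "\<And>x y. x \<in> X \<Longrightarrow> y \<in> X \<Longrightarrow> x * y = y * x"
  shows "abelian (cstar_generated X)"
proof -
  let ?A = "cstar_generated X"
  have "X \<subseteq> commutant X"
    using comm by (auto simp: commutant_def)
  then have "?A \<subseteq> commutant X"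
    by (rule hull_minimal) (rule cstar_subalgebra_commutant[OF star])
  then have comm': "x * y = y * x" if "y \<in> ?A" "x \<in> X" for x y
    using subsetD[of ?A "commutant X" y] that by (simp add: commutant_def)
  have "X \<subseteq> commutant ?A"
    using comm'[symmetric] by (auto simp: commutant_def)
  then have "?A \<subseteq> commutant ?A"
    by (rule hull_minimal)
      (rule cstar_subalgebra_commutant,
        use cstar_subalgebra_generated[of X] in \<open>simp add: cstar_subalgebra_def\<close>)
  then have "y \<in> commutant ?A" if "y \<in> ?A" for y
    using that by (rule subsetD)
  then show ?thesis
    by (simp add: abelian_def commutant_def)
qed

text \<open>A three-epsilon argument: the maps are uniformly contractive, so convergence passes to
  norm limits of points, and closedness of \<open>A\<close> keeps the limit in \<open>A\<close>.
  Together with \<open>density_induct\<close> it reduces convergence on the whole algebra to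
  monomials.\<close>

lemma closed_contractive_limits:
  fixes T :: "nat \<Rightarrow> 'a::cstar_algebra \<Rightarrow> 'a"
  assumes diff: "\<And>m x y. T m (x - y) = T m x - T m y"
    and contr: "\<And>m x. norm (T m x) \<le> norm x"
    and A: "closed A"
  shows "closed {x. \<exists>a\<in>A. (\<lambda>m. T m x) \<longlonglongrightarrow> a}"
proof (rule closed_sequential_limits[THEN iffD2], intro allI impI, elim conjE)
  fix x l assume "\<forall>i. x i \<in> {x. \<exists>a\<in>A. (\<lambda>m. T m x) \<longlonglongrightarrow> a}" and lim: "x \<longlonglongrightarrow> l"
  then obtain a where aA: "\<And>i. a i \<in> A" and a: "\<And>i. (\<lambda>m. T m (x i)) \<longlonglongrightarrow> a i"
    by simp metis
  have close: "norm (T m l - T m (x i)) \<le> norm (l - x i)" for m i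
    using contr[of m "l - x i"] by (simp add: diff)
  have "Cauchy (\<lambda>m. T m l)"
  proof (rule CauchyI)
    fix e :: real assume "0 < e"
    then obtain i where i: "norm (l - x i) < e / 3"
      using LIMSEQ_D[OF lim, of "e / 3"] by (auto simp: norm_minus_commute)
    obtain M where M: "\<And>m k. m \<ge> M \<Longrightarrow> k \<ge> M \<Longrightarrow> norm (T m (x i) - T k (x i)) < e / 3"
      using LIMSEQ_imp_Cauchy[OF a[of i]] \<open>0 < e\<close> unfolding Cauchy_iff
      by (metis divide_pos_pos zero_less_numeral)
    have "norm (T m l - T k l) < e" if "m \<ge> M" "k \<ge> M" for m k
    proof -
      have "T m l - T k l = (T m l - T m (x i)) + (T m (x i) - T k (x i)) - (T k l - T k (x i))"
        by simp
      also have "norm \<dots> \<le> norm (T m l - T m (x i)) + norm (T m (x i) - T k (x i))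
          + norm (T k l - T k (x i))"
        by (meson norm_triangle_ineq norm_triangle_ineq4 order_trans add_right_mono)
      also have "\<dots> < e"
        using close[of m i] close[of k i] M[OF that] i by linarith
      finally show ?thesis .
    qed
    then show "\<exists>M. \<forall>m\<ge>M. \<forall>k\<ge>M. norm (T m l - T k l) < e" by blast
  qed
  then obtain b where b: "(\<lambda>m. T m l) \<longlonglongrightarrow> b"
    using Cauchy_convergent convergent_def by blast
  have "norm (b - a i) \<le> norm (l - x i)" for i
    by (rule LIMSEQ_le_const2[OF tendsto_norm[OF tendsto_diff[OF b a]]]) (use close in blast)
  moreover have "(\<lambda>i. norm (l - x i)) \<longlonglongrightarrow> 0"
    using tendsto_norm[OF tendsto_diff[OF tendsto_const lim, of l]] by simp
  ultimately have "(\<lambda>i. b - a i) \<longlonglongrightarrow> 0"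
    by (rule Lim_null_comparison[OF always_eventually[OF allI]])
  then have "a \<longlonglongrightarrow> b"
    using tendsto_diff[OF tendsto_const[of b], of "\<lambda>i. b - a i" 0 sequentially] by simp
  then have "b \<in> A"
    using A aA closed_sequentially by blast
  with b show "l \<in> {x. \<exists>a\<in>A. (\<lambda>m. T m x) \<longlonglongrightarrow> a}" by blast
qed

section \<open>Orthogonality of isometries whose range projections add up to one\<close>

text \<open>
  The value of \<open>(P + Q)^m\<close> expanded into noncommutative monomials, each monomial weighted by
  \<open>g\<close> at the number of factors \<open>P\<close> minus the number of factors \<open>Q\<close>.
\<close>

primrec weighted_power ::
    "'a::real_normed_algebra_1 \<Rightarrow> 'a \<Rightarrow> nat \<Rightarrow> (real \<Rightarrow> real) \<Rightarrow> 'a" where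
  "weighted_power P Q 0 g = of_real (g 0)"
| "weighted_power P Q (Suc m) g =
    P * weighted_power P Q m (\<lambda>z. g (z + 1)) + Q * weighted_power P Q m (\<lambda>z. g (z - 1))"

text \<open>The bounds 1/2 act as the step probabilities of a simple random walk, and each step
  raises the second moment by one: the mean of \<open>(c + 1)\<^sup>2\<close> and
  \<open>(c - 1)\<^sup>2\<close> is \<open>c\<^sup>2 + 1\<close>.\<close>

lemma norm_weighted_power:
  assumes "norm P \<le> 1 / 2" "norm Q \<le> 1 / 2" "\<And>z. \<bar>g z\<bar> \<le> \<alpha> + \<beta> * (z + c)\<^sup>2"
  shows "norm (weighted_power P Q m g) \<le> \<alpha> + \<beta> * (c\<^sup>2 + m)"
  using assms(3)
proof (induction m arbitrary: g c)
  case 0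
  then show ?case using 0[of 0] by simp
next
  case (Suc m)
  have 1: "norm (weighted_power P Q m (\<lambda>z. g (z + 1))) \<le> \<alpha> + \<beta> * ((c + 1)\<^sup>2 + m)"
    by (rule Suc.IH) (use Suc.prems in \<open>metis add.assoc add.commute\<close>)
  have 2: "norm (weighted_power P Q m (\<lambda>z. g (z - 1))) \<le> \<alpha> + \<beta> * ((c - 1)\<^sup>2 + m)"
    by (rule Suc.IH) (use Suc.prems[of "_ - 1"] in \<open>simp add: algebra_simps\<close>)
  have "norm (weighted_power P Q (Suc m) g)
      \<le> norm P * norm (weighted_power P Q m (\<lambda>z. g (z + 1)))
        + norm Q * norm (weighted_power P Q m (\<lambda>z. g (z - 1)))"
    by (simp add: norm_triangle_le add_mono norm_mult_ineq)
  also have "\<dots> \<le> 1 / 2 * (\<alpha> + \<beta> * ((c + 1)\<^sup>2 + m)) + 1 / 2 * (\<alpha> + \<beta> * ((c - 1)\<^sup>2 + m))"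
    by (intro add_mono mult_mono 1 2 assms(1,2)) auto
  also have "\<dots> = \<alpha> + \<beta> * (c\<^sup>2 + Suc m)"
    by (simp add: power2_eq_square algebra_simps)
  finally show ?case .
qed

lemma weighted_power_linear:
  assumes "P + Q = 1"
  shows "weighted_power P Q m (\<lambda>z. z + c) = of_nat m * (P - Q) + of_real c"
proof (induction m arbitrary: c)
  case (Suc m)
  have "weighted_power P Q (Suc m) (\<lambda>z. z + c)
      = P * weighted_power P Q m (\<lambda>z. z + (1 + c)) + Q * weighted_power P Q m (\<lambda>z. z + (c - 1))"
    by (simp add: algebra_simps)
  also have "\<dots> = (P + Q) * (of_nat m * (P - Q) + of_real c) + (P - Q)"
    unfolding Suc by (simp add: algebra_simps)
  finally show ?case using assms by (simp add: algebra_simps)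
qed simp

text \<open>
  With \<open>P = (1 + b) / 2\<close> and \<open>Q = (1 - b) / 2\<close>, the element \<open>m b\<close> is the weighted power for the
  weight \<open>z\<close>, whose norm is at most the mean absolute position, about \<open>\<surd>m\<close>, of a simple random walk.
\<close>

lemma one_extreme_point:
  fixes b :: "'a::real_normed_algebra_1"
  assumes "norm (1 + b) \<le> 1" "norm (1 - b) \<le> 1"
  shows "b = 0"
proof -
  define P Q where "P = (1 / 2 :: real) *\<^sub>R (1 + b)" and "Q = (1 / 2 :: real) *\<^sub>R (1 - b)"
  have PQ: "P + Q = 1" "P - Q = b"
    unfolding P_def Q_def by (simp_all add: algebra_simps flip: scaleR_add_left)
  have nPQ: "norm P \<le> 1 / 2" "norm Q \<le> 1 / 2"
    using assms by (simp_all add: P_def Q_def)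
  \<comment> \<open>After \<open>K\<^sup>2\<close> steps the walk is typically at distance
    \<open>K\<close>. The quadratic majorant of \<open>\<bar>z\<bar>\<close> touches it at distance
    \<open>K\<close>, so \<open>K\<^sup>2\<close> times the norm of \<open>b\<close> is at most
    \<open>K\<close>.\<close>
  have bound: "norm b \<le> 1 / K" if "K > 0" for K :: nat
  proof -
    have "\<bar>z\<bar> \<le> real K / 2 + 1 / (2 * K) * (z + 0)\<^sup>2" for z :: real
    proof -
      have "0 \<le> (\<bar>z\<bar> - K)\<^sup>2" by simp
      then have "2 * K * \<bar>z\<bar> \<le> K\<^sup>2 + z\<^sup>2" by (simp add: power2_eq_square algebra_simps)
      then show ?thesis using that by (simp add: field_simps power2_eq_square)
    qed
    then have "norm (weighted_power P Q (K\<^sup>2) (\<lambda>z. z))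
        \<le> real K / 2 + 1 / (2 * K) * ((0 :: real)\<^sup>2 + real (K\<^sup>2))"
      by (rule norm_weighted_power[OF nPQ])
    also have "\<dots> = K" using that by (simp add: field_simps power2_eq_square)
    also have "weighted_power P Q (K\<^sup>2) (\<lambda>z. z) = of_nat (K\<^sup>2) * b"
      using weighted_power_linear[OF PQ(1), of "K\<^sup>2" 0] by (simp add: PQ(2))
    also have "norm \<dots> = real (K\<^sup>2) * norm b"
      by (metis of_real_of_nat_eq norm_scaleR scaleR_conv_of_real real_norm_def abs_of_nat)
    finally show ?thesis using that by (simp add: field_simps power2_eq_square)
  qed
  have "norm b \<le> 0"
  proof (rule field_le_epsilon)
    fix e :: real assume "0 < e"
    then obtain K :: nat where "K > 0" "1 / K < e"
      by (metis nat_approx_posE zero_less_Suc)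
    with bound[of K] show "norm b \<le> 0 + e" by linarith
  qed
  then show ?thesis by simp
qed

text \<open>Compress by \<open>S i\<close>: the elements \<open>a k\<close> add up to 1 and
  \<open>a i\<close> is already 1, so the others add up to 0. Each \<open>1 - a k\<close> is a
  contraction, being the compression of a projection. Then 1 plus and minus
  \<open>(1 / N) *\<^sub>R a j\<close> both lie in the unit ball, and extremality of 1 gives
  \<open>a j = 0\<close>; finally \<open>a j = star z * z\<close> with
  \<open>z = star (S j) * S i\<close>.\<close>

lemma isometries_orthogonal:
  fixes S :: "'i \<Rightarrow> 'a::cstar_algebra"
  assumes fin: "finite I"
    and iso: "\<And>i. i \<in> I \<Longrightarrow> star (S i) * S i = 1"
    and sum: "(\<Sum>i\<in>I. S i * star (S i)) = 1"
    and ij: "i \<in> I" "j \<in> I" "i \<noteq> j"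
  shows "star (S i) * S j = 0"
proof -
  define a where "a k = star (S i) * (S k * star (S k)) * S i" for k
  define J where "J = I - {i} - {j}"
  have I: "I = insert i (insert j J)" "finite J" "i \<notin> J" "j \<notin> J"
    using ij fin by (auto simp: J_def)
  have contr: "norm (1 - a k) \<le> 1" if "k \<in> I" for k
  proof -
    have "norm (1 - S k * star (S k)) \<le> 1"
    proof (rule norm_selfadjoint_idempotent)
      have "S k * star (S k) * (S k * star (S k)) = S k * star (S k)"
        by (metis iso[OF that] mult.assoc mult.right_neutral)
      then show "(1 - S k * star (S k)) * (1 - S k * star (S k)) = 1 - S k * star (S k)"
        by (simp add: algebra_simps)
    qed (simp add: star_diff star_mult star_star)
    moreover have "1 - a k = star (S i) * (1 - S k * star (S k)) * S i"
      unfolding a_def using iso[OF ij(1)] by (simp add: algebra_simps)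
    moreover have "norm (star (S i)) = 1" "norm (S i) = 1"
      using norm_isometry[OF iso[OF ij(1)]] by auto
    ultimately show ?thesis
      by (metis (no_types, lifting) norm_mult_ineq mult.left_neutral mult.right_neutral order_trans)
  qed
  have "a i = 1"
    using iso[OF ij(1)] by (simp add: a_def flip: mult.assoc)
  moreover have "(\<Sum>k\<in>I. a k) = star (S i) * (\<Sum>k\<in>I. S k * star (S k)) * S i"
    unfolding a_def by (simp add: sum_distrib_left sum_distrib_right)
  ultimately have sum0: "a j = - (\<Sum>k\<in>J. a k)"
    using sum iso[OF ij(1)] I ij(3) by (simp add: add_eq_0_iff2)
  \<comment> \<open>One unit for the leading 1 and one for each \<open>k\<close> in
    \<open>J\<close>: since \<open>a j\<close> is minus the sum over \<open>J\<close>, adding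
    \<open>N\<close> copies of 1 turns it into a sum of \<open>N\<close> contractions.\<close>
  define N where "N = real (card J) + 1"
  have "N *\<^sub>R 1 + a j = 1 + (\<Sum>k\<in>J. 1 - a k)"
  proof -
    have "real (card J) *\<^sub>R (1 :: 'a) = (\<Sum>k\<in>J. 1)"
      by (simp add: scaleR_conv_of_real)
    then have "N *\<^sub>R (1 :: 'a) = (\<Sum>k\<in>J. 1) + 1"
      by (metis N_def scaleR_add_left scaleR_one)
    moreover have "(\<Sum>k\<in>J. 1 - a k) = (\<Sum>k\<in>J. 1) - (\<Sum>k\<in>J. a k)"
      by (rule sum_subtractf)
    ultimately show ?thesis
      unfolding sum0 by (metis add.commute add_diff_eq diff_conv_add_uminus)
  qed
  also have "norm \<dots> \<le> 1 + (\<Sum>k\<in>J. norm (1 - a k))"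
    by (rule norm_triangle_le) (simp add: norm_sum)
  also have "(\<Sum>k\<in>J. norm (1 - a k)) \<le> (\<Sum>k\<in>J. 1)"
    by (rule sum_mono) (use contr I in auto)
  finally have plus: "norm (N *\<^sub>R 1 + a j) \<le> N" by (simp add: N_def)
  have "N *\<^sub>R 1 - a j = (N - 1) *\<^sub>R 1 + (1 - a j)" by (simp add: algebra_simps)
  also have "norm \<dots> \<le> (N - 1) + 1"
    using contr[OF ij(2)] by (intro norm_triangle_le add_mono) (auto simp: N_def)
  finally have minus: "norm (N *\<^sub>R 1 - a j) \<le> N" by simp
  have "N > 0" by (simp add: N_def)
  have "(1 / N) *\<^sub>R a j = 0"
  proof (rule one_extreme_point)
    have "1 + (1 / N) *\<^sub>R a j = (1 / N) *\<^sub>R (N *\<^sub>R 1 + a j)"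
      using \<open>N > 0\<close> by (simp add: scaleR_add_right)
    then show "norm (1 + (1 / N) *\<^sub>R a j) \<le> 1" using plus \<open>N > 0\<close> by simp
    have "1 - (1 / N) *\<^sub>R a j = (1 / N) *\<^sub>R (N *\<^sub>R 1 - a j)"
      using \<open>N > 0\<close> by (simp add: scaleR_diff_right)
    then show "norm (1 - (1 / N) *\<^sub>R a j) \<le> 1" using minus \<open>N > 0\<close> by simp
  qed
  then have "a j = 0" using \<open>N > 0\<close> by simp
  then have "star (star (S j) * S i) * (star (S j) * S i) = 0"
    by (simp add: a_def star_mult star_star mult.assoc)
  then have "star (S j) * S i = 0"
    using cstar_identity[of "star (S j) * S i"] by simp
  then show ?thesis
    by (metis star_mult star_star star_zero)
qed

section \<open>Words in the isometries\<close>

lemma span_mult_closed: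
  fixes X Y Z :: "'a::cstar_algebra set"
  assumes "\<And>x y. x \<in> X \<Longrightarrow> y \<in> Y \<Longrightarrow> x * y \<in> complex_vector.span Z"
    and x: "x \<in> complex_vector.span X" and y: "y \<in> complex_vector.span Y"
  shows "x * y \<in> complex_vector.span Z"
  using x
proof (induction rule: complex_vector.span_induct)
  case base
  show ?case
    by (simp add: complex_vector.subspace_def complex_vector.span_zero complex_vector.span_add
        complex_vector.span_scale distrib_right scaleC_mult_left)
next
  case (step x)
  show ?case using y
  proof (induction rule: complex_vector.span_induct)
    case base
    show ?case
      by (simp add: complex_vector.subspace_def complex_vector.span_zero complex_vector.span_add
          complex_vector.span_scale distrib_left scaleC_mult_right)
  qed (use assms step in blast)
qed

text \<open>The factor \<open>g c\<close> lets the same induction serve linear maps and the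
  conjugate-linear \<open>star\<close>.\<close>

lemma span_linear_image:
  fixes f :: "'a::cstar_algebra \<Rightarrow> 'a"
  assumes add: "\<And>x y. f (x + y) = f x + f y" and scale: "\<And>c x. f (c *\<^sub>C x) = g c *\<^sub>C f x"
    and X: "\<And>x. x \<in> X \<Longrightarrow> f x \<in> V" and V: "complex_vector.subspace V"
    and x: "x \<in> complex_vector.span X"
  shows "f x \<in> V"
  using x
proof (induction rule: complex_vector.span_induct)
  case base
  have "f 0 = 0" using add[of 0 0] by simp
  then show ?case
    using V by (simp add: complex_vector.subspace_def add scale)
qed (use X in blast)

section \<open>Combinatorics of words\<close>

lemma words_Nil [simp]: "[] \<in> words n"
  by (simp add: words_def)

lemma words_Cons [simp]: "i # \<mu> \<in> words n \<longleftrightarrow> i \<in> {1..n} \<and> \<mu> \<in> words n"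
  by (auto simp: words_def)

lemma words_append [simp]: "\<mu> @ \<nu> \<in> words n \<longleftrightarrow> \<mu> \<in> words n \<and> \<nu> \<in> words n"
  by (auto simp: words_def)

lemma words_of_length_0 [simp]: "words_of_length n 0 = {[]}"
  by (auto simp: words_of_length_def)

lemma words_of_length_Suc:
  "words_of_length n (Suc k) = (\<lambda>(i, \<mu>). i # \<mu>) ` ({1..n} \<times> words_of_length n k)"
  by (auto simp: words_of_length_def length_Suc_conv image_iff)

lemma words_of_lengthD:
  assumes "\<mu> \<in> words_of_length n k"
  shows "\<mu> \<in> words n" "length \<mu> = k"
  using assms by (auto simp: words_of_length_def)

lemma finite_words_of_length [simp]: "finite (words_of_length n k)"
  by (induction k) (simp_all add: words_of_length_Suc)

lemma sum_words_Suc: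
  "(\<Sum>\<mu>\<in>words_of_length n (Suc k). f \<mu>) = (\<Sum>i=1..n. \<Sum>\<mu>\<in>words_of_length n k. f (i # \<mu>))"
proof -
  have "(\<Sum>\<mu>\<in>words_of_length n (Suc k). f \<mu>)
      = (\<Sum>p\<in>{1..n} \<times> words_of_length n k. f (fst p # snd p))"
    unfolding words_of_length_Suc
    by (subst sum.reindex) (auto simp: inj_on_def case_prod_unfold)
  then show ?thesis by (simp add: sum.cartesian_product case_prod_unfold)
qed

lemma card_words_of_length: "card (words_of_length n k) = n ^ k"
proof (induction k)
  case (Suc k)
  have "card (words_of_length n (Suc k)) = (\<Sum>\<mu>\<in>words_of_length n (Suc k). 1)" by simp
  also have "\<dots> = n ^ Suc k" unfolding sum_words_Suc using Suc by simp
  finally show ?case .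
qed simp

section \<open>Word calculus for Cuntz isometries\<close>

locale cuntz_system =
  fixes n :: nat and S :: "nat \<Rightarrow> 'a::cstar_algebra"
  assumes two_le: "2 \<le> n"
    and isometry: "\<And>i. i \<in> {1..n} \<Longrightarrow> star (S i) * S i = 1"
    and sum_ranges: "(\<Sum>i=1..n. S i * star (S i)) = 1"
    and generated: "cstar_generated (S ` {1..n}) = UNIV"
begin

abbreviation Sw :: "nat list \<Rightarrow> 'a" where "Sw \<equiv> S_word S"
abbreviation W :: "nat list set" where "W \<equiv> words n"
abbreviation Wl :: "nat \<Rightarrow> nat list set" where "Wl \<equiv> words_of_length n"
abbreviation shift_pow :: "nat \<Rightarrow> 'a \<Rightarrow> 'a" ("\<sigma>") where "\<sigma> m \<equiv> shift n S ^^ m"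
abbreviation munit :: "nat list \<Rightarrow> nat list \<Rightarrow> 'a" where "munit \<alpha> \<beta> \<equiv> Sw \<alpha> * star (Sw \<beta>)"

lemma n_pos: "n > 0" using two_le by simp

lemma star_S_S: "i \<in> {1..n} \<Longrightarrow> j \<in> {1..n} \<Longrightarrow> star (S i) * S j = (if i = j then 1 else 0)"
  using isometries_orthogonal[of "{1..n}" S i j] isometry sum_ranges by auto

lemma star_S_S_mult:
  "i \<in> {1..n} \<Longrightarrow> j \<in> {1..n} \<Longrightarrow> star (S i) * (S j * x) = (if i = j then x else 0)"
  by (simp add: star_S_S flip: mult.assoc)

lemma Sw_Nil [simp]: "Sw [] = 1" by (simp add: S_word_def)
lemma Sw_Cons [simp]: "Sw (i # \<mu>) = S i * Sw \<mu>" by (simp add: S_word_def)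
lemma Sw_append: "Sw (\<mu> @ \<nu>) = Sw \<mu> * Sw \<nu>" by (simp add: S_word_def)

lemma star_Sw_Sw_self [simp]: "\<mu> \<in> W \<Longrightarrow> star (Sw \<mu>) * Sw \<mu> = 1"
  by (induction \<mu>) (simp_all add: star_mult mult.assoc star_S_S_mult)

lemma norm_Sw [simp]: "\<mu> \<in> W \<Longrightarrow> norm (Sw \<mu>) = 1"
  by (simp add: norm_isometry)

text \<open>The first letter where the words differ kills the product by orthogonality. Without such
  a letter one word is a prefix of the other, and the common part cancels.\<close>

lemma star_Sw_Sw_cases:
  assumes "\<alpha> \<in> W" "\<beta> \<in> W"
  obtains "star (Sw \<alpha>) * Sw \<beta> = 0" "\<nexists>\<gamma>. \<beta> = \<alpha> @ \<gamma> \<or> \<alpha> = \<beta> @ \<gamma>"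
    | \<gamma> where "\<gamma> \<in> W" "\<beta> = \<alpha> @ \<gamma>" "star (Sw \<alpha>) * Sw \<beta> = Sw \<gamma>"
    | \<gamma> where "\<gamma> \<in> W" "\<alpha> = \<beta> @ \<gamma>" "star (Sw \<alpha>) * Sw \<beta> = star (Sw \<gamma>)"
proof -
  have "(star (Sw \<alpha>) * Sw \<beta> = 0 \<and> (\<nexists>\<gamma>. \<beta> = \<alpha> @ \<gamma> \<or> \<alpha> = \<beta> @ \<gamma>))
      \<or> (\<exists>\<gamma>\<in>W. \<beta> = \<alpha> @ \<gamma> \<and> star (Sw \<alpha>) * Sw \<beta> = Sw \<gamma>)
      \<or> (\<exists>\<gamma>\<in>W. \<alpha> = \<beta> @ \<gamma> \<and> star (Sw \<alpha>) * Sw \<beta> = star (Sw \<gamma>))"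
    using assms
  proof (induction \<alpha> arbitrary: \<beta>)
    case (Cons i \<alpha>)
    show ?case
    proof (cases \<beta>)
      case Nil
      then show ?thesis using Cons.prems by auto
    next
      case (Cons j \<beta>')
      have "star (Sw (i # \<alpha>)) * Sw \<beta> = (if i = j then star (Sw \<alpha>) * Sw \<beta>' else 0)"
        using Cons Cons.prems by (simp add: star_mult mult.assoc star_S_S_mult)
      then show ?thesis
        using Cons Cons.prems Cons.IH[of \<beta>'] by (cases "i = j") auto
    qed
  qed auto
  then show ?thesis using that by blast
qed

lemma star_Sw_Sw:
  assumes "\<alpha> \<in> Wl k" "\<beta> \<in> Wl k"
  shows "star (Sw \<alpha>) * Sw \<beta> = (if \<alpha> = \<beta> then 1 else 0)"
  using words_of_lengthD[OF assms(1)] words_of_lengthD[OF assms(2)]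
  by (auto elim: star_Sw_Sw_cases[of \<alpha> \<beta>])

lemma sum_munit: "(\<Sum>\<mu>\<in>Wl k. munit \<mu> \<mu>) = 1"
proof (induction k)
  case (Suc k)
  have "(\<Sum>\<mu>\<in>Wl (Suc k). munit \<mu> \<mu>) = (\<Sum>i=1..n. S i * (\<Sum>\<mu>\<in>Wl k. munit \<mu> \<mu>) * star (S i))"
    unfolding sum_words_Suc by (simp add: star_mult mult.assoc sum_distrib_left sum_distrib_right)
  then show ?case using sum_ranges by (simp add: Suc)
qed simp

subsection \<open>The grading\<close>

text \<open>The algebraic part of the spectral subspaces of the gauge action. \<open>Deg 0\<close>
  is the increasing union of the core levels.\<close>

definition Deg :: "int \<Rightarrow> 'a set" where
  "Deg d = complex_vector.span
    {munit \<alpha> \<beta> | \<alpha> \<beta>. \<alpha> \<in> W \<and> \<beta> \<in> W \<and> int (length \<alpha>) - int (length \<beta>) = d}"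

definition cuntz_poly :: "'a set" where
  "cuntz_poly = complex_vector.span {munit \<alpha> \<beta> | \<alpha> \<beta>. \<alpha> \<in> W \<and> \<beta> \<in> W}"

lemma subspace_Deg: "complex_vector.subspace (Deg d)"
  unfolding Deg_def by (rule complex_vector.subspace_span)

lemma munit_Deg: "\<alpha> \<in> W \<Longrightarrow> \<beta> \<in> W \<Longrightarrow> munit \<alpha> \<beta> \<in> Deg (int (length \<alpha>) - int (length \<beta>))"
  unfolding Deg_def by (rule complex_vector.span_base) blast

lemma munit_mult_cases:
  assumes "\<alpha> \<in> W" "\<beta> \<in> W" "\<gamma> \<in> W" "\<delta> \<in> W"
  obtains "munit \<alpha> \<beta> * munit \<gamma> \<delta> = 0"
    | \<epsilon> where "\<epsilon> \<in> W" "\<gamma> = \<beta> @ \<epsilon>" "munit \<alpha> \<beta> * munit \<gamma> \<delta> = munit (\<alpha> @ \<epsilon>) \<delta>"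
    | \<epsilon> where "\<epsilon> \<in> W" "\<beta> = \<gamma> @ \<epsilon>" "munit \<alpha> \<beta> * munit \<gamma> \<delta> = munit \<alpha> (\<delta> @ \<epsilon>)"
proof -
  have eq: "munit \<alpha> \<beta> * munit \<gamma> \<delta> = Sw \<alpha> * (star (Sw \<beta>) * Sw \<gamma>) * star (Sw \<delta>)"
    by (simp add: mult.assoc)
  show ?thesis
    by (rule star_Sw_Sw_cases[OF assms(2,3)])
      (use eq that in \<open>auto simp: Sw_append star_mult mult.assoc\<close>)
qed

lemma Deg_mult: "x \<in> Deg a \<Longrightarrow> y \<in> Deg b \<Longrightarrow> x * y \<in> Deg (a + b)"
  unfolding Deg_def
proof (rule span_mult_closed)
  fix x y
  assume "x \<in> {munit \<alpha> \<beta> | \<alpha> \<beta>. \<alpha> \<in> W \<and> \<beta> \<in> W \<and> int (length \<alpha>) - int (length \<beta>) = a}"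
    and "y \<in> {munit \<alpha> \<beta> | \<alpha> \<beta>. \<alpha> \<in> W \<and> \<beta> \<in> W \<and> int (length \<alpha>) - int (length \<beta>) = b}"
  then obtain \<alpha> \<beta> \<gamma> \<delta> where W: "\<alpha> \<in> W" "\<beta> \<in> W" "\<gamma> \<in> W" "\<delta> \<in> W"
    and xy: "x = munit \<alpha> \<beta>" "y = munit \<gamma> \<delta>"
    and ab: "a = int (length \<alpha>) - int (length \<beta>)" "b = int (length \<gamma>) - int (length \<delta>)"
    by auto
  have "x * y \<in> Deg (a + b)"
    unfolding xy
  proof (rule munit_mult_cases[OF W])
    fix \<epsilon> assume "\<epsilon> \<in> W" "\<gamma> = \<beta> @ \<epsilon>" "munit \<alpha> \<beta> * munit \<gamma> \<delta> = munit (\<alpha> @ \<epsilon>) \<delta>"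
    then show "munit \<alpha> \<beta> * munit \<gamma> \<delta> \<in> Deg (a + b)"
      using munit_Deg[of "\<alpha> @ \<epsilon>" \<delta>] W by (simp add: ab algebra_simps)
  next
    fix \<epsilon> assume "\<epsilon> \<in> W" "\<beta> = \<gamma> @ \<epsilon>" "munit \<alpha> \<beta> * munit \<gamma> \<delta> = munit \<alpha> (\<delta> @ \<epsilon>)"
    then show "munit \<alpha> \<beta> * munit \<gamma> \<delta> \<in> Deg (a + b)"
      using munit_Deg[of \<alpha> "\<delta> @ \<epsilon>"] W by (simp add: ab algebra_simps)
  qed (simp add: complex_vector.subspace_0[OF subspace_Deg])
  then show "x * y \<in> complex_vector.span
      {munit \<alpha> \<beta> | \<alpha> \<beta>. \<alpha> \<in> W \<and> \<beta> \<in> W \<and> int (length \<alpha>) - int (length \<beta>) = a + b}"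
    by (simp add: Deg_def)
qed

lemma Deg_star:
  assumes "x \<in> Deg d"
  shows "star x \<in> Deg (- d)"
proof (rule span_linear_image[OF star_add star_scaleC _ subspace_Deg assms[unfolded Deg_def]])
  fix x assume "x \<in> {munit \<alpha> \<beta> | \<alpha> \<beta>. \<alpha> \<in> W \<and> \<beta> \<in> W \<and> int (length \<alpha>) - int (length \<beta>) = d}"
  then obtain \<alpha> \<beta> where "\<alpha> \<in> W" "\<beta> \<in> W" "d = int (length \<alpha>) - int (length \<beta>)" "x = munit \<alpha> \<beta>"
    by auto
  then show "star x \<in> Deg (- d)"
    using munit_Deg[of \<beta> \<alpha>] by (simp add: star_mult star_star)
qed

lemma Sw_Deg: "\<alpha> \<in> W \<Longrightarrow> Sw \<alpha> \<in> Deg (int (length \<alpha>))"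
  using munit_Deg[of \<alpha> "[]"] by simp

lemma star_Sw_Deg: "\<alpha> \<in> W \<Longrightarrow> star (Sw \<alpha>) \<in> Deg (- int (length \<alpha>))"
  using munit_Deg[of "[]" \<alpha>] by simp

lemma one_Deg: "1 \<in> Deg 0"
  using Sw_Deg[of "[]"] by simp

lemma closure_cuntz_poly: "closure cuntz_poly = UNIV"
proof -
  have poly_mult: "x * y \<in> cuntz_poly" if "x \<in> cuntz_poly" "y \<in> cuntz_poly" for x y
    using _ that unfolding cuntz_poly_def
  proof (rule span_mult_closed)
    fix x y assume "x \<in> {munit \<alpha> \<beta> | \<alpha> \<beta>. \<alpha> \<in> W \<and> \<beta> \<in> W}" "y \<in> {munit \<alpha> \<beta> | \<alpha> \<beta>. \<alpha> \<in> W \<and> \<beta> \<in> W}"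
    then obtain \<alpha> \<beta> \<gamma> \<delta> where W: "\<alpha> \<in> W" "\<beta> \<in> W" "\<gamma> \<in> W" "\<delta> \<in> W"
      and xy: "x = munit \<alpha> \<beta>" "y = munit \<gamma> \<delta>"
      by auto
    have base: "munit \<mu> \<nu> \<in> complex_vector.span {munit \<alpha> \<beta> | \<alpha> \<beta>. \<alpha> \<in> W \<and> \<beta> \<in> W}"
      if "\<mu> \<in> W" "\<nu> \<in> W" for \<mu> \<nu>
      using that by (blast intro: complex_vector.span_base)
    show "x * y \<in> complex_vector.span {munit \<alpha> \<beta> | \<alpha> \<beta>. \<alpha> \<in> W \<and> \<beta> \<in> W}"
      unfolding xy
      by (rule munit_mult_cases[OF W]) (use W base in \<open>simp_all add: complex_vector.span_zero\<close>)
  qed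
  have poly_star: "star x \<in> cuntz_poly" if "x \<in> cuntz_poly" for x
    using that unfolding cuntz_poly_def
  proof (rule span_linear_image[OF star_add star_scaleC _ complex_vector.subspace_span, rotated])
    fix x assume "x \<in> {munit \<alpha> \<beta> | \<alpha> \<beta>. \<alpha> \<in> W \<and> \<beta> \<in> W}"
    then obtain \<alpha> \<beta> where "\<alpha> \<in> W" "\<beta> \<in> W" "x = munit \<alpha> \<beta>" by auto
    then show "star x \<in> complex_vector.span {munit \<alpha> \<beta> | \<alpha> \<beta>. \<alpha> \<in> W \<and> \<beta> \<in> W}"
      by (intro complex_vector.span_base) (auto simp: star_mult star_star)
  qed
  have sub: "complex_vector.subspace cuntz_poly"
    unfolding cuntz_poly_def by (rule complex_vector.subspace_span)
  have "cstar_subalgebra (closure cuntz_poly)"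
    unfolding cstar_subalgebra_def complex_vector.subspace_def
  proof (intro conjI ballI allI)
    show "0 \<in> closure cuntz_poly"
      using complex_vector.subspace_0[OF sub] closure_subset by blast
    show "x + y \<in> closure cuntz_poly" if "x \<in> closure cuntz_poly" "y \<in> closure cuntz_poly" for x y
    proof -
      obtain f g where "\<And>k. f k \<in> cuntz_poly" "f \<longlonglongrightarrow> x" "\<And>k. g k \<in> cuntz_poly" "g \<longlonglongrightarrow> y"
        using \<open>x \<in> closure cuntz_poly\<close> \<open>y \<in> closure cuntz_poly\<close> unfolding closure_sequential by metis
      then show ?thesis
        unfolding closure_sequential using complex_vector.subspace_add[OF sub] tendsto_add[of f x _ g y]
        by (intro exI[of _ "\<lambda>k. f k + g k"]) simp
    qed
    show "x * y \<in> closure cuntz_poly" if "x \<in> closure cuntz_poly" "y \<in> closure cuntz_poly" for x y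
    proof -
      obtain f g where "\<And>k. f k \<in> cuntz_poly" "f \<longlonglongrightarrow> x" "\<And>k. g k \<in> cuntz_poly" "g \<longlonglongrightarrow> y"
        using \<open>x \<in> closure cuntz_poly\<close> \<open>y \<in> closure cuntz_poly\<close> unfolding closure_sequential by metis
      then show ?thesis
        unfolding closure_sequential using poly_mult tendsto_mult[of f x _ g y]
        by (intro exI[of _ "\<lambda>k. f k * g k"]) simp
    qed
    show "c *\<^sub>C x \<in> closure cuntz_poly" if "x \<in> closure cuntz_poly" for c x
    proof -
      obtain f where "\<And>k. f k \<in> cuntz_poly" "f \<longlonglongrightarrow> x"
        using \<open>x \<in> closure cuntz_poly\<close> unfolding closure_sequential by metis
      then show ?thesis
        unfolding closure_sequential using complex_vector.subspace_scale[OF sub] tendsto_scaleC[of f x _ c]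
        by (intro exI[of _ "\<lambda>k. c *\<^sub>C f k"]) simp
    qed
    show "star x \<in> closure cuntz_poly" if "x \<in> closure cuntz_poly" for x
    proof -
      obtain f where "\<And>k. f k \<in> cuntz_poly" "f \<longlonglongrightarrow> x"
        using \<open>x \<in> closure cuntz_poly\<close> unfolding closure_sequential by metis
      then show ?thesis
        unfolding closure_sequential using poly_star tendsto_star[of f x]
        by (intro exI[of _ "\<lambda>k. star (f k)"]) simp
    qed
  qed simp
  moreover have "S ` {1..n} \<subseteq> closure cuntz_poly"
  proof safe
    fix i assume "i \<in> {1..n}"
    then have "munit [i] [] \<in> cuntz_poly"
      unfolding cuntz_poly_def
      by (intro complex_vector.span_base CollectI exI[of _ "[i]"] exI[of _ "[]"]) simp
    then show "S i \<in> closure cuntz_poly" using closure_subset[of cuntz_poly] by auto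
  qed
  ultimately have "cstar_generated (S ` {1..n}) \<subseteq> closure cuntz_poly"
    by (rule hull_minimal[rotated])
  then show ?thesis unfolding generated by (rule top.extremum_uniqueI)
qed

lemma density_induct [case_names closed subspace munit]:
  assumes "closed {x. P x}" "complex_vector.subspace {x. P x}"
    and "\<And>\<alpha> \<beta>. \<alpha> \<in> W \<Longrightarrow> \<beta> \<in> W \<Longrightarrow> P (munit \<alpha> \<beta>)"
  shows "P x"
proof -
  have "cuntz_poly \<subseteq> {x. P x}"
    unfolding cuntz_poly_def by (rule complex_vector.span_minimal) (use assms in auto)
  then have "closure cuntz_poly \<subseteq> {x. P x}"
    using assms(1) by (rule closure_minimal)
  then show ?thesis using closure_cuntz_poly by auto
qed

subsection \<open>The shift and the levels\<close>

lemma shift_add: "shift n S (x + y) = shift n S x + shift n S y"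
  by (simp add: shift_def distrib_left distrib_right sum.distrib)

lemma shift_scaleC: "shift n S (c *\<^sub>C x) = c *\<^sub>C shift n S x"
  by (simp add: shift_def scaleC_mult_left scaleC_mult_right scaleC_sum_right)

lemma shift_star: "shift n S (star x) = star (shift n S x)"
  by (simp add: shift_def star_sum star_mult star_star mult.assoc)

lemma shift_one: "shift n S 1 = 1"
  using sum_ranges by (simp add: shift_def)

lemma shift_S:
  assumes i: "i \<in> {1..n}"
  shows "shift n S x * S i = S i * x"
proof -
  have "shift n S x * S i = (\<Sum>j=1..n. S j * x * (star (S j) * S i))"
    by (simp add: shift_def sum_distrib_right mult.assoc)
  also have "\<dots> = (\<Sum>j=1..n. if j = i then S j * x else 0)"
    by (rule sum.cong) (use i star_S_S in auto)
  finally show ?thesis using i by simp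
qed

lemma shift_mult: "shift n S (x * y) = shift n S x * shift n S y"
proof -
  have "shift n S x * shift n S y = (\<Sum>i=1..n. shift n S x * S i * y * star (S i))"
    unfolding shift_def[of n S y] by (simp add: sum_distrib_left mult.assoc)
  also have "\<dots> = (\<Sum>i=1..n. S i * x * y * star (S i))"
    by (rule sum.cong) (simp_all add: shift_S)
  finally show ?thesis by (simp add: shift_def mult.assoc)
qed

lemma shift_pow_add: "\<sigma> m (x + y) = \<sigma> m x + \<sigma> m y"
  by (induction m) (simp_all add: shift_add)

lemma shift_pow_scaleC: "\<sigma> m (c *\<^sub>C x) = c *\<^sub>C \<sigma> m x"
  by (induction m) (simp_all add: shift_scaleC)

lemma shift_pow_star: "\<sigma> m (star x) = star (\<sigma> m x)"
  by (induction m) (simp_all add: shift_star)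

lemma shift_pow_one [simp]: "\<sigma> m 1 = 1"
  by (induction m) (simp_all add: shift_one)

lemma shift_pow_mult: "\<sigma> m (x * y) = \<sigma> m x * \<sigma> m y"
  by (induction m) (simp_all add: shift_mult)

lemma shift_pow_pow: "\<sigma> m (\<sigma> k x) = \<sigma> (m + k) x"
  by (simp add: funpow_add)

lemma shift_pow_zero [simp]: "\<sigma> m 0 = 0"
  using shift_pow_scaleC[of m 0 0] by simp

lemma shift_pow_sum: "\<sigma> m (\<Sum>i\<in>I. f i) = (\<Sum>i\<in>I. \<sigma> m (f i))"
  by (induction I rule: infinite_finite_induct) (simp_all add: shift_pow_add)

text \<open>Every letter that crosses the shifted element absorbs one shift, by
  \<open>shift_S\<close>. The bound on the length makes the natural-number subtraction
  genuine.\<close>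

lemma shift_pow_Sw:
  assumes "\<alpha> \<in> W" "length \<alpha> \<le> m"
  shows "\<sigma> m x * Sw \<alpha> = Sw \<alpha> * \<sigma> (m - length \<alpha>) x"
  using assms
proof (induction \<alpha> arbitrary: m)
  case (Cons i \<alpha>)
  then obtain m' where m: "m = Suc m'" by (cases m) auto
  have "\<sigma> m x * Sw (i # \<alpha>) = S i * (\<sigma> m' x * Sw \<alpha>)"
    using Cons.prems by (simp add: m shift_S flip: mult.assoc)
  then show ?case using Cons.IH[of m'] Cons.prems by (simp add: m mult.assoc)
qed simp

lemma star_Sw_shift_pow:
  assumes "\<alpha> \<in> W" "length \<alpha> \<le> m"
  shows "star (Sw \<alpha>) * \<sigma> m x = \<sigma> (m - length \<alpha>) x * star (Sw \<alpha>)"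
  using arg_cong[OF shift_pow_Sw[OF assms, of "star x"], of star]
  by (simp add: star_mult shift_pow_star star_star)

lemma shift_pow_eq_sum: "\<sigma> m x = (\<Sum>\<mu>\<in>Wl m. Sw \<mu> * x * star (Sw \<mu>))"
proof -
  have "\<sigma> m x = (\<Sum>\<mu>\<in>Wl m. \<sigma> m x * munit \<mu> \<mu>)"
    by (simp add: sum_munit flip: sum_distrib_left)
  also have "\<dots> = (\<Sum>\<mu>\<in>Wl m. Sw \<mu> * x * star (Sw \<mu>))"
  proof (rule sum.cong[OF refl])
    fix \<mu> assume "\<mu> \<in> Wl m"
    from words_of_lengthD[OF this] show "\<sigma> m x * munit \<mu> \<mu> = Sw \<mu> * x * star (Sw \<mu>)"
      using shift_pow_Sw[of \<mu> m x] by (simp flip: mult.assoc)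
  qed
  finally show ?thesis .
qed

lemma munit_refine: "munit \<alpha> \<beta> = (\<Sum>\<mu>\<in>Wl l. munit (\<alpha> @ \<mu>) (\<beta> @ \<mu>))"
proof -
  have "(\<Sum>\<mu>\<in>Wl l. munit (\<alpha> @ \<mu>) (\<beta> @ \<mu>)) = Sw \<alpha> * (\<Sum>\<mu>\<in>Wl l. munit \<mu> \<mu>) * star (Sw \<beta>)"
    by (simp add: Sw_append star_mult sum_distrib_left sum_distrib_right mult.assoc)
  then show ?thesis by (simp add: sum_munit)
qed

lemma shift_pow_munit: "\<sigma> m (munit \<alpha> \<beta>) = (\<Sum>\<mu>\<in>Wl m. munit (\<mu> @ \<alpha>) (\<mu> @ \<beta>))"
  by (simp add: shift_pow_eq_sum Sw_append star_mult mult.assoc)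

lemma Wl_append: "\<alpha> \<in> Wl k \<Longrightarrow> \<beta> \<in> Wl l \<Longrightarrow> \<alpha> @ \<beta> \<in> Wl (k + l)"
  by (auto simp: words_of_length_def)

lemma subspace_core_level: "complex_vector.subspace (core_level n S k)"
  unfolding core_level_def by (rule complex_vector.subspace_span)

lemma subspace_diag_level: "complex_vector.subspace (diag_level n S k)"
  unfolding diag_level_def by (rule complex_vector.subspace_span)

lemma munit_core_level: "\<alpha> \<in> Wl k \<Longrightarrow> \<beta> \<in> Wl k \<Longrightarrow> munit \<alpha> \<beta> \<in> core_level n S k"
  unfolding core_level_def by (rule complex_vector.span_base) blast

lemma munit_diag_level: "\<alpha> \<in> Wl k \<Longrightarrow> munit \<alpha> \<alpha> \<in> diag_level n S k"
  unfolding diag_level_def by (rule complex_vector.span_base) blast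

lemma core_level_induct [consumes 1, case_names subspace munit]:
  assumes "x \<in> core_level n S k" "complex_vector.subspace {x. P x}"
    and "\<And>\<alpha> \<beta>. \<alpha> \<in> Wl k \<Longrightarrow> \<beta> \<in> Wl k \<Longrightarrow> P (munit \<alpha> \<beta>)"
  shows "P x"
  by (rule complex_vector.span_induct[OF assms(1)[unfolded core_level_def] assms(2)]) (use assms(3) in auto)

lemma diag_level_induct [consumes 1, case_names subspace munit]:
  assumes "x \<in> diag_level n S k" "complex_vector.subspace {x. P x}"
    and "\<And>\<alpha>. \<alpha> \<in> Wl k \<Longrightarrow> P (munit \<alpha> \<alpha>)"
  shows "P x"
  by (rule complex_vector.span_induct[OF assms(1)[unfolded diag_level_def] assms(2)]) (use assms(3) in auto)

lemma Deg_induct [consumes 1, case_names subspace munit]: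
  assumes "x \<in> Deg d" "complex_vector.subspace {x. P x}"
    and "\<And>\<alpha> \<beta>. \<alpha> \<in> W \<Longrightarrow> \<beta> \<in> W \<Longrightarrow> int (length \<alpha>) - int (length \<beta>) = d \<Longrightarrow> P (munit \<alpha> \<beta>)"
  shows "P x"
  by (rule complex_vector.span_induct[OF assms(1)[unfolded Deg_def] assms(2)]) (use assms(3) in auto)

lemma diag_level_core_level: "x \<in> diag_level n S k \<Longrightarrow> x \<in> core_level n S k"
  by (erule diag_level_induct) (simp_all add: subspace_core_level munit_core_level)

lemma core_level_Deg: "x \<in> core_level n S k \<Longrightarrow> x \<in> Deg 0"
proof (erule core_level_induct)
  show "munit \<alpha> \<beta> \<in> Deg 0" if "\<alpha> \<in> Wl k" "\<beta> \<in> Wl k" for \<alpha> \<beta>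
    using munit_Deg[of \<alpha> \<beta>] that[THEN words_of_lengthD(1)] that[THEN words_of_lengthD(2)] by simp
qed (simp add: subspace_Deg)

lemma core_level_mono: "k \<le> l \<Longrightarrow> x \<in> core_level n S k \<Longrightarrow> x \<in> core_level n S l"
proof (erule core_level_induct)
  show "munit \<alpha> \<beta> \<in> core_level n S l" if "k \<le> l" "\<alpha> \<in> Wl k" "\<beta> \<in> Wl k" for \<alpha> \<beta>
  proof -
    have "munit (\<alpha> @ \<mu>) (\<beta> @ \<mu>) \<in> core_level n S l" if "\<mu> \<in> Wl (l - k)" for \<mu>
      using Wl_append[OF \<open>\<alpha> \<in> Wl k\<close> that] Wl_append[OF \<open>\<beta> \<in> Wl k\<close> that] \<open>k \<le> l\<close>
      by (simp add: munit_core_level)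
    then show ?thesis
      unfolding munit_refine[of \<alpha> \<beta> "l - k"]
      by (intro complex_vector.subspace_sum[OF subspace_core_level])
  qed
qed (simp add: subspace_core_level)

lemma munit_mult:
  assumes "\<beta> \<in> Wl k" "\<gamma> \<in> Wl k"
  shows "munit \<alpha> \<beta> * munit \<gamma> \<delta> = (if \<beta> = \<gamma> then munit \<alpha> \<delta> else 0)"
proof -
  have "munit \<alpha> \<beta> * munit \<gamma> \<delta> = Sw \<alpha> * (star (Sw \<beta>) * Sw \<gamma>) * star (Sw \<delta>)"
    by (simp add: mult.assoc)
  then show ?thesis by (simp add: star_Sw_Sw[OF assms])
qed

lemma core_level_mult: "x \<in> core_level n S k \<Longrightarrow> y \<in> core_level n S k \<Longrightarrow> x * y \<in> core_level n S k"
  unfolding core_level_def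
proof (rule span_mult_closed)
  fix x y
  assume "x \<in> {munit \<mu> \<nu> | \<mu> \<nu>. \<mu> \<in> Wl k \<and> \<nu> \<in> Wl k}" "y \<in> {munit \<mu> \<nu> | \<mu> \<nu>. \<mu> \<in> Wl k \<and> \<nu> \<in> Wl k}"
  then have "x * y \<in> core_level n S k"
    using munit_mult munit_core_level complex_vector.subspace_0[OF subspace_core_level] by auto
  then show "x * y \<in> complex_vector.span {munit \<mu> \<nu> | \<mu> \<nu>. \<mu> \<in> Wl k \<and> \<nu> \<in> Wl k}"
    by (simp add: core_level_def)
qed

lemma core_level_star: "x \<in> core_level n S k \<Longrightarrow> star x \<in> core_level n S k"
proof (rule span_linear_image[OF star_add star_scaleC _ subspace_core_level])
  show "star x \<in> core_level n S k" if "x \<in> {munit \<mu> \<nu> | \<mu> \<nu>. \<mu> \<in> Wl k \<and> \<nu> \<in> Wl k}" for x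
    using that by (auto simp: star_mult star_star intro: munit_core_level)
qed (simp add: core_level_def)

lemma diag_level_star: "x \<in> diag_level n S k \<Longrightarrow> star x \<in> diag_level n S k"
proof (rule span_linear_image[OF star_add star_scaleC _ subspace_diag_level])
  show "star x \<in> diag_level n S k" if "x \<in> {munit \<mu> \<mu> | \<mu>. \<mu> \<in> Wl k}" for x
    using that by (auto simp: star_mult star_star intro: munit_diag_level)
qed (simp add: diag_level_def)

lemma one_diag_level: "1 \<in> diag_level n S k"
  by (subst sum_munit[of k, symmetric])
    (intro complex_vector.subspace_sum[OF subspace_diag_level] munit_diag_level)

lemma shift_pow_core_level: "x \<in> core_level n S k \<Longrightarrow> \<sigma> m x \<in> core_level n S (m + k)"
proof (rule span_linear_image[OF shift_pow_add shift_pow_scaleC _ subspace_core_level])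
  show "\<sigma> m x \<in> core_level n S (m + k)" if "x \<in> {munit \<mu> \<nu> | \<mu> \<nu>. \<mu> \<in> Wl k \<and> \<nu> \<in> Wl k}" for x
    using that by (auto simp: shift_pow_munit
        intro!: complex_vector.subspace_sum[OF subspace_core_level] munit_core_level Wl_append)
qed (simp add: core_level_def)

lemma shift_pow_Deg: "x \<in> Deg d \<Longrightarrow> \<sigma> m x \<in> Deg d"
proof (rule span_linear_image[OF shift_pow_add shift_pow_scaleC _ subspace_Deg])
  show "\<sigma> m x \<in> Deg d"
    if x: "x \<in> {munit \<alpha> \<beta> | \<alpha> \<beta>. \<alpha> \<in> W \<and> \<beta> \<in> W \<and> int (length \<alpha>) - int (length \<beta>) = d}" for x
  proof -
    obtain \<alpha> \<beta> where W: "\<alpha> \<in> W" "\<beta> \<in> W" and d: "d = int (length \<alpha>) - int (length \<beta>)"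
      and x: "x = munit \<alpha> \<beta>" using x by auto
    have "munit (\<mu> @ \<alpha>) (\<mu> @ \<beta>) \<in> Deg d" if "\<mu> \<in> Wl m" for \<mu>
      using munit_Deg[of "\<mu> @ \<alpha>" "\<mu> @ \<beta>"] W words_of_lengthD[OF that] by (simp add: d)
    then show ?thesis
      unfolding x shift_pow_munit by (intro complex_vector.subspace_sum[OF subspace_Deg])
  qed
qed (simp add: Deg_def)

text \<open>On a matrix unit both products equal \<open>Sw \<alpha> * y * star (Sw \<beta>)\<close>.
  This is what makes different blocks commute.\<close>

lemma core_level_shift_pow_commute:
  assumes "x \<in> core_level n S k"
  shows "x * \<sigma> k y = \<sigma> k y * x"
  using assms
proof (induction rule: core_level_induct)
  case (munit \<alpha> \<beta>)
  note W = munit[THEN words_of_lengthD(1)] and l = munit[THEN words_of_lengthD(2)]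
  have "munit \<alpha> \<beta> * \<sigma> k y = Sw \<alpha> * (star (Sw \<beta>) * \<sigma> k y)" by (simp add: mult.assoc)
  also have "\<dots> = Sw \<alpha> * y * star (Sw \<beta>)"
    using star_Sw_shift_pow[OF W(2), of k y] l by (simp add: mult.assoc)
  also have "\<dots> = (\<sigma> k y * Sw \<alpha>) * star (Sw \<beta>)"
    using shift_pow_Sw[OF W(1), of k y] l by simp
  finally show ?case by (simp add: mult.assoc)
qed (simp add: complex_vector.subspace_def distrib_left distrib_right scaleC_mult_left scaleC_mult_right)

subsection \<open>Diagonal elements\<close>

definition diag_sum :: "nat \<Rightarrow> (nat list \<Rightarrow> complex) \<Rightarrow> 'a" where
  "diag_sum k f = (\<Sum>\<mu>\<in>Wl k. f \<mu> *\<^sub>C munit \<mu> \<mu>)"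

lemma diag_sum_diag_level: "diag_sum k f \<in> diag_level n S k"
  unfolding diag_sum_def
  by (intro complex_vector.subspace_sum[OF subspace_diag_level]
      complex_vector.subspace_scale[OF subspace_diag_level] munit_diag_level)

lemma diag_sum_mult_munit: "\<nu> \<in> Wl k \<Longrightarrow> diag_sum k f * munit \<nu> \<beta> = f \<nu> *\<^sub>C munit \<nu> \<beta>"
proof -
  assume \<nu>: "\<nu> \<in> Wl k"
  have "diag_sum k f * munit \<nu> \<beta> = (\<Sum>\<mu>\<in>Wl k. f \<mu> *\<^sub>C (munit \<mu> \<mu> * munit \<nu> \<beta>))"
    by (simp add: diag_sum_def sum_distrib_right scaleC_mult_left)
  also have "\<dots> = (\<Sum>\<mu>\<in>Wl k. if \<mu> = \<nu> then f \<mu> *\<^sub>C munit \<mu> \<beta> else 0)"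
    by (rule sum.cong) (auto simp: munit_mult[OF _ \<nu>])
  finally show ?thesis using \<nu> by simp
qed

lemma diag_sum_mult: "diag_sum k f * diag_sum k g = diag_sum k (\<lambda>\<mu>. f \<mu> * g \<mu>)"
proof -
  have "diag_sum k f * diag_sum k g = (\<Sum>\<nu>\<in>Wl k. g \<nu> *\<^sub>C (diag_sum k f * munit \<nu> \<nu>))"
    unfolding diag_sum_def[of k g] by (simp add: sum_distrib_left scaleC_mult_right)
  also have "\<dots> = (\<Sum>\<nu>\<in>Wl k. (f \<nu> * g \<nu>) *\<^sub>C munit \<nu> \<nu>)"
    by (rule sum.cong) (simp_all add: diag_sum_mult_munit scaleC_scaleC mult.commute)
  finally show ?thesis by (simp add: diag_sum_def)
qed

lemma diag_sum_star: "star (diag_sum k f) = diag_sum k (\<lambda>\<mu>. cnj (f \<mu>))"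
  by (simp add: diag_sum_def star_sum star_scaleC star_mult star_star)

lemma unitary_diag_sum:
  assumes "\<And>\<mu>. \<mu> \<in> Wl k \<Longrightarrow> cmod (f \<mu>) = 1"
  shows "unitary (diag_sum k f)"
proof -
  have "diag_sum k (\<lambda>\<mu>. cnj (f \<mu>) * f \<mu>) = 1" "diag_sum k (\<lambda>\<mu>. f \<mu> * cnj (f \<mu>)) = 1"
    using assms unfolding diag_sum_def sum_munit[of k, symmetric]
    by (auto intro!: sum.cong simp: scaleC_one mult.commute[of "cnj _"] simp flip: complex_norm_square)
  then show ?thesis by (simp add: unitary_def diag_sum_star diag_sum_mult)
qed

text \<open>A complex number of modulus at most one is the mean of two of modulus one.\<close>

lemma norm_diag_sum_le:
  assumes "\<And>\<mu>. \<mu> \<in> Wl k \<Longrightarrow> cmod (f \<mu>) \<le> M" "M > 0"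
  shows "norm (diag_sum k f) \<le> M"
proof -
  have "\<exists>a b. z = (a + b) / 2 \<and> cmod a = 1 \<and> cmod b = 1" if "cmod z \<le> 1" for z
  proof -
    \<comment> \<open>\<open>w\<close> and \<open>cnj w\<close> are the points of the unit circle
      with real part \<open>cmod z\<close>; \<open>s\<close> rotates their mean to \<open>z\<close>.
      For \<open>z = 0\<close> any direction serves, but \<open>sgn 0\<close> would not have modulus
      one.\<close>
    define s where "s = (if z = 0 then 1 else sgn z)"
    define w where "w = Complex (cmod z) (sqrt (1 - (cmod z)\<^sup>2))"
    have "(cmod z)\<^sup>2 \<le> 1" using that by (simp add: power_le_one)
    then have w: "cmod w = 1" by (simp add: w_def cmod_def)
    have s: "cmod s = 1" by (simp add: s_def norm_sgn)
    have "w + cnj w = 2 * complex_of_real (cmod z)"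
      by (simp add: w_def complex_eq_iff)
    moreover have "s * complex_of_real (cmod z) = z"
      by (simp add: s_def sgn_eq)
    ultimately have "z = (s * w + s * cnj w) / 2"
      by (metis (no_types, lifting) distrib_left mult.left_commute nonzero_mult_div_cancel_left zero_neq_numeral)
    then show ?thesis
      using w s by (metis complex_mod_cnj mult_1 norm_mult)
  qed
  then obtain a b where ab: "\<And>z. cmod z \<le> 1 \<Longrightarrow> z = (a z + b z) / 2 \<and> cmod (a z) = 1 \<and> cmod (b z) = 1"
    by metis
  define g where "g \<mu> = f \<mu> / complex_of_real M" for \<mu>
  have g: "cmod (g \<mu>) \<le> 1" if "\<mu> \<in> Wl k" for \<mu>
    using assms(1)[OF that] \<open>M > 0\<close> by (simp add: g_def norm_divide)
  have "diag_sum k f = complex_of_real (M / 2) *\<^sub>C (diag_sum k (\<lambda>\<mu>. a (g \<mu>)) + diag_sum k (\<lambda>\<mu>. b (g \<mu>)))"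
  proof -
    have "f \<mu> = complex_of_real (M / 2) * (a (g \<mu>) + b (g \<mu>))" if "\<mu> \<in> Wl k" for \<mu>
    proof -
      have "f \<mu> = complex_of_real M * g \<mu>" using \<open>M > 0\<close> by (simp add: g_def)
      also have "g \<mu> = (a (g \<mu>) + b (g \<mu>)) / 2" using ab[OF g[OF that]] by blast
      finally show ?thesis by simp
    qed
    then show ?thesis
      unfolding diag_sum_def scaleC_sum_right sum.distrib[symmetric] scaleC_add_right[symmetric]
        scaleC_add_left[symmetric] scaleC_scaleC
      by (intro sum.cong) simp_all
  qed
  also have "norm \<dots> \<le> M / 2 * (norm (diag_sum k (\<lambda>\<mu>. a (g \<mu>))) + norm (diag_sum k (\<lambda>\<mu>. b (g \<mu>))))"
    using \<open>M > 0\<close> by (simp add: norm_scaleC norm_triangle_ineq mult_left_mono)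
  also have "\<dots> = M"
    using norm_unitary[OF unitary_diag_sum] ab[OF g] by simp
  finally show ?thesis .
qed

section \<open>The gauge-invariant state\<close>

text \<open>The standard left inverse of the shift: \<open>star (S i) * shift n S x * S i\<close> is
  \<open>x\<close> for every \<open>i\<close>.\<close>

definition transfer :: "'a \<Rightarrow> 'a" where
  "transfer x = (1 / real n) *\<^sub>R (\<Sum>i=1..n. star (S i) * x * S i)"

lemma transfer_add: "transfer (x + y) = transfer x + transfer y"
  by (simp add: transfer_def distrib_left distrib_right sum.distrib scaleR_add_right)

lemma transfer_scaleC: "transfer (c *\<^sub>C x) = c *\<^sub>C transfer x"
  unfolding transfer_def
  by (simp add: scaleC_mult_left scaleC_mult_right scaleC_scaleC mult.commute
      flip: scaleC_sum_right scaleC_of_real)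

lemma transfer_star: "transfer (star x) = star (transfer x)"
  by (simp add: transfer_def star_scaleR star_sum star_mult star_star mult.assoc)

lemma norm_transfer: "norm (transfer x) \<le> norm x"
proof -
  have "norm (\<Sum>i=1..n. star (S i) * x * S i) \<le> (\<Sum>i=1..n. norm x)"
  proof (rule sum_norm_le)
    fix i assume "i \<in> {1..n}"
    then have "norm (S i) = 1" using norm_isometry isometry by blast
    then show "norm (star (S i) * x * S i) \<le> norm x"
      by (metis norm_mult_ineq mult.left_neutral mult.right_neutral norm_star order_trans)
  qed
  then show ?thesis using n_pos by (simp add: transfer_def field_simps)
qed

lemma transfer_pow_add: "(transfer ^^ k) (x + y) = (transfer ^^ k) x + (transfer ^^ k) y"
  by (induction k) (simp_all add: transfer_add)

lemma transfer_pow_scaleC: "(transfer ^^ k) (c *\<^sub>C x) = c *\<^sub>C (transfer ^^ k) x"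
  by (induction k) (simp_all add: transfer_scaleC)

lemma transfer_pow_star: "(transfer ^^ k) (star x) = star ((transfer ^^ k) x)"
  by (induction k) (simp_all add: transfer_star)

lemma norm_transfer_pow: "norm ((transfer ^^ k) x) \<le> norm x"
  by (induction k) (auto intro: order_trans[OF norm_transfer])

lemma transfer_one: "transfer 1 = 1"
proof -
  have "(\<Sum>i=1..n. star (S i) * 1 * S i) = (\<Sum>i=1..n. 1)"
    by (rule sum.cong) (use isometry in auto)
  also have "\<dots> = real n *\<^sub>R 1" by (simp add: scaleR_conv_of_real)
  finally show ?thesis using n_pos by (simp add: transfer_def)
qed

lemma transfer_S_mult: "i \<in> {1..n} \<Longrightarrow> transfer (S i * y) = (1 / real n) *\<^sub>R (y * S i)"
proof -
  assume i: "i \<in> {1..n}"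
  have "(\<Sum>j=1..n. star (S j) * (S i * y) * S j) = (\<Sum>j=1..n. if j = i then y * S j else 0)"
    by (rule sum.cong) (use i star_S_S_mult in auto)
  then show ?thesis using i by (simp add: transfer_def)
qed

text \<open>Only the summand of the first letter survives, and it moves that letter to the end at
  the price of a factor \<open>1 / real n\<close>. The word never gets shorter, so the factor is
  gained at every step.\<close>

lemma norm_transfer_pow_Sw:
  "\<alpha> \<in> W \<Longrightarrow> \<alpha> \<noteq> [] \<Longrightarrow> norm ((transfer ^^ k) (Sw \<alpha>)) \<le> (1 / real n) ^ k"
proof (induction k arbitrary: \<alpha>)
  case (Suc k)
  then obtain i \<beta> where \<alpha>: "\<alpha> = i # \<beta>" by (cases \<alpha>) auto
  have "transfer (Sw \<alpha>) = (1 / real n) *\<^sub>R Sw (\<beta> @ [i])"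
    using transfer_S_mult[of i "Sw \<beta>"] Suc.prems by (simp add: \<alpha> Sw_append)
  then have "(transfer ^^ Suc k) (Sw \<alpha>) = (1 / real n) *\<^sub>R (transfer ^^ k) (Sw (\<beta> @ [i]))"
    using transfer_pow_scaleC[of k "complex_of_real (1 / real n)" "Sw (\<beta> @ [i])"]
    unfolding scaleC_of_real by (simp add: funpow_swap1)
  also have "norm \<dots> \<le> 1 / real n * (1 / real n) ^ k"
    using Suc.IH[of "\<beta> @ [i]"] Suc.prems by (simp add: \<alpha> divide_right_mono)
  finally show ?case by simp
qed simp

text \<open>While both words are nonempty, a step strips one letter from each, with factor
  \<open>1 / n\<close> if the letters agree and 0 otherwise. If both are exhausted together the rest
  is 1; a leftover nonempty word or its adjoint decays.\<close>

lemma transfer_pow_munit_tendsto: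
  assumes "\<alpha> \<in> W" "\<beta> \<in> W"
  shows "(\<lambda>k. (transfer ^^ k) (munit \<alpha> \<beta>))
    \<longlonglongrightarrow> (if \<alpha> = \<beta> then 1 / of_nat n ^ length \<alpha> else 0) *\<^sub>C 1"
proof -
  have null: "(\<lambda>k. (1 / real n) ^ k) \<longlonglongrightarrow> 0"
    using two_le by (intro LIMSEQ_realpow_zero) auto
  have *: "(\<lambda>k. (transfer ^^ k) (Sw \<alpha>)) \<longlonglongrightarrow> 0" if "\<alpha> \<in> W" "\<alpha> \<noteq> []" for \<alpha>
    by (rule Lim_null_comparison[OF _ null]) (use norm_transfer_pow_Sw[OF that] in simp)
  show ?thesis using assms
  proof (induction \<alpha> arbitrary: \<beta>)
    case Nil
    show ?case
    proof (cases "\<beta> = []")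
      case True
      have "(transfer ^^ k) 1 = 1" for k by (induction k) (simp_all add: transfer_one)
      then show ?thesis using True by (simp add: scaleC_one)
    next
      case False
      then show ?thesis
        using tendsto_star[OF *[of \<beta>]] Nil.prems by (simp add: transfer_pow_star)
    qed
  next
    case (Cons i \<alpha>)
    show ?case
    proof (cases \<beta>)
      case Nil
      then show ?thesis using *[of "i # \<alpha>"] Cons.prems by simp
    next
      case (Cons j \<beta>')
      note \<beta> = this
      let ?c = "if i = j then 1 / complex_of_nat n else 0"
      have "transfer (munit (i # \<alpha>) \<beta>) = ?c *\<^sub>C munit \<alpha> \<beta>'"
      proof -
        have "transfer (munit (i # \<alpha>) \<beta>) = (1 / real n) *\<^sub>R (Sw \<alpha> * star (Sw \<beta>') * (star (S j) * S i))"
          using transfer_S_mult[of i "Sw \<alpha> * star (Sw \<beta>)"] Cons.prems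
          by (simp add: \<beta> star_mult mult.assoc)
        moreover have "complex_of_real (1 / real n) = 1 / of_nat n" by simp
        ultimately show ?thesis
          using star_S_S[of j i] Cons.prems scaleC_of_real[of "1 / real n" "munit \<alpha> \<beta>'"]
          by (auto simp: \<beta>)
      qed
      then have "(\<lambda>k. (transfer ^^ Suc k) (munit (i # \<alpha>) \<beta>)) = (\<lambda>k. ?c *\<^sub>C (transfer ^^ k) (munit \<alpha> \<beta>'))"
        by (simp add: funpow_swap1 transfer_pow_scaleC)
      moreover have "(\<lambda>k. ?c *\<^sub>C (transfer ^^ k) (munit \<alpha> \<beta>'))
          \<longlonglongrightarrow> ?c *\<^sub>C ((if \<alpha> = \<beta>' then 1 / of_nat n ^ length \<alpha> else 0) *\<^sub>C 1)"
        by (rule tendsto_scaleC) (use Cons.IH Cons.prems in \<open>simp add: \<beta>\<close>)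
      ultimately show ?thesis
        by (subst filterlim_sequentially_Suc[symmetric]) (auto simp: \<beta> scaleC_scaleC mult.commute split: if_splits)
    qed
  qed
qed

lemma closed_scalars: "closed (range (\<lambda>c. c *\<^sub>C (1 :: 'a)))"
proof -
  have "bounded_linear (\<lambda>c. c *\<^sub>C (1 :: 'a))"
  proof (rule bounded_linear_intro[where K=1])
    show "(r *\<^sub>R c) *\<^sub>C (1 :: 'a) = r *\<^sub>R (c *\<^sub>C 1)" for r c
      by (metis scaleC_of_real scaleC_scaleC scaleR_conv_of_real)
  qed (simp_all add: scaleC_add_left)
  then have "complete (range (\<lambda>c. c *\<^sub>C (1 :: 'a)))"
    by (intro complete_isometric_image[where e=1]) (simp_all add: complete_UNIV)
  then show ?thesis by (rule complete_imp_closed)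
qed

lemma transfer_pow_convergent: "\<exists>c. (\<lambda>k. (transfer ^^ k) x) \<longlonglongrightarrow> c *\<^sub>C 1"
proof -
  have "\<exists>a\<in>range (\<lambda>c. c *\<^sub>C (1 :: 'a)). (\<lambda>k. (transfer ^^ k) x) \<longlonglongrightarrow> a"
  proof (rule density_induct)
    have "(transfer ^^ m) (x - y) = (transfer ^^ m) x - (transfer ^^ m) y" for m x y
      using transfer_pow_add[of m "x - y" y] by simp
    then show "closed {x. \<exists>a\<in>range (\<lambda>c. c *\<^sub>C (1 :: 'a)). (\<lambda>k. (transfer ^^ k) x) \<longlonglongrightarrow> a}"
      by (intro closed_contractive_limits norm_transfer_pow closed_scalars)
    show "complex_vector.subspace {x. \<exists>a\<in>range (\<lambda>c. c *\<^sub>C (1 :: 'a)). (\<lambda>k. (transfer ^^ k) x) \<longlonglongrightarrow> a}"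
      unfolding complex_vector.subspace_def
    proof safe
      have "(transfer ^^ k) 0 = 0" for k using transfer_pow_scaleC[of k 0 0] by simp
      then show "\<exists>a\<in>range (\<lambda>c. c *\<^sub>C 1). (\<lambda>k. (transfer ^^ k) 0) \<longlonglongrightarrow> a"
        by (intro bexI[of _ 0] range_eqI[of _ _ 0]) simp_all
    next
      fix x y c d
      assume "(\<lambda>k. (transfer ^^ k) x) \<longlonglongrightarrow> c *\<^sub>C 1" "(\<lambda>k. (transfer ^^ k) y) \<longlonglongrightarrow> d *\<^sub>C 1"
      then show "\<exists>a\<in>range (\<lambda>c. c *\<^sub>C 1). (\<lambda>k. (transfer ^^ k) (x + y)) \<longlonglongrightarrow> a"
        by (intro bexI[of _ "c *\<^sub>C 1 + d *\<^sub>C 1"] range_eqI[of _ _ "c + d"])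
          (simp_all add: transfer_pow_add tendsto_add scaleC_add_left)
    next
      fix x c d
      assume "(\<lambda>k. (transfer ^^ k) x) \<longlonglongrightarrow> c *\<^sub>C 1"
      from tendsto_scaleC[OF this, of d] show "\<exists>a\<in>range (\<lambda>c. c *\<^sub>C 1). (\<lambda>k. (transfer ^^ k) (d *\<^sub>C x)) \<longlonglongrightarrow> a"
        by (intro bexI[of _ "d *\<^sub>C c *\<^sub>C 1"] range_eqI[of _ _ "d * c"])
          (simp_all add: transfer_pow_scaleC tendsto_scaleC scaleC_scaleC)
    qed
  qed (use transfer_pow_munit_tendsto in blast)
  then show ?thesis by blast
qed

text \<open>This is the KMS state of the gauge action at inverse temperature log n, and
  \<open>psi_Sw_mult\<close> is its KMS relation. The description is legitimate by
  \<open>transfer_pow_convergent\<close> and because distinct scalars give distinct multiples of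
  1.\<close>

definition \<psi> :: "'a \<Rightarrow> complex" where
  "\<psi> x = (THE c. (\<lambda>k. (transfer ^^ k) x) \<longlonglongrightarrow> c *\<^sub>C 1)"

lemma psi_eqI: "(\<lambda>k. (transfer ^^ k) x) \<longlonglongrightarrow> c *\<^sub>C 1 \<Longrightarrow> \<psi> x = c"
  unfolding \<psi>_def by (rule the_equality) (auto dest: LIMSEQ_unique)

lemma psi_lim: "(\<lambda>k. (transfer ^^ k) x) \<longlonglongrightarrow> \<psi> x *\<^sub>C 1"
  using transfer_pow_convergent[of x] psi_eqI by metis

lemma psi_add: "\<psi> (x + y) = \<psi> x + \<psi> y"
  by (rule psi_eqI) (simp add: transfer_pow_add scaleC_add_left tendsto_add psi_lim)

lemma psi_scaleC: "\<psi> (c *\<^sub>C x) = c * \<psi> x"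
  using tendsto_scaleC[OF psi_lim[of x], of c]
  by (intro psi_eqI) (simp add: transfer_pow_scaleC scaleC_scaleC)

lemma psi_star: "\<psi> (star x) = cnj (\<psi> x)"
  using tendsto_star[OF psi_lim[of x]]
  by (intro psi_eqI) (simp add: transfer_pow_star star_scaleC)

lemma norm_psi: "cmod (\<psi> x) \<le> norm x"
  using LIMSEQ_le_const2[OF tendsto_norm[OF psi_lim[of x]], of "norm x"] norm_transfer_pow by auto

lemma psi_transfer: "\<psi> (transfer x) = \<psi> x"
  using psi_lim[of x, THEN LIMSEQ_Suc] by (intro psi_eqI) (simp add: funpow_swap1)

lemma psi_munit:
  "\<alpha> \<in> W \<Longrightarrow> \<beta> \<in> W \<Longrightarrow> \<psi> (munit \<alpha> \<beta>) = (if \<alpha> = \<beta> then 1 / of_nat n ^ length \<alpha> else 0)"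
  by (rule psi_eqI[OF transfer_pow_munit_tendsto])

lemma psi_one [simp]: "\<psi> 1 = 1"
  using psi_munit[of "[]" "[]"] by simp

lemma psi_scaleR: "\<psi> (r *\<^sub>R x) = of_real r * \<psi> x"
  by (simp add: psi_scaleC flip: scaleC_of_real)

lemma bounded_linear_psi: "bounded_linear \<psi>"
  by (rule bounded_linear_intro[where K=1])
    (simp_all add: psi_add norm_psi psi_scaleR scaleR_conv_of_real[where 'a=complex])

lemmas psi_diff = linear_diff[OF bounded_linear.linear[OF bounded_linear_psi]]
lemmas psi_sum = linear_sum[OF bounded_linear.linear[OF bounded_linear_psi]]
lemmas psi_zero [simp] = linear_0[OF bounded_linear.linear[OF bounded_linear_psi]]
lemmas tendsto_psi = bounded_linear.tendsto[OF bounded_linear_psi]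
lemmas continuous_on_psi = bounded_linear.continuous_on[OF bounded_linear_psi]

section \<open>The KMS relation and its consequences\<close>

lemma psi_S_mult: "i \<in> {1..n} \<Longrightarrow> \<psi> (S i * y) = \<psi> (y * S i) / of_nat n"
  by (subst psi_transfer[symmetric]) (simp add: transfer_S_mult psi_scaleR)

lemma psi_Sw_mult: "\<alpha> \<in> W \<Longrightarrow> \<psi> (Sw \<alpha> * y) = \<psi> (y * Sw \<alpha>) / of_nat n ^ length \<alpha>"
proof (induction \<alpha> arbitrary: y)
  case (Cons i \<alpha>)
  then have "\<psi> (S i * (Sw \<alpha> * y)) = \<psi> (Sw \<alpha> * (y * S i)) / of_nat n"
    by (simp add: psi_S_mult mult.assoc)
  then show ?case using Cons by (simp add: mult.assoc)
qed simp

lemma psi_mult_star_Sw: "\<alpha> \<in> W \<Longrightarrow> \<psi> (y * star (Sw \<alpha>)) = \<psi> (star (Sw \<alpha>) * y) / of_nat n ^ length \<alpha>"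
  using arg_cong[OF psi_Sw_mult[of \<alpha> "star y"], of cnj]
  by (simp add: star_mult star_star flip: psi_star)

text \<open>On monomials both sides reduce to
  \<open>\<psi> (star (Sw \<beta>) * x * Sw \<alpha>)\<close>, divided by
  \<open>n ^ length \<alpha>\<close> on the left and by \<open>n ^ length \<beta>\<close> on the
  right; in degree zero these agree.\<close>

lemma psi_Deg0_commute: "f \<in> Deg 0 \<Longrightarrow> \<psi> (f * x) = \<psi> (x * f)"
proof (induction rule: Deg_induct)
  case (munit \<alpha> \<beta>)
  have "\<psi> (munit \<alpha> \<beta> * x) = \<psi> (star (Sw \<beta>) * x * Sw \<alpha>) / of_nat n ^ length \<alpha>"
    using psi_Sw_mult[OF munit(1), of "star (Sw \<beta>) * x"] by (simp add: mult.assoc)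
  also have "\<dots> = \<psi> (x * munit \<alpha> \<beta>)"
    using psi_mult_star_Sw[OF munit(2), of "x * Sw \<alpha>"] munit(3) by (simp add: mult.assoc)
  finally show ?case .
qed (simp add: complex_vector.subspace_def psi_add psi_scaleC distrib_left distrib_right
    scaleC_mult_left scaleC_mult_right)

lemma psi_Deg: "x \<in> Deg d \<Longrightarrow> d \<noteq> 0 \<Longrightarrow> \<psi> x = 0"
  by (induction rule: Deg_induct)
    (auto simp: complex_vector.subspace_def psi_add psi_scaleC psi_munit)

lemma psi_Sw_conj:
  assumes "\<alpha> \<in> Wl k" "\<beta> \<in> Wl k"
  shows "\<psi> (Sw \<alpha> * x * star (Sw \<beta>)) = (if \<alpha> = \<beta> then \<psi> x / of_nat n ^ k else 0)"
proof -
  note W = assms[THEN words_of_lengthD(1)] and l = assms[THEN words_of_lengthD(2)]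
  have "\<psi> (Sw \<alpha> * x * star (Sw \<beta>)) = \<psi> (x * (star (Sw \<beta>) * Sw \<alpha>)) / of_nat n ^ k"
    using psi_Sw_mult[OF W(1), of "x * star (Sw \<beta>)"] l by (simp add: mult.assoc)
  then show ?thesis by (simp add: star_Sw_Sw[OF assms(2,1)])
qed

lemma psi_shift_pow: "\<psi> (\<sigma> k x) = \<psi> x"
proof -
  have "\<psi> (\<sigma> k x) = (\<Sum>\<mu>\<in>Wl k. \<psi> x / of_nat n ^ k)"
    unfolding shift_pow_eq_sum psi_sum by (rule sum.cong) (simp_all add: psi_Sw_conj)
  then show ?thesis using n_pos by (simp add: card_words_of_length)
qed

lemma psi_core_shift:
  assumes "f \<in> core_level n S k"
  shows "\<psi> (f * \<sigma> k x) = \<psi> f * \<psi> x"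
  using assms
proof (induction rule: core_level_induct)
  case (munit \<alpha> \<beta>)
  note W = munit[THEN words_of_lengthD(1)] and l = munit[THEN words_of_lengthD(2)]
  have "munit \<alpha> \<beta> * \<sigma> k x = Sw \<alpha> * x * star (Sw \<beta>)"
    using star_Sw_shift_pow[OF W(2), of k x] l by (simp add: mult.assoc)
  then show ?case using munit W l by (simp add: psi_Sw_conj psi_munit)
qed (simp add: complex_vector.subspace_def psi_add psi_scaleC distrib_right scaleC_mult_left)

lemma psi_compress:
  "\<psi> x = (\<Sum>\<mu>\<in>Wl k. \<psi> (star (Sw \<mu>) * x * Sw \<mu>)) / of_nat n ^ k"
proof -
  have "\<psi> x = \<psi> (\<Sum>\<mu>\<in>Wl k. x * Sw \<mu> * star (Sw \<mu>))"
    by (simp add: mult.assoc sum_munit flip: sum_distrib_left)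
  also have "\<dots> = (\<Sum>\<mu>\<in>Wl k. \<psi> (star (Sw \<mu>) * x * Sw \<mu>) / of_nat n ^ k)"
    unfolding psi_sum
  proof (rule sum.cong[OF refl])
    fix \<mu> assume "\<mu> \<in> Wl k"
    from words_of_lengthD[OF this] show "\<psi> (x * Sw \<mu> * star (Sw \<mu>)) = \<psi> (star (Sw \<mu>) * x * Sw \<mu>) / of_nat n ^ k"
      using psi_mult_star_Sw[of \<mu> "x * Sw \<mu>"] by (simp add: mult.assoc)
  qed
  finally show ?thesis by (simp add: sum_divide_distrib)
qed

subsection \<open>Positivity\<close>

definition word_span :: "'a set" where
  "word_span = complex_vector.span (Sw ` W)"

lemma subspace_word_span: "complex_vector.subspace word_span"
  unfolding word_span_def by (rule complex_vector.subspace_span)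

text \<open>The isometries \<open>Sw \<alpha>\<close> are orthonormal for the form
  \<open>\<psi> (star a * b)\<close>: distinct ones are orthogonal or leave a nonempty word, on
  which \<open>\<psi>\<close> vanishes. So the value is a sum of squared moduli of
  coefficients.\<close>

lemma psi_positive_word_span:
  assumes "y \<in> word_span"
  shows "\<exists>r\<ge>0. \<psi> (star y * y) = complex_of_real r"
proof -
  obtain t r where t: "finite t" "t \<subseteq> Sw ` W" and y: "y = (\<Sum>a\<in>t. r a *\<^sub>C a)"
    using assms unfolding word_span_def complex_vector.span_explicit by blast
  have orth: "\<psi> (star a * b) = (if a = b then 1 else 0)" if at: "a \<in> t" and bt: "b \<in> t" for a b
  proof -
    obtain \<alpha> \<beta> where W: "\<alpha> \<in> W" "\<beta> \<in> W" and ab: "a = Sw \<alpha>" "b = Sw \<beta>"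
      using t(2) at bt by blast
    show ?thesis
    proof (cases "a = b")
      case True
      then show ?thesis using W by (simp add: ab)
    next
      case False
      show ?thesis
        by (rule star_Sw_Sw_cases[OF W])
          (use False psi_munit[of "[]"] psi_munit[of _ "[]"] in \<open>auto simp: ab\<close>)
    qed
  qed
  have "\<psi> (star y * y) = (\<Sum>b\<in>t. \<Sum>a\<in>t. cnj (r a) * r b * \<psi> (star a * b))"
    by (simp add: y star_sum star_scaleC sum_distrib_left sum_distrib_right psi_sum psi_scaleC
        scaleC_mult_left scaleC_mult_right mult.assoc mult.left_commute)
  also have "\<dots> = (\<Sum>b\<in>t. \<Sum>a\<in>t. if a = b then cnj (r b) * r b else 0)"
    by (intro sum.cong refl) (auto simp: orth)
  also have "\<dots> = (\<Sum>a\<in>t. complex_of_real ((cmod (r a))\<^sup>2))"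
    unfolding complex_norm_square using t(1) by (simp add: mult.commute)
  finally show ?thesis
    by (intro exI[of _ "\<Sum>a\<in>t. (cmod (r a))\<^sup>2"]) (simp add: sum_nonneg)
qed

text \<open>A long word on the right absorbs every adjoint word occurring in \<open>x\<close>,
  leaving a combination of plain words.\<close>

lemma cuntz_poly_mult_Sw: "x \<in> cuntz_poly \<Longrightarrow> \<exists>l0. \<forall>l\<ge>l0. \<forall>\<nu>\<in>Wl l. x * Sw \<nu> \<in> word_span"
  unfolding cuntz_poly_def
proof (induction rule: complex_vector.span_induct)
  case base
  show ?case
    unfolding complex_vector.subspace_def
  proof safe
    show "\<exists>l0. \<forall>l\<ge>l0. \<forall>\<nu>\<in>Wl l. 0 * Sw \<nu> \<in> word_span"
      by (simp add: complex_vector.subspace_0[OF subspace_word_span])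
  next
    fix x y k l
    assume "\<forall>j\<ge>k. \<forall>\<nu>\<in>Wl j. x * Sw \<nu> \<in> word_span" "\<forall>j\<ge>l. \<forall>\<nu>\<in>Wl j. y * Sw \<nu> \<in> word_span"
    then show "\<exists>l0. \<forall>l\<ge>l0. \<forall>\<nu>\<in>Wl l. (x + y) * Sw \<nu> \<in> word_span"
      by (intro exI[of _ "max k l"])
        (auto simp: distrib_right intro: complex_vector.subspace_add[OF subspace_word_span])
  next
    fix c x k
    assume "\<forall>j\<ge>k. \<forall>\<nu>\<in>Wl j. x * Sw \<nu> \<in> word_span"
    then show "\<exists>l0. \<forall>l\<ge>l0. \<forall>\<nu>\<in>Wl l. (c *\<^sub>C x) * Sw \<nu> \<in> word_span"
      by (intro exI[of _ k])
        (simp add: scaleC_mult_left complex_vector.subspace_scale[OF subspace_word_span])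
  qed
next
  case (step x)
  then obtain \<alpha> \<beta> where W: "\<alpha> \<in> W" "\<beta> \<in> W" and x: "x = munit \<alpha> \<beta>" by auto
  have base: "Sw \<gamma> \<in> word_span" if "\<gamma> \<in> W" for \<gamma>
    unfolding word_span_def using that by (intro complex_vector.span_base) simp
  have "x * Sw \<nu> \<in> word_span" if "l \<ge> length \<beta>" "\<nu> \<in> Wl l" for l \<nu>
  proof -
    note \<nu> = words_of_lengthD[OF that(2)]
    have "Sw \<alpha> * (star (Sw \<beta>) * Sw \<nu>) \<in> word_span"
    proof (rule star_Sw_Sw_cases[OF W(2) \<nu>(1)])
      fix \<gamma> assume "\<gamma> \<in> W" "star (Sw \<beta>) * Sw \<nu> = Sw \<gamma>"
      then show ?thesis using W base[of "\<alpha> @ \<gamma>"] by (simp add: Sw_append)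
    next
      fix \<gamma> assume "\<beta> = \<nu> @ \<gamma>" "star (Sw \<beta>) * Sw \<nu> = star (Sw \<gamma>)"
      then show ?thesis using W base[of \<alpha>] \<nu>(2) that(1) by simp
    qed (simp add: complex_vector.subspace_0[OF subspace_word_span])
    then show ?thesis by (simp add: x mult.assoc)
  qed
  then show ?case by blast
qed

text \<open>By \<open>psi_compress\<close> the value is an average of
  \<open>\<psi> (star (x * Sw \<nu>) * (x * Sw \<nu>))\<close> over long words, where orthonormality
  of words applies. Both conditions are closed and pass from polynomials to all
  \<open>x\<close>.\<close>

lemma psi_positive: "Im (\<psi> (star x * x)) = 0" "0 \<le> Re (\<psi> (star x * x))"
proof -
  have pos: "\<exists>r\<ge>0. \<psi> (star x * x) = complex_of_real r" if x: "x \<in> cuntz_poly" for x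
  proof -
    obtain l where l: "\<And>\<nu>. \<nu> \<in> Wl l \<Longrightarrow> x * Sw \<nu> \<in> word_span"
      using cuntz_poly_mult_Sw[OF x] by blast
    have "\<exists>r. \<forall>\<nu>\<in>Wl l. r \<nu> \<ge> 0 \<and> \<psi> (star (x * Sw \<nu>) * (x * Sw \<nu>)) = complex_of_real (r \<nu>)"
      by (rule bchoice) (use psi_positive_word_span[OF l] in blast)
    then obtain r where r: "\<And>\<nu>. \<nu> \<in> Wl l \<Longrightarrow> r \<nu> \<ge> 0"
      "\<And>\<nu>. \<nu> \<in> Wl l \<Longrightarrow> \<psi> (star (x * Sw \<nu>) * (x * Sw \<nu>)) = complex_of_real (r \<nu>)"
      by blast
    have "\<psi> (star x * x) = (\<Sum>\<nu>\<in>Wl l. complex_of_real (r \<nu>)) / of_nat n ^ l"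
      unfolding psi_compress[of "star x * x" l]
      by (intro arg_cong2[where f="(/)"] sum.cong refl) (simp add: r(2)[symmetric] star_mult mult.assoc)
    then show ?thesis
      by (intro exI[of _ "(\<Sum>\<nu>\<in>Wl l. r \<nu>) / real n ^ l"]) (simp add: r(1) sum_nonneg)
  qed
  have cont: "continuous_on UNIV (\<lambda>x. \<psi> (star x * x))"
    by (intro continuous_on_psi continuous_on_mult continuous_on_star continuous_on_id)
  let ?P = "{x. Im (\<psi> (star x * x)) = 0} \<inter> {x. 0 \<le> Re (\<psi> (star x * x))}"
  have "closure cuntz_poly \<subseteq> ?P"
  proof (rule closure_minimal)
    show "cuntz_poly \<subseteq> ?P" using pos by fastforce
    show "closed ?P"
      by (intro closed_Int closed_Collect_eq closed_Collect_le continuous_intros cont)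
  qed
  then show "Im (\<psi> (star x * x)) = 0" "0 \<le> Re (\<psi> (star x * x))"
    using closure_cuntz_poly by auto
qed

end

section \<open>The diagonal expectation\<close>

locale cuntz_diagonal = cuntz_system n S for n and S :: "nat \<Rightarrow> 'a::cstar_algebra" +
  fixes \<Phi> :: "'a \<Rightarrow> 'a"
  assumes expectation: "diag_expectation n S \<Phi>"
begin

lemma Phi_linear: "Vector_Spaces.linear scaleC scaleC \<Phi>"
  using expectation by (simp add: diag_expectation_def conditional_expectation_def)

lemma Phi_add: "\<Phi> (x + y) = \<Phi> x + \<Phi> y"
  using Phi_linear by (simp add: Vector_Spaces.linear_iff)

lemma Phi_scaleC: "\<Phi> (c *\<^sub>C x) = c *\<^sub>C \<Phi> x"
  using Phi_linear by (simp add: Vector_Spaces.linear_iff)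

lemma norm_Phi: "norm (\<Phi> x) \<le> norm x"
  using expectation by (simp add: diag_expectation_def conditional_expectation_def)

lemma bounded_linear_Phi: "bounded_linear \<Phi>"
  by (rule bounded_linear_intro[where K=1])
    (simp_all add: Phi_add norm_Phi Phi_scaleC flip: scaleC_of_real)

lemmas Phi_diff = linear_diff[OF bounded_linear.linear[OF bounded_linear_Phi]]
lemmas Phi_sum = linear_sum[OF bounded_linear.linear[OF bounded_linear_Phi]]
lemmas Phi_zero [simp] = linear_0[OF bounded_linear.linear[OF bounded_linear_Phi]]
lemmas continuous_on_Phi = bounded_linear.continuous_on[OF bounded_linear_Phi]

lemma diag_level_diag_masa: "x \<in> diag_level n S k \<Longrightarrow> x \<in> diag_masa n S"
  unfolding diag_masa_def by (rule subsetD[OF closure_subset]) blast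

lemma Phi_in_diag_masa: "\<Phi> x \<in> diag_masa n S"
  using expectation by (auto simp: diag_expectation_def conditional_expectation_def)

lemma Phi_diag_masa: "x \<in> diag_masa n S \<Longrightarrow> \<Phi> x = x"
  using expectation by (simp add: diag_expectation_def conditional_expectation_def)

lemma Phi_bimodule:
  "a \<in> diag_masa n S \<Longrightarrow> b \<in> diag_masa n S \<Longrightarrow> \<Phi> (a * x * b) = a * \<Phi> x * b"
  using expectation by (simp add: diag_expectation_def conditional_expectation_def)

lemma Phi_mult_left: "d \<in> diag_level n S k \<Longrightarrow> \<Phi> (d * x) = d * \<Phi> x"
  using Phi_bimodule[of d 1 x] diag_level_diag_masa one_diag_level by auto

lemma Phi_munit:
  assumes "\<alpha> \<in> W" "\<beta> \<in> W"
  shows "\<Phi> (munit \<alpha> \<beta>) = (if \<alpha> = \<beta> then munit \<alpha> \<alpha> else 0)"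
proof (cases "\<alpha> = \<beta>")
  case True
  have "munit \<alpha> \<alpha> \<in> diag_level n S (length \<alpha>)"
    using assms by (intro munit_diag_level) (simp add: words_of_length_def)
  then show ?thesis using True Phi_diag_masa diag_level_diag_masa by auto
qed (use assms expectation in \<open>simp add: diag_expectation_def\<close>)

lemma psi_Phi: "\<psi> (\<Phi> x) = \<psi> x"
proof (induction x rule: density_induct)
  case closed
  show ?case
    by (intro closed_Collect_eq continuous_on_psi continuous_on_Phi continuous_on_id)
qed (auto simp: complex_vector.subspace_def Phi_add Phi_scaleC psi_add psi_scaleC Phi_munit psi_munit)

lemma Phi_Deg: "x \<in> Deg d \<Longrightarrow> d \<noteq> 0 \<Longrightarrow> \<Phi> x = 0"
  by (induction rule: Deg_induct)
    (auto simp: complex_vector.subspace_def Phi_add Phi_scaleC Phi_munit)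

lemma Phi_core_level: "x \<in> core_level n S k \<Longrightarrow> \<Phi> x \<in> diag_level n S k"
proof (induction rule: core_level_induct)
  case subspace
  then show ?case
    by (simp add: complex_vector.subspace_def Phi_add Phi_scaleC subspace_diag_level[unfolded complex_vector.subspace_def])
next
  case (munit \<alpha> \<beta>)
  then show ?case
    using munit[THEN words_of_lengthD(1)]
    by (simp add: Phi_munit munit_diag_level complex_vector.subspace_0[OF subspace_diag_level])
qed

lemma Phi_Sw_conj:
  assumes "\<alpha> \<in> Wl k" "\<beta> \<in> Wl k"
  shows "\<Phi> (Sw \<alpha> * x * star (Sw \<beta>)) = (if \<alpha> = \<beta> then Sw \<alpha> * \<Phi> x * star (Sw \<alpha>) else 0)"
proof (induction x rule: density_induct)
  case closed
  show ?case
    by (cases "\<alpha> = \<beta>") (auto intro!: closed_Collect_eq continuous_intros continuous_on_Phi)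
next
  case subspace
  show ?case
    by (auto simp: complex_vector.subspace_def Phi_add Phi_scaleC distrib_left distrib_right
        scaleC_mult_left scaleC_mult_right)
next
  case (munit \<gamma> \<delta>)
  show ?case
  proof -
    have eq: "Sw \<alpha> * munit \<gamma> \<delta> * star (Sw \<beta>) = munit (\<alpha> @ \<gamma>) (\<beta> @ \<delta>)"
      by (simp add: Sw_append star_mult mult.assoc)
    have "\<alpha> @ \<gamma> = \<beta> @ \<delta> \<longleftrightarrow> \<alpha> = \<beta> \<and> \<gamma> = \<delta>"
      using assms[THEN words_of_lengthD(2)] by simp
    then show ?thesis
      using munit assms[THEN words_of_lengthD(1)]
      unfolding eq by (simp add: Phi_munit) (simp add: Sw_append star_mult mult.assoc)
  qed
qed

lemma Phi_shift_pow: "\<Phi> (\<sigma> k x) = \<sigma> k (\<Phi> x)"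
  unfolding shift_pow_eq_sum Phi_sum by (rule sum.cong) (simp_all add: Phi_Sw_conj)

lemma Phi_core_shift:
  assumes "f \<in> core_level n S k"
  shows "\<Phi> (f * \<sigma> k x) = \<Phi> f * \<sigma> k (\<Phi> x)"
  using assms
proof (induction rule: core_level_induct)
  case (munit \<alpha> \<beta>)
  note W = munit[THEN words_of_lengthD(1)] and l = munit[THEN words_of_lengthD(2)]
  have eq: "munit \<delta> \<gamma> * \<sigma> k y = Sw \<delta> * y * star (Sw \<gamma>)" if "\<gamma> \<in> Wl k" for \<gamma> \<delta> y
    using star_Sw_shift_pow[of \<gamma> k y] words_of_lengthD[OF that] by (simp add: mult.assoc)
  show ?case
    using munit W by (auto simp: eq Phi_Sw_conj Phi_munit)
qed (simp add: complex_vector.subspace_def Phi_add Phi_scaleC distrib_right scaleC_mult_left)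

text \<open>Compression by \<open>Sw \<mu>\<close> turns a diagonal element of this level into its
  coefficient times 1, and \<open>\<psi>\<close> reads the coefficient off.\<close>

lemma diag_level_eq_diag_sum:
  assumes "x \<in> diag_level n S k"
  shows "x = diag_sum k (\<lambda>\<mu>. \<psi> (star (Sw \<mu>) * x * Sw \<mu>))"
  using assms
proof (induction rule: diag_level_induct)
  case subspace
  define F where "F x = diag_sum k (\<lambda>\<mu>. \<psi> (star (Sw \<mu>) * x * Sw \<mu>))" for x
  have F: "F (x + y) = F x + F y" "F (c *\<^sub>C x) = c *\<^sub>C F x" "F 0 = 0" for x y c
    by (simp_all add: F_def diag_sum_def distrib_left distrib_right psi_add psi_scaleC
        scaleC_add_left sum.distrib scaleC_mult_left scaleC_mult_right scaleC_sum_right scaleC_scaleC)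
  have "complex_vector.subspace {x. F x = x}"
    by (simp add: complex_vector.subspace_def F)
  then show ?case unfolding F_def by (simp add: eq_commute)
next
  case (munit \<alpha>)
  have "diag_sum k (\<lambda>\<mu>. \<psi> (star (Sw \<mu>) * munit \<alpha> \<alpha> * Sw \<mu>)) = (\<Sum>\<mu>\<in>Wl k. if \<mu> = \<alpha> then munit \<alpha> \<alpha> else 0)"
    unfolding diag_sum_def
  proof (rule sum.cong[OF refl])
    fix \<mu> assume \<mu>: "\<mu> \<in> Wl k"
    have "star (Sw \<mu>) * munit \<alpha> \<alpha> * Sw \<mu> = (star (Sw \<mu>) * Sw \<alpha>) * (star (Sw \<alpha>) * Sw \<mu>)"
      by (simp add: mult.assoc)
    then show "\<psi> (star (Sw \<mu>) * munit \<alpha> \<alpha> * Sw \<mu>) *\<^sub>C munit \<mu> \<mu> = (if \<mu> = \<alpha> then munit \<alpha> \<alpha> else 0)"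
      using star_Sw_Sw[OF \<mu> munit] star_Sw_Sw[OF munit \<mu>] by (auto simp: scaleC_one)
  qed
  then show ?case using munit by simp
qed

text \<open>Testing against \<open>munit \<nu> \<nu> * star z\<close> shows that all diagonal
  coefficients of \<open>b = \<Phi> (star z * z)\<close> vanish. A finite-level approximant
  \<open>d\<close> of \<open>b\<close> then has coefficients, hence norm, bounded by the error, so
  \<open>b = 0\<close>, and faithfulness of \<open>\<Phi>\<close> applies.\<close>

lemma psi_faithful:
  assumes "\<And>y. \<psi> (y * z) = 0"
  shows "z = 0"
proof -
  define b where "b = \<Phi> (star z * z)"
  have coeff: "\<psi> (star (Sw \<nu>) * b * Sw \<nu>) = 0" if "\<nu> \<in> Wl l" for \<nu> l
  proof -
    note \<nu> = words_of_lengthD[OF that]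
    have "\<psi> (munit \<nu> \<nu> * b) = \<psi> (munit \<nu> \<nu> * star z * z)"
      unfolding b_def Phi_mult_left[OF munit_diag_level[OF that], symmetric] psi_Phi
      by (simp add: mult.assoc)
    then have "\<psi> (munit \<nu> \<nu> * b) = 0" using assms by simp
    then show ?thesis
      using psi_Sw_mult[OF \<nu>(1), of "star (Sw \<nu>) * b"] n_pos by (simp add: mult.assoc)
  qed
  have "norm b \<le> 0"
  proof (rule field_le_epsilon)
    fix e :: real assume "0 < e"
    have "b \<in> closure (\<Union>k. diag_level n S k)"
      using Phi_in_diag_masa by (simp add: b_def diag_masa_def)
    then obtain d l where d: "d \<in> diag_level n S l" and db: "norm (d - b) < e / 2"
      unfolding closure_approachable dist_norm using \<open>0 < e\<close> by (metis UN_E half_gt_zero)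
    have "cmod (\<psi> (star (Sw \<nu>) * d * Sw \<nu>)) \<le> e / 2" if "\<nu> \<in> Wl l" for \<nu>
    proof -
      have "\<psi> (star (Sw \<nu>) * d * Sw \<nu>) = \<psi> (star (Sw \<nu>) * (d - b) * Sw \<nu>)"
        using coeff[OF that] by (simp add: right_diff_distrib left_diff_distrib psi_diff)
      also have "cmod \<dots> \<le> norm (star (Sw \<nu>) * (d - b) * Sw \<nu>)" by (rule norm_psi)
      also have "\<dots> \<le> norm (star (Sw \<nu>)) * norm (d - b) * norm (Sw \<nu>)"
        by (meson norm_mult_ineq norm_ge_zero mult_right_mono order_trans)
      also have "\<dots> \<le> e / 2" using db words_of_lengthD(1)[OF that] by simp
      finally show ?thesis .
    qed
    then have "norm (diag_sum l (\<lambda>\<nu>. \<psi> (star (Sw \<nu>) * d * Sw \<nu>))) \<le> e / 2"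
      using \<open>0 < e\<close> by (intro norm_diag_sum_le) auto
    then have "norm d \<le> e / 2"
      by (simp flip: diag_level_eq_diag_sum[OF d])
    then show "norm b \<le> 0 + e"
      using db norm_triangle_ineq4[of d "d - b"] by simp
  qed
  then have "\<Phi> (star z * z) = 0" by (simp add: b_def)
  moreover have "faithful \<Phi>"
    using expectation by (simp add: diag_expectation_def)
  ultimately show ?thesis
    unfolding faithful_def by blast
qed

text \<open>For \<open>\<alpha> \<noteq> \<beta>\<close> the projection
  \<open>munit \<alpha> \<alpha>\<close> can be inserted in front, cycled to the right end by the
  centralizer property and carried back through \<open>y\<close>, where it annihilates
  \<open>munit \<alpha> \<beta>\<close> from the right.\<close>

lemma psi_core_level_Phi:
  assumes "f \<in> core_level n S k" and comm: "\<And>d. d \<in> diag_level n S k \<Longrightarrow> d * y = y * d"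
  shows "\<psi> (f * y) = \<psi> (\<Phi> f * y)"
  using assms(1)
proof (induction rule: core_level_induct)
  case (munit \<alpha> \<beta>)
  note W = munit[THEN words_of_lengthD(1)]
  show ?case
  proof (cases "\<alpha> = \<beta>")
    case False
    have "\<psi> (munit \<alpha> \<beta> * y) = \<psi> (munit \<alpha> \<alpha> * (munit \<alpha> \<beta> * y))"
      using munit_mult[OF munit(1) munit(1), of \<alpha> \<beta>] by (simp flip: mult.assoc)
    also have "\<dots> = \<psi> (munit \<alpha> \<beta> * (y * munit \<alpha> \<alpha>))"
      using psi_Deg0_commute[OF core_level_Deg[OF munit_core_level[OF munit(1,1)]], of "munit \<alpha> \<beta> * y"]
      by (simp add: mult.assoc)
    also have "y * munit \<alpha> \<alpha> = munit \<alpha> \<alpha> * y"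
      using comm[OF munit_diag_level[OF munit(1)]] by simp
    also have "munit \<alpha> \<beta> * (munit \<alpha> \<alpha> * y) = 0"
      using munit_mult[OF munit(2,1), of \<alpha> \<alpha>] False by (simp flip: mult.assoc)
    finally show ?thesis using False W by (simp add: Phi_munit)
  qed (use W in \<open>simp add: Phi_munit\<close>)
qed (simp add: complex_vector.subspace_def Phi_add Phi_scaleC psi_add psi_scaleC distrib_right scaleC_mult_left)

end

section \<open>Vanishing of the Fourier coefficients of nonzero degree\<close>

text \<open>For independent random signs the mean of the quadratic form is its diagonal sum. The
  induction makes this deterministic: the sign of the new index is chosen so that its cross terms
  contribute at most 0.\<close>

lemma sign_choice:
  fixes a :: "'i \<Rightarrow> 'i \<Rightarrow> real"
  assumes "finite I"
  shows "\<exists>\<epsilon> :: 'i \<Rightarrow> real. (\<forall>i. \<epsilon> i = 1 \<or> \<epsilon> i = -1) \<and> (\<Sum>i\<in>I. \<Sum>j\<in>I. \<epsilon> i * \<epsilon> j * a i j) \<le> (\<Sum>i\<in>I. a i i)"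
  using assms
proof (induction I rule: finite_induct)
  case empty
  show ?case by (intro exI[of _ "\<lambda>_. 1"]) simp
next
  case (insert k I)
  then obtain \<epsilon> :: "'i \<Rightarrow> real" where \<epsilon>: "\<And>i. \<epsilon> i = 1 \<or> \<epsilon> i = -1"
    and le: "(\<Sum>i\<in>I. \<Sum>j\<in>I. \<epsilon> i * \<epsilon> j * a i j) \<le> (\<Sum>i\<in>I. a i i)" by blast
  define t where "t = (\<Sum>j\<in>I. \<epsilon> j * (a k j + a j k))"
  define s :: real where "s = (if t \<le> 0 then 1 else -1)"
  define \<delta> where "\<delta> = \<epsilon>(k := s)"
  have \<delta>I: "\<delta> i = \<epsilon> i" if "i \<in> I" for i using that insert.hyps by (auto simp: \<delta>_def)
  have "(\<Sum>i\<in>insert k I. \<Sum>j\<in>insert k I. \<delta> i * \<delta> j * a i j)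
      = s * s * a k k + (\<Sum>j\<in>I. s * \<epsilon> j * a k j) + (\<Sum>i\<in>I. \<epsilon> i * s * a i k)
        + (\<Sum>i\<in>I. \<Sum>j\<in>I. \<epsilon> i * \<epsilon> j * a i j)"
    using insert.hyps by (simp add: sum.distrib \<delta>I cong: sum.cong) (simp add: \<delta>_def)
  also have "\<dots> = a k k + s * t + (\<Sum>i\<in>I. \<Sum>j\<in>I. \<epsilon> i * \<epsilon> j * a i j)"
    by (simp add: t_def s_def sum_distrib_left sum.distrib sum_negf algebra_simps)
  also have "\<dots> \<le> (\<Sum>i\<in>insert k I. a i i)"
    using le insert.hyps by (simp add: s_def)
  finally show ?case
    using \<epsilon> by (intro exI[of _ \<delta>]) (auto simp: \<delta>_def s_def)
qed

section \<open>Overlap of projections and symmetries with their shifts\<close>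

context cuntz_system
begin

text \<open>A Hilbert space inside the algebra: for \<open>x\<close> and \<open>y\<close> in it,
  \<open>star x * y\<close> is a multiple of 1, namely the inner product.\<close>

definition words_span :: "nat \<Rightarrow> 'a set" where
  "words_span k = complex_vector.span (Sw ` Wl k)"

lemma subspace_words_span: "complex_vector.subspace (words_span k)"
  unfolding words_span_def by (rule complex_vector.subspace_span)

lemma Sw_words_span: "\<mu> \<in> Wl k \<Longrightarrow> Sw \<mu> \<in> words_span k"
  unfolding words_span_def by (rule complex_vector.span_base) simp

lemma words_span_induct [consumes 1, case_names subspace Sw]:
  assumes "x \<in> words_span k" "complex_vector.subspace {x. P x}" "\<And>\<alpha>. \<alpha> \<in> Wl k \<Longrightarrow> P (Sw \<alpha>)"
  shows "P x"
  by (rule complex_vector.span_induct[OF assms(1)[unfolded words_span_def] assms(2)]) (use assms(3) in auto)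

lemma core_level_mult_words_span:
  assumes "x \<in> core_level n S k" "y \<in> words_span k"
  shows "x * y \<in> words_span k"
  using assms unfolding core_level_def words_span_def
proof (rule span_mult_closed[rotated])
  fix x y assume "x \<in> {munit \<mu> \<nu> | \<mu> \<nu>. \<mu> \<in> Wl k \<and> \<nu> \<in> Wl k}" "y \<in> Sw ` Wl k"
  then obtain \<mu> \<nu> \<beta> where xy: "x = munit \<mu> \<nu>" "y = Sw \<beta>" and W: "\<mu> \<in> Wl k" "\<nu> \<in> Wl k" "\<beta> \<in> Wl k"
    by auto
  have "x * y = (if \<nu> = \<beta> then Sw \<mu> else 0)"
    using star_Sw_Sw[OF W(2,3)] by (simp add: xy mult.assoc)
  then show "x * y \<in> complex_vector.span (Sw ` Wl k)"
    using W Sw_words_span[OF W(1)] by (simp add: complex_vector.span_zero words_span_def)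
qed

lemma star_words_span_mult:
  assumes x: "x \<in> words_span a" and y: "y \<in> words_span b" and "a \<le> b"
  shows "star x * y \<in> words_span (b - a)"
  using x
proof (induction rule: words_span_induct)
  case subspace
  show ?case
    using subspace_words_span[of "b - a"]
    by (simp add: complex_vector.subspace_def star_add star_scaleC distrib_right scaleC_mult_left)
next
  case (Sw \<alpha>)
  show ?case using y
  proof (induction rule: words_span_induct)
    case subspace
    show ?case
      using subspace_words_span[of "b - a"]
      by (simp add: complex_vector.subspace_def distrib_left scaleC_mult_right)
  next
    case inner: (Sw \<beta>)
    note \<alpha> = words_of_lengthD[OF Sw] and \<beta> = words_of_lengthD[OF inner]
    show ?case
    proof (rule star_Sw_Sw_cases[OF \<alpha>(1) \<beta>(1)])
      fix \<gamma> assume "\<gamma> \<in> W" "\<beta> = \<alpha> @ \<gamma>" "star (Sw \<alpha>) * Sw \<beta> = Sw \<gamma>"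
      then show ?thesis using \<alpha> \<beta> by (auto simp: words_of_length_def intro: Sw_words_span)
    next
      fix \<gamma> assume "\<gamma> \<in> W" "\<alpha> = \<beta> @ \<gamma>" "star (Sw \<alpha>) * Sw \<beta> = star (Sw \<gamma>)"
      then show ?thesis using \<alpha> \<beta> \<open>a \<le> b\<close> Sw_words_span[of "[]" 0] by auto
    qed (simp add: complex_vector.subspace_0[OF subspace_words_span])
  qed
qed

lemma psi_words_span_mult: "x \<in> words_span k \<Longrightarrow> \<psi> (x * y) = \<psi> (y * x) / of_nat n ^ k"
proof (induction rule: words_span_induct)
  case (Sw \<alpha>)
  from words_of_lengthD[OF this] show ?case by (simp add: psi_Sw_mult)
qed (simp add: complex_vector.subspace_def psi_add psi_scaleC distrib_left distrib_right
    scaleC_mult_left scaleC_mult_right add_divide_distrib)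

text \<open>\<open>star x * x\<close> is a scalar, which is read off both by \<open>\<psi>\<close>
  and by the C*-identity.\<close>

lemma norm_words_span:
  assumes "x \<in> words_span k"
  shows "(norm x)\<^sup>2 = Re (\<psi> (star x * x))"
proof -
  have "star x * x \<in> words_span 0"
    using star_words_span_mult[OF assms assms] by simp
  then obtain c where c: "star x * x = c *\<^sub>C 1"
    by (auto simp: words_span_def complex_vector.span_singleton)
  then have "\<psi> (star x * x) = c" by (simp add: psi_scaleC)
  moreover have "cmod c = (norm x)\<^sup>2"
    using cstar_identity[of x] by (simp add: c)
  ultimately show ?thesis
    using psi_positive[of x] by (simp add: cmod_def)
qed

text \<open>Here \<open>\<psi> p\<close> is \<open>1 / real n ^ r\<close>; the point is the gain of
  a factor 2 over this, uniformly in \<open>j\<close>. For \<open>j \<le> r\<close>,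
  \<open>p\<close> is the range projection of \<open>\<xi>\<close>, and the overlap is a sum of
  squared norms of the \<open>\<eta> \<gamma>\<close> divided by \<open>n ^ (r + j)\<close>. These
  are dominated by the \<open>\<rho> \<gamma>\<close>, whose squares add up to 1. For
  \<open>j > r\<close> the projection and its shift are independent.\<close>

lemma psi_rank_one_overlap:
  assumes u: "u \<in> core_level n S r" "unitary u" and \<nu>: "\<nu> \<in> Wl r" and "1 \<le> j" "1 \<le> r"
  defines "p \<equiv> u * munit \<nu> \<nu> * star u"
  shows "Re (\<psi> (p * \<sigma> j p)) \<le> 1 / (2 * real n ^ r)"
proof (cases "j \<le> r")
  case True
  define \<xi> where "\<xi> = u * Sw \<nu>"
  have \<xi>: "\<xi> \<in> words_span r"
    unfolding \<xi>_def by (intro core_level_mult_words_span u Sw_words_span \<nu>)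
  have \<xi>1: "star \<xi> * \<xi> = 1"
    using u(2) words_of_lengthD(1)[OF \<nu>] by (simp add: \<xi>_def star_mult mult.assoc unitary_cancel)
  have p: "p = \<xi> * star \<xi>" by (simp add: p_def \<xi>_def star_mult mult.assoc)
  define \<rho> where "\<rho> \<gamma> = star (Sw \<gamma>) * \<xi>" for \<gamma>
  define \<eta> where "\<eta> \<gamma> = star (\<rho> \<gamma>) * \<xi>" for \<gamma>
  have term_le: "Re (\<psi> (p * (Sw \<gamma> * p * star (Sw \<gamma>)))) \<le> Re (\<psi> (star (\<rho> \<gamma>) * \<rho> \<gamma>)) / real n ^ (r + j)"
    if \<gamma>: "\<gamma> \<in> Wl j" for \<gamma>
  proof -
    have \<rho>: "\<rho> \<gamma> \<in> words_span (r - j)"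
      unfolding \<rho>_def by (rule star_words_span_mult[OF Sw_words_span[OF \<gamma>] \<xi> True])
    have \<eta>: "\<eta> \<gamma> \<in> words_span j"
      unfolding \<eta>_def using star_words_span_mult[OF \<rho> \<xi>] True by simp
    have "\<psi> (p * (Sw \<gamma> * p * star (Sw \<gamma>))) = \<psi> (\<xi> * (\<eta> \<gamma> * star \<xi> * star (Sw \<gamma>)))"
      by (simp add: p \<eta>_def \<rho>_def star_mult star_star mult.assoc)
    also have "\<dots> = \<psi> (\<eta> \<gamma> * star (\<eta> \<gamma>)) / of_nat n ^ r"
      unfolding psi_words_span_mult[OF \<xi>] by (simp add: \<eta>_def \<rho>_def star_mult star_star mult.assoc)
    also have "\<dots> = \<psi> (star (\<eta> \<gamma>) * \<eta> \<gamma>) / of_nat n ^ (r + j)"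
      unfolding psi_words_span_mult[OF \<eta>] by (simp add: power_add)
    also have "Re \<dots> = Re (\<psi> (star (\<eta> \<gamma>) * \<eta> \<gamma>)) / real n ^ (r + j)"
      by (metis Re_divide_of_real of_real_of_nat_eq of_real_power)
    also have "Re (\<psi> (star (\<eta> \<gamma>) * \<eta> \<gamma>)) = (norm (\<eta> \<gamma>))\<^sup>2"
      by (rule norm_words_span[OF \<eta>, symmetric])
    also have "(norm (\<eta> \<gamma>))\<^sup>2 / real n ^ (r + j) \<le> (norm (\<rho> \<gamma>))\<^sup>2 / real n ^ (r + j)"
    proof (intro divide_right_mono power_mono)
      show "norm (\<eta> \<gamma>) \<le> norm (\<rho> \<gamma>)"
        unfolding \<eta>_def using norm_mult_ineq[of "star (\<rho> \<gamma>)" \<xi>] norm_isometry[OF \<xi>1] by simp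
    qed simp_all
    also have "(norm (\<rho> \<gamma>))\<^sup>2 = Re (\<psi> (star (\<rho> \<gamma>) * \<rho> \<gamma>))"
      by (rule norm_words_span[OF \<rho>])
    finally show ?thesis .
  qed
  have "Re (\<psi> (p * \<sigma> j p)) = (\<Sum>\<gamma>\<in>Wl j. Re (\<psi> (p * (Sw \<gamma> * p * star (Sw \<gamma>)))))"
    unfolding shift_pow_eq_sum sum_distrib_left psi_sum by simp
  also have "\<dots> \<le> (\<Sum>\<gamma>\<in>Wl j. Re (\<psi> (star (\<rho> \<gamma>) * \<rho> \<gamma>)) / real n ^ (r + j))"
    by (rule sum_mono[OF term_le])
  also have "\<dots> = Re (\<psi> (\<Sum>\<gamma>\<in>Wl j. star (\<rho> \<gamma>) * \<rho> \<gamma>)) / real n ^ (r + j)"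
    by (simp add: psi_sum sum_divide_distrib)
  also have "(\<Sum>\<gamma>\<in>Wl j. star (\<rho> \<gamma>) * \<rho> \<gamma>) = star \<xi> * (\<Sum>\<gamma>\<in>Wl j. munit \<gamma> \<gamma>) * \<xi>"
    by (simp add: \<rho>_def star_mult star_star sum_distrib_left sum_distrib_right mult.assoc)
  also have "\<dots> = 1" by (simp add: sum_munit \<xi>1)
  also have "Re (\<psi> 1) / real n ^ (r + j) \<le> 1 / (2 * real n ^ r)"
  proof -
    have "2 \<le> real n ^ 1" using two_le by simp
    also have "\<dots> \<le> real n ^ j" using two_le \<open>1 \<le> j\<close> by (intro power_increasing) auto
    finally show ?thesis using n_pos by (simp add: power_add field_simps)
  qed
  finally show ?thesis .
next
  case False
  have P: "munit \<nu> \<nu> \<in> core_level n S r" by (rule munit_core_level[OF \<nu> \<nu>])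
  have "p \<in> core_level n S r"
    unfolding p_def by (intro core_level_mult u core_level_star P)
  then have "p \<in> core_level n S j" using False by (intro core_level_mono[of r j]) auto
  then have "\<psi> (p * \<sigma> j p) = \<psi> p * \<psi> p" by (rule psi_core_shift)
  also have "\<psi> p = \<psi> (munit \<nu> \<nu>)"
    using psi_Deg0_commute[OF core_level_Deg[OF u(1)], of "munit \<nu> \<nu> * star u"] u(2)
    by (simp add: p_def mult.assoc unitary_cancel)
  also have "\<dots> = complex_of_real (1 / real n ^ r)"
    using words_of_lengthD[OF \<nu>] by (simp add: psi_munit)
  finally have "\<psi> (p * \<sigma> j p) = complex_of_real (1 / real n ^ r * (1 / real n ^ r))" by simp
  then have "Re (\<psi> (p * \<sigma> j p)) = 1 / real n ^ r * (1 / real n ^ r)" by (simp only: Re_complex_of_real)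
  also have "\<dots> \<le> 1 / real n ^ r * (1 / 2)"
  proof (rule mult_left_mono)
    have "2 \<le> real n ^ 1" using two_le by simp
    also have "\<dots> \<le> real n ^ r" using two_le \<open>1 \<le> r\<close> by (intro power_increasing) auto
    finally show "1 / real n ^ r \<le> 1 / 2" by (intro divide_left_mono) (use n_pos in auto)
  qed simp
  finally show ?thesis by simp
qed

text \<open>The \<open>n ^ r\<close> diagonal terms are at most \<open>1 / (2 * n ^ r)\<close> each,
  and the signs keep the cross terms from adding to them. The symmetry depends on the lag
  \<open>j\<close>.\<close>

lemma exists_diag_symmetry:
  assumes u: "u \<in> core_level n S r" "unitary u" and "1 \<le> j" "1 \<le> r"
  shows "\<exists>d\<in>diag_level n S r. star d = d \<and> d * d = 1 \<and>
    Re (\<psi> (u * d * star u * \<sigma> j (u * d * star u))) \<le> 1 / 2"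
proof -
  define p where "p \<nu> = u * munit \<nu> \<nu> * star u" for \<nu>
  obtain \<epsilon> :: "nat list \<Rightarrow> real" where \<epsilon>: "\<And>\<nu>. \<epsilon> \<nu> = 1 \<or> \<epsilon> \<nu> = -1"
    and le: "(\<Sum>\<mu>\<in>Wl r. \<Sum>\<nu>\<in>Wl r. \<epsilon> \<mu> * \<epsilon> \<nu> * Re (\<psi> (p \<mu> * \<sigma> j (p \<nu>))))
      \<le> (\<Sum>\<nu>\<in>Wl r. Re (\<psi> (p \<nu> * \<sigma> j (p \<nu>))))"
    using sign_choice[OF finite_words_of_length[of n r], of "\<lambda>\<mu> \<nu>. Re (\<psi> (p \<mu> * \<sigma> j (p \<nu>)))"] by blast
  define d where "d = diag_sum r (\<lambda>\<nu>. complex_of_real (\<epsilon> \<nu>))"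
  have "complex_of_real (\<epsilon> \<nu>) * complex_of_real (\<epsilon> \<nu>) = 1" for \<nu>
    using \<epsilon>[of \<nu>] by auto
  then have dd: "d * d = 1"
    by (simp add: d_def diag_sum_mult) (simp add: diag_sum_def scaleC_one sum_munit)
  have g: "u * d * star u = (\<Sum>\<nu>\<in>Wl r. complex_of_real (\<epsilon> \<nu>) *\<^sub>C p \<nu>)"
    by (simp add: d_def diag_sum_def p_def sum_distrib_left sum_distrib_right scaleC_mult_left scaleC_mult_right)
  have "\<psi> (u * d * star u * \<sigma> j (u * d * star u))
      = (\<Sum>\<mu>\<in>Wl r. \<Sum>\<nu>\<in>Wl r. complex_of_real (\<epsilon> \<mu> * \<epsilon> \<nu>) * \<psi> (p \<mu> * \<sigma> j (p \<nu>)))"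
    unfolding g shift_pow_sum sum_product psi_sum
    by (simp add: shift_pow_scaleC scaleC_mult_left scaleC_mult_right psi_scaleC mult_ac)
  then have "Re (\<psi> (u * d * star u * \<sigma> j (u * d * star u)))
      = (\<Sum>\<mu>\<in>Wl r. \<Sum>\<nu>\<in>Wl r. \<epsilon> \<mu> * \<epsilon> \<nu> * Re (\<psi> (p \<mu> * \<sigma> j (p \<nu>))))"
    by simp
  also note le
  also have "(\<Sum>\<nu>\<in>Wl r. Re (\<psi> (p \<nu> * \<sigma> j (p \<nu>)))) \<le> (\<Sum>\<nu>\<in>Wl r. 1 / (2 * real n ^ r))"
    unfolding p_def by (intro sum_mono psi_rank_one_overlap u assms)
  also have "\<dots> = 1 / 2" using n_pos by (simp add: card_words_of_length)
  finally have "Re (\<psi> (u * d * star u * \<sigma> j (u * d * star u))) \<le> 1 / 2" .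
  moreover have "d \<in> diag_level n S r" "star d = d"
    by (simp_all add: d_def diag_sum_diag_level diag_sum_star)
  ultimately show ?thesis using dd by blast
qed

section \<open>Asymptotic independence\<close>

lemma psi_shift_cuntz_poly:
  "z \<in> cuntz_poly \<Longrightarrow> \<exists>m0. \<forall>m\<ge>m0. \<forall>y\<in>Deg 0. \<psi> (\<sigma> m y * z) = \<psi> y * \<psi> z"
  unfolding cuntz_poly_def
proof (induction rule: complex_vector.span_induct)
  case base
  show ?case
    unfolding complex_vector.subspace_def
  proof safe
    fix x x' k l
    assume "\<forall>m\<ge>k. \<forall>y\<in>Deg 0. \<psi> (\<sigma> m y * x) = \<psi> y * \<psi> x" "\<forall>m\<ge>l. \<forall>y\<in>Deg 0. \<psi> (\<sigma> m y * x') = \<psi> y * \<psi> x'"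
    then show "\<exists>m0. \<forall>m\<ge>m0. \<forall>y\<in>Deg 0. \<psi> (\<sigma> m y * (x + x')) = \<psi> y * \<psi> (x + x')"
      by (intro exI[of _ "max k l"]) (auto simp: distrib_left psi_add)
  next
    fix c x k
    assume "\<forall>m\<ge>k. \<forall>y\<in>Deg 0. \<psi> (\<sigma> m y * x) = \<psi> y * \<psi> x"
    then show "\<exists>m0. \<forall>m\<ge>m0. \<forall>y\<in>Deg 0. \<psi> (\<sigma> m y * (c *\<^sub>C x)) = \<psi> y * \<psi> (c *\<^sub>C x)"
      by (intro exI[of _ k]) (auto simp: scaleC_mult_right psi_scaleC)
  qed simp
next
  case (step z)
  then obtain \<alpha> \<beta> where W: "\<alpha> \<in> W" "\<beta> \<in> W" and z: "z = munit \<alpha> \<beta>" by auto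
  have "\<psi> (\<sigma> m y * z) = \<psi> y * \<psi> z" if m: "m \<ge> length \<alpha>" and y: "y \<in> Deg 0" for m y
  proof (cases "length \<alpha> = length \<beta>")
    case True
    have "\<sigma> m y * z = Sw \<alpha> * \<sigma> (m - length \<alpha>) y * star (Sw \<beta>)"
      using shift_pow_Sw[OF W(1) m, of y] by (simp add: z flip: mult.assoc)
    then show ?thesis
      using psi_Sw_conj[of \<alpha> "length \<alpha>" \<beta>] W True psi_shift_pow
      by (simp add: words_of_length_def z psi_munit)
  next
    case False
    have "\<sigma> m y * z \<in> Deg (0 + (int (length \<alpha>) - int (length \<beta>)))"
      unfolding z by (intro Deg_mult shift_pow_Deg y munit_Deg W)
    then have "\<psi> (\<sigma> m y * z) = 0" using False by (intro psi_Deg) auto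
    moreover have "\<psi> z = 0" using False W by (auto simp: z psi_munit)
    ultimately show ?thesis by simp
  qed
  then show ?case by blast
qed

lemma unitary_shift_pow: "unitary y \<Longrightarrow> unitary (\<sigma> m y)"
  by (simp add: unitary_def flip: shift_pow_star shift_pow_mult)

text \<open>Independence is exact on polynomials, and unitaries have norm one, so \<open>m0\<close>
  is uniform in \<open>y\<close>. The uniformity is essential: the symmetry that goes into
  \<open>y\<close> is chosen only after \<open>m0\<close>.\<close>

lemma psi_mixing:
  assumes "e > 0"
  shows "\<exists>m0. \<forall>m\<ge>m0. \<forall>y\<in>Deg 0. unitary y \<longrightarrow> cmod (\<psi> (\<sigma> m y * z) - \<psi> y * \<psi> z) \<le> e"
proof -
  have "z \<in> closure cuntz_poly" by (simp add: closure_cuntz_poly)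
  then obtain z' where z': "z' \<in> cuntz_poly" and close: "norm (z' - z) < e / 2"
    unfolding closure_approachable dist_norm using assms by (metis half_gt_zero)
  obtain m0 where m0: "\<And>m y. m \<ge> m0 \<Longrightarrow> y \<in> Deg 0 \<Longrightarrow> \<psi> (\<sigma> m y * z') = \<psi> y * \<psi> z'"
    using psi_shift_cuntz_poly[OF z'] by blast
  have "cmod (\<psi> (\<sigma> m y * z) - \<psi> y * \<psi> z) \<le> e" if "m \<ge> m0" "y \<in> Deg 0" "unitary y" for m y
  proof -
    have "\<psi> (\<sigma> m y * z) - \<psi> y * \<psi> z = \<psi> y * \<psi> (z' - z) - \<psi> (\<sigma> m y * (z' - z))"
      using m0[OF that(1,2)] by (simp add: right_diff_distrib psi_diff)
    also have "cmod \<dots> \<le> cmod (\<psi> y) * cmod (\<psi> (z' - z)) + cmod (\<psi> (\<sigma> m y * (z' - z)))"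
      by (metis norm_triangle_ineq4 norm_mult)
    also have "\<dots> \<le> 1 * norm (z' - z) + 1 * norm (z' - z)"
    proof (intro add_mono mult_mono norm_psi)
      show "cmod (\<psi> y) \<le> 1" using norm_psi[of y] norm_unitary[OF that(3)] by simp
      show "cmod (\<psi> (\<sigma> m y * (z' - z))) \<le> 1 * norm (z' - z)"
        using norm_psi[of "\<sigma> m y * (z' - z)"] norm_mult_ineq[of "\<sigma> m y" "z' - z"]
          norm_unitary[OF unitary_shift_pow[OF that(3)], of m] by simp
    qed simp_all
    finally show ?thesis using close by simp
  qed
  then show ?thesis by blast
qed

text \<open>
  A symmetry \<open>\<sigma>\<^sup>R(g)\<close> commuting with \<open>x\<close> turns the coefficient \<open>z = S\<^sub>\<alpha>\<^sup>* x S\<^sub>\<beta>\<close> into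
  \<open>\<sigma>\<^sup>s(g) z \<sigma>\<^sup>t(g)\<close> with \<open>s \<noteq> t\<close>. Since \<open>\<sigma>\<^sup>t(g) \<sigma>\<^sup>s(g)\<close> is asymptotically independent of \<open>z\<close> and
  the real part of its expectation stays below \<open>1/2\<close>, the expectation of \<open>z\<close> must vanish.
\<close>

lemma fourier_coefficient_vanishes:
  assumes W: "\<alpha> \<in> W" "\<beta> \<in> W" and len: "length \<alpha> \<noteq> length \<beta>"
    and comm: "\<And>m0. \<exists>R\<ge>m0. \<exists>r\<ge>1. \<exists>u\<in>core_level n S r. unitary u \<and>
      (\<forall>d\<in>diag_level n S r. x * \<sigma> R (u * d * star u) = \<sigma> R (u * d * star u) * x)"
  shows "\<psi> (star (Sw \<alpha>) * x * Sw \<beta>) = 0"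
proof -
  define z where "z = star (Sw \<alpha>) * x * Sw \<beta>"
  have "cmod (\<psi> z) \<le> 0 + e" if "e > 0" for e
  proof -
    \<comment> \<open>Half of \<open>e\<close>, because at the end \<open>cmod (\<psi> z)\<close>
      carries the factor \<open>cmod (1 - \<psi> y)\<close>, which is only known to be at least
      \<open>1 / 2\<close>.\<close>
    obtain m0 where m0: "\<And>m y. m \<ge> m0 \<Longrightarrow> y \<in> Deg 0 \<Longrightarrow> unitary y \<Longrightarrow>
        cmod (\<psi> (\<sigma> m y * z) - \<psi> y * \<psi> z) \<le> e / 2"
      using psi_mixing[of "e / 2" z] \<open>e > 0\<close> by (metis half_gt_zero)
    obtain R r u where R: "R \<ge> m0 + length \<alpha> + length \<beta>" and r: "r \<ge> 1"
      and u: "u \<in> core_level n S r" "unitary u"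
      and xu: "\<And>d. d \<in> diag_level n S r \<Longrightarrow> x * \<sigma> R (u * d * star u) = \<sigma> R (u * d * star u) * x"
      using comm by blast
    \<comment> \<open>\<open>R\<close> exceeds \<open>m0\<close> by both lengths, so the smaller
      remaining shift \<open>m\<close> is still at least \<open>m0\<close>. The lag \<open>j\<close>
      is the difference of the two lengths.\<close>
    define s t where "s = R - length \<alpha>" and "t = R - length \<beta>"
    define m j where "m = min s t" and "j = max s t - m"
    have st: "s \<noteq> t" "m \<ge> m0" "j \<ge> 1"
      using R len by (auto simp: s_def t_def m_def j_def)
    obtain d where d: "d \<in> diag_level n S r" "star d = d" "d * d = 1"
      and half: "Re (\<psi> (u * d * star u * \<sigma> j (u * d * star u))) \<le> 1 / 2"
      using exists_diag_symmetry[OF u st(3) r] by blast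
    define g where "g = u * d * star u"
    have g: "star g = g" "g * g = 1"
    proof -
      show "star g = g" by (simp add: g_def star_mult star_star d(2) mult.assoc)
      have "g * g = u * (d * (star u * u) * d) * star u" by (simp add: g_def mult.assoc)
      then show "g * g = 1" by (simp add: u(2) unitary_cancel d(3))
    qed
    have g_unitary: "unitary g" using g by (simp add: unitary_def)
    have gDeg: "g \<in> Deg 0"
      unfolding g_def
      by (intro core_level_Deg[of _ r] core_level_mult core_level_star u diag_level_core_level d)
    define y where "y = \<sigma> (t - m) g * \<sigma> (s - m) g"
    have y: "y \<in> Deg 0" "unitary y"
      unfolding y_def using Deg_mult[of _ 0 _ 0] shift_pow_Deg[OF gDeg]
      by (auto intro: unitary_mult unitary_shift_pow g_unitary)
    have psi_y: "Re (\<psi> y) \<le> 1 / 2"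
    proof (cases "s < t")
      case True
      then have "y = \<sigma> j g * g" by (simp add: y_def m_def j_def)
      then show ?thesis using half psi_Deg0_commute[OF gDeg, of "\<sigma> j g"] by (simp add: g_def)
    next
      case False
      then have "y = g * \<sigma> j g" by (simp add: y_def m_def j_def)
      then show ?thesis using half by (simp add: g_def)
    qed
    \<comment> \<open>Since \<open>g * g = 1\<close>, a copy of \<open>\<sigma> R g\<close> can be
      placed on each side of \<open>x\<close>. The copies cross words of different lengths and come
      out with different shifts.\<close>
    have "z = star (Sw \<alpha>) * (\<sigma> R g * x * \<sigma> R g) * Sw \<beta>"
    proof -
      have "\<sigma> R g * x * \<sigma> R g = \<sigma> R g * \<sigma> R g * x"
        using xu[OF d(1)] by (simp add: g_def mult.assoc)
      then show ?thesis by (simp add: z_def g(2) flip: shift_pow_mult)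
    qed
    also have "\<dots> = (star (Sw \<alpha>) * \<sigma> R g) * x * (\<sigma> R g * Sw \<beta>)" by (simp add: mult.assoc)
    also have "\<dots> = \<sigma> s g * z * \<sigma> t g"
      using R by (simp add: star_Sw_shift_pow shift_pow_Sw W s_def t_def z_def mult.assoc)
    finally have "\<psi> z = \<psi> (\<sigma> t g * (\<sigma> s g * z))"
      using psi_Deg0_commute[OF shift_pow_Deg[OF gDeg], of t "\<sigma> s g * z"] by simp
    also have "\<sigma> t g * (\<sigma> s g * z) = \<sigma> m y * z"
      by (simp add: y_def shift_pow_mult shift_pow_pow mult.assoc m_def)
    finally have "cmod (\<psi> z - \<psi> y * \<psi> z) \<le> e / 2"
      using m0[OF st(2) y] by simp
    then have "cmod (1 - \<psi> y) * cmod (\<psi> z) \<le> e / 2"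
      by (simp add: left_diff_distrib flip: norm_mult)
    moreover have "1 / 2 \<le> cmod (1 - \<psi> y)"
      using complex_Re_le_cmod[of "1 - \<psi> y"] psi_y by simp
    then have "1 / 2 * cmod (\<psi> z) \<le> cmod (1 - \<psi> y) * cmod (\<psi> z)"
      by (rule mult_right_mono) simp
    ultimately show ?thesis by simp
  qed
  then have "cmod (\<psi> z) \<le> 0" by (rule field_le_epsilon)
  then show ?thesis by (simp add: z_def)
qed

end

section \<open>Infinite product conjugates of the diagonal\<close>

context cuntz_system
begin

text \<open>Compression by the word of \<open>m\<close> letters 1 undoes the shift. Injectivity lets
  unitarity pass from \<open>U k\<close> and \<open>d k\<close> to their unshifted
  preimages.\<close>

lemma shift_pow_eq_iff [simp]: "\<sigma> m x = \<sigma> m y \<longleftrightarrow> x = y"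
proof
  assume eq: "\<sigma> m x = \<sigma> m y"
  define \<mu> where "\<mu> = replicate m (1 :: nat)"
  have \<mu>: "\<mu> \<in> W" "length \<mu> = m"
    using two_le by (auto simp: \<mu>_def words_def)
  have "star (Sw \<mu>) * (\<sigma> m z * Sw \<mu>) = z" for z
    using shift_pow_Sw[of \<mu> m z] \<mu> by (simp flip: mult.assoc)
  then show "x = y" using eq by metis
qed simp

lemma unitary_shift_pow_iff: "unitary (\<sigma> m u) \<longleftrightarrow> unitary u"
proof -
  have "star (\<sigma> m u) * \<sigma> m u = \<sigma> m (star u * u)" "\<sigma> m u * star (\<sigma> m u) = \<sigma> m (u * star u)"
    by (simp_all add: shift_pow_mult shift_pow_star)
  then show ?thesis
    unfolding unitary_def by (metis shift_pow_eq_iff shift_pow_one)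
qed

end

locale product_conjugate = cuntz_diagonal n S \<Phi>
  for n and S :: "nat \<Rightarrow> 'a::cstar_algebra" and \<Phi> +
  fixes r R :: "nat \<Rightarrow> nat" and u :: "nat \<Rightarrow> 'a" and A :: "'a set"
  assumes r_pos: "\<And>k. 1 \<le> k \<Longrightarrow> 0 < r k"
    and R_eq: "\<And>k. 1 \<le> k \<Longrightarrow> R k = (\<Sum>j\<in>{1..<k}. r j)"
    and u_core: "\<And>k. 1 \<le> k \<Longrightarrow> u k \<in> core_level n S (r k)"
    and u_unitary: "\<And>k. 1 \<le> k \<Longrightarrow> unitary (u k)"
    and A_eq: "A = cstar_generated (\<Union>k\<in>{1..}. (\<lambda>x. \<sigma> (R k) (u k) * x * star (\<sigma> (R k) (u k))) `
      \<sigma> (R k) ` diag_level n S (r k))"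
begin

lemma R_1 [simp]: "R (Suc 0) = 0"
  using R_eq[of 1] by simp

lemma R_Suc: "R (Suc (Suc m)) = R (Suc m) + r (Suc m)"
  by (simp add: R_eq)

lemma R_ge: "m \<le> R (Suc m)"
proof (induction m)
  case (Suc m)
  then show ?case using r_pos[of "Suc m"] by (simp add: R_Suc)
qed simp

lemma R_mono: "m \<le> m' \<Longrightarrow> R (Suc m) \<le> R (Suc m')"
  by (induction m' rule: dec_induct) (auto simp: R_Suc)

section \<open>Blocks and partial products\<close>

definition block :: "nat \<Rightarrow> 'a \<Rightarrow> 'a" where
  "block k d = \<sigma> (R k) (u k * d * star (u k))"

lemma A_generated: "A = cstar_generated (\<Union>k\<in>{1..}. block k ` diag_level n S (r k))"
  unfolding A_eq block_def by (simp add: image_image shift_pow_mult shift_pow_star)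

lemma cstar_subalgebra_A: "cstar_subalgebra A"
  unfolding A_generated by (rule cstar_subalgebra_generated)

lemma subspace_A: "complex_vector.subspace A" and closed_A: "closed A"
  and A_mult: "x \<in> A \<Longrightarrow> y \<in> A \<Longrightarrow> x * y \<in> A"
  using cstar_subalgebra_A by (simp_all add: cstar_subalgebra_def)

lemma block_in_A: "1 \<le> k \<Longrightarrow> d \<in> diag_level n S (r k) \<Longrightarrow> block k d \<in> A"
  unfolding A_generated by (rule hull_inc) auto

lemma one_in_A: "1 \<in> A"
  using block_in_A[of 1 1] one_diag_level u_unitary[of 1] by (simp add: block_def unitary_cancel)

text \<open>\<open>V m\<close> uses the blocks 1 to \<open>m\<close> and lives in level
  \<open>R (Suc m)\<close>, their total length. It need not converge; only conjugation by it
  stabilizes, level by level.\<close>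

primrec V :: "nat \<Rightarrow> 'a" where
  "V 0 = 1"
| "V (Suc m) = V m * \<sigma> (R (Suc m)) (u (Suc m))"

lemma unitary_V: "unitary (V m)"
  by (induction m) (simp_all add: unitary_def[of 1] unitary_mult unitary_shift_pow u_unitary)

lemma V_core: "V m \<in> core_level n S (R (Suc m))"
proof (induction m)
  case 0
  then show ?case using one_diag_level diag_level_core_level by auto
next
  case (Suc m)
  have "V m \<in> core_level n S (R (Suc (Suc m)))"
    using Suc by (rule core_level_mono[rotated]) (simp add: R_Suc)
  moreover have "\<sigma> (R (Suc m)) (u (Suc m)) \<in> core_level n S (R (Suc (Suc m)))"
    unfolding R_Suc by (intro shift_pow_core_level u_core) simp
  ultimately show ?case by (simp add: core_level_mult)
qed

lemma V_Deg: "V m \<in> Deg 0"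
  by (rule core_level_Deg[OF V_core])

text \<open>A diagonal matrix unit splits into a prefix part of level \<open>R (Suc m)\<close> and a
  shifted suffix part. The new unitary commutes with the former, and \<open>star (V m)\<close> with
  the conjugated latter, so the conjugate factors into an element handled by induction and a
  block.\<close>

lemma V_conj_diag_in_A:
  "d \<in> diag_level n S (R (Suc m)) \<Longrightarrow> V m * d * star (V m) \<in> A"
proof (induction m arbitrary: d)
  case 0
  then have "d \<in> diag_level n S 0" by simp
  then show ?case
    by (induction rule: diag_level_induct) (simp_all add: subspace_A one_in_A)
next
  case (Suc m)
  define L where "L = R (Suc m)"
  define U where "U = \<sigma> L (u (Suc m))"
  have "d \<in> diag_level n S (L + r (Suc m))"
    using Suc.prems by (simp add: R_Suc L_def)
  then show ?case
  proof (induction rule: diag_level_induct)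
    case subspace
    show ?case
      using subspace_A
      by (simp add: complex_vector.subspace_def distrib_left distrib_right scaleC_mult_left scaleC_mult_right)
  next
    case (munit \<alpha>)
    define \<beta> \<gamma> where "\<beta> = take L \<alpha>" and "\<gamma> = drop L \<alpha>"
    have \<alpha>: "\<alpha> = \<beta> @ \<gamma>" by (simp add: \<beta>_def \<gamma>_def)
    have "\<beta> @ \<gamma> \<in> W" using words_of_lengthD(1)[OF munit] by (simp add: \<alpha>)
    moreover have "length \<beta> = L" "length \<gamma> = r (Suc m)"
      using words_of_lengthD(2)[OF munit] by (simp_all add: \<beta>_def \<gamma>_def)
    ultimately have \<beta>: "\<beta> \<in> Wl L" and \<gamma>: "\<gamma> \<in> Wl (r (Suc m))"
      by (simp_all add: words_of_length_def)
    define G where "G = \<sigma> L (munit \<gamma> \<gamma>)"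
    have "munit \<beta> \<beta> * G = Sw \<beta> * (star (Sw \<beta>) * G)" by (simp add: mult.assoc)
    also have "\<dots> = munit \<alpha> \<alpha>"
      using star_Sw_shift_pow[of \<beta> L "munit \<gamma> \<gamma>"] words_of_lengthD[OF \<beta>]
      by (simp add: G_def \<alpha> Sw_append star_mult mult.assoc)
    finally have split: "munit \<alpha> \<alpha> = munit \<beta> \<beta> * G" by simp
    have UG: "U * G * star U = block (Suc m) (munit \<gamma> \<gamma>)"
      by (simp add: U_def G_def block_def L_def shift_pow_mult shift_pow_star)
    have comm1: "U * munit \<beta> \<beta> = munit \<beta> \<beta> * U"
      unfolding U_def by (rule core_level_shift_pow_commute[OF munit_core_level[OF \<beta> \<beta>], symmetric])
    have comm2: "(U * G * star U) * star (V m) = star (V m) * (U * G * star U)"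
      unfolding UG block_def L_def[symmetric]
      by (rule core_level_shift_pow_commute[OF core_level_star[OF V_core[of m, folded L_def]], symmetric])
    have "V (Suc m) * munit \<alpha> \<alpha> * star (V (Suc m)) = V m * (U * munit \<beta> \<beta>) * G * star U * star (V m)"
      by (simp add: split U_def L_def star_mult mult.assoc)
    also have "\<dots> = V m * munit \<beta> \<beta> * ((U * G * star U) * star (V m))"
      by (simp add: comm1 mult.assoc)
    also have "\<dots> = (V m * munit \<beta> \<beta> * star (V m)) * (U * G * star U)"
      using comm2 by (simp add: mult.assoc)
    also have "\<dots> \<in> A"
      unfolding UG using munit_diag_level[OF \<beta>] munit_diag_level[OF \<gamma>]
      by (intro A_mult Suc.IH block_in_A) (simp_all add: L_def)
    finally show ?case .
  qed
qed

text \<open>All later factors are shifted past the level of \<open>f\<close>, so they commute with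
  it and cancel.\<close>

lemma V_conj_stable:
  assumes "m \<le> m'" and f: "f \<in> core_level n S (R (Suc m))"
  shows "V m' * f * star (V m') = V m * f * star (V m)"
  using assms(1)
proof (induction m' rule: dec_induct)
  case (step k)
  define U where "U = \<sigma> (R (Suc k)) (u (Suc k))"
  have "f \<in> core_level n S (R (Suc k))"
    by (rule core_level_mono[OF R_mono[OF step(1)] f])
  then have "U * f = f * U"
    unfolding U_def by (rule core_level_shift_pow_commute[symmetric])
  moreover have "U * star U = 1"
    unfolding U_def using unitary_shift_pow[OF u_unitary[of "Suc k"]] by (simp add: unitary_def)
  ultimately have "U * f * star U = f"
    by (metis mult.assoc mult.right_neutral)
  moreover have "V (Suc k) * f * star (V (Suc k)) = V k * (U * f * star U) * star (V k)"
    by (simp add: U_def star_mult mult.assoc)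
  ultimately show ?case using step.IH by simp
qed simp

lemma abelian_A: "abelian A"
  unfolding A_generated
proof (rule abelian_generated)
  fix x assume "x \<in> (\<Union>k\<in>{1..}. block k ` diag_level n S (r k))"
  then obtain k d where "1 \<le> k" "d \<in> diag_level n S (r k)" "x = block k d" by auto
  moreover from this have "star x = block k (star d)"
    by (simp add: block_def star_mult star_star mult.assoc flip: shift_pow_star)
  ultimately show "star x \<in> (\<Union>k\<in>{1..}. block k ` diag_level n S (r k))"
    using diag_level_star by auto
next
  have less: "block k d * block l d' = block l d' * block k d"
    if kl0: "1 \<le> k" "k < l" and d: "d \<in> diag_level n S (r k)" for k l d d'
  proof -
    obtain k' l' where kl: "k = Suc k'" "l = Suc l'" "Suc k' \<le> l'"
      using kl0 by (cases k; cases l) auto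
    have "u k * d * star (u k) \<in> core_level n S (r k)"
      by (intro core_level_mult core_level_star diag_level_core_level u_core kl0(1) d)
    then have "block k d \<in> core_level n S (R (Suc k))"
      unfolding block_def kl R_Suc by (rule shift_pow_core_level)
    then have "block k d \<in> core_level n S (R l)"
      unfolding kl by (rule core_level_mono[OF R_mono[OF kl(3)]])
    then show ?thesis
      unfolding block_def[of l] by (rule core_level_shift_pow_commute)
  qed
  fix x y
  assume "x \<in> (\<Union>k\<in>{1..}. block k ` diag_level n S (r k))" "y \<in> (\<Union>k\<in>{1..}. block k ` diag_level n S (r k))"
  then obtain k d l d' where k: "1 \<le> k" "d \<in> diag_level n S (r k)" "x = block k d"
    and l: "1 \<le> l" "d' \<in> diag_level n S (r l)" "y = block l d'" by auto
  show "x * y = y * x"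
  proof (cases "k = l")
    case True
    obtain f g where "d = diag_sum (r k) f" "d' = diag_sum (r k) g"
      using k l True diag_level_eq_diag_sum by metis
    then have "d * d' = d' * d"
      by (simp add: diag_sum_mult mult.commute)
    then have "u k * d * star (u k) * (u k * d' * star (u k)) = u k * d' * star (u k) * (u k * d * star (u k))"
      using u_unitary[OF k(1)]
      by (simp add: mult.assoc unitary_cancel) (metis mult.assoc)
    then show ?thesis
      unfolding k l True[symmetric] block_def by (metis shift_pow_mult)
  next
    case False
    then consider "k < l" | "l < k" by linarith
    then show ?thesis
      by cases (use less k l in \<open>auto\<close>)
  qed
qed

subsection \<open>The conditional expectation onto the product conjugate\<close>

definition cond_exp :: "nat \<Rightarrow> 'a \<Rightarrow> 'a" where
  "cond_exp m x = V m * \<Phi> (star (V m) * x * V m) * star (V m)"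

lemma cond_exp_add: "cond_exp m (x + y) = cond_exp m x + cond_exp m y"
  by (simp add: cond_exp_def distrib_left distrib_right Phi_add)

lemma cond_exp_scaleC: "cond_exp m (c *\<^sub>C x) = c *\<^sub>C cond_exp m x"
  by (simp add: cond_exp_def scaleC_mult_left scaleC_mult_right Phi_scaleC)

lemma norm_cond_exp: "norm (cond_exp m x) \<le> norm x"
proof -
  have "norm (cond_exp m x) \<le> norm (\<Phi> (star (V m) * x * V m))"
    unfolding cond_exp_def by (rule norm_conj_unitary_le[OF unitary_V])
  also have "\<dots> \<le> norm (star (V m) * x * star (star (V m)))"
    by (simp add: star_star norm_Phi)
  also have "\<dots> \<le> norm x"
    by (rule norm_conj_unitary_le[OF unitary_star[OF unitary_V]])
  finally show ?thesis .
qed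

text \<open>By density, only monomials matter. In nonzero degree every term is 0. In degree zero the
  sequence is constant from \<open>m = k\<close> on, since \<open>k \<le> R (Suc k)\<close> puts the
  monomial into a level where conjugation by \<open>V\<close> has stabilized.\<close>

lemma cond_exp_convergent: "\<exists>a\<in>A. (\<lambda>m. cond_exp m x) \<longlonglongrightarrow> a"
proof (induction x rule: density_induct)
  case closed
  have "cond_exp m (x - y) = cond_exp m x - cond_exp m y" for m x y
    using cond_exp_add[of m "x - y" y] by simp
  then show ?case
    by (intro closed_contractive_limits norm_cond_exp closed_A)
next
  case subspace
  show ?case
    unfolding complex_vector.subspace_def
  proof safe
    show "\<exists>a\<in>A. (\<lambda>m. cond_exp m 0) \<longlonglongrightarrow> a"
      using complex_vector.subspace_0[OF subspace_A] by (intro bexI[of _ 0]) (simp_all add: cond_exp_def)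
  next
    fix x y a b
    assume "a \<in> A" "b \<in> A" "(\<lambda>m. cond_exp m x) \<longlonglongrightarrow> a" "(\<lambda>m. cond_exp m y) \<longlonglongrightarrow> b"
    then show "\<exists>a\<in>A. (\<lambda>m. cond_exp m (x + y)) \<longlonglongrightarrow> a"
      using complex_vector.subspace_add[OF subspace_A]
      by (intro bexI[of _ "a + b"]) (simp_all add: cond_exp_add tendsto_add)
  next
    fix x a c
    assume "a \<in> A" and lim: "(\<lambda>m. cond_exp m x) \<longlonglongrightarrow> a"
    then show "\<exists>a\<in>A. (\<lambda>m. cond_exp m (c *\<^sub>C x)) \<longlonglongrightarrow> a"
      using complex_vector.subspace_scale[OF subspace_A] tendsto_scaleC[OF lim, of c]
      by (intro bexI[of _ "c *\<^sub>C a"]) (simp_all add: cond_exp_scaleC)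
  qed
next
  case (munit \<alpha> \<beta>)
  show ?case
  proof (cases "length \<alpha> = length \<beta>")
    case False
    have "cond_exp m (munit \<alpha> \<beta>) = 0" for m
    proof -
      have "star (V m) * munit \<alpha> \<beta> * V m \<in> Deg (- 0 + (int (length \<alpha>) - int (length \<beta>)) + 0)"
        by (intro Deg_mult Deg_star V_Deg munit_Deg munit)
      then show ?thesis using False by (simp add: cond_exp_def Phi_Deg)
    qed
    then show ?thesis
      using complex_vector.subspace_0[OF subspace_A] by (intro bexI[of _ 0]) simp_all
  next
    case True
    define k where "k = length \<alpha>"
    define f where "f = star (V k) * munit \<alpha> \<beta> * V k"
    have level: "munit \<alpha> \<beta> \<in> core_level n S (R (Suc k))"
      using munit True R_ge[of k] by (intro core_level_mono[OF R_ge] munit_core_level)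
        (simp_all add: words_of_length_def k_def)
    have f: "f \<in> core_level n S (R (Suc k))"
      unfolding f_def by (rule core_level_mult[OF core_level_mult[OF core_level_star[OF V_core] level] V_core])
    have "cond_exp m (munit \<alpha> \<beta>) = V k * \<Phi> f * star (V k)" if "k \<le> m" for m
    proof -
      have "munit \<alpha> \<beta> = V k * f * star (V k)"
        by (simp add: f_def mult.assoc unitary_cancel[OF unitary_V])
      also have "\<dots> = V m * f * star (V m)"
        by (rule V_conj_stable[OF that f, symmetric])
      finally have "star (V m) * munit \<alpha> \<beta> * V m = f"
        by (simp add: mult.assoc unitary_cancel[OF unitary_V])
      then show ?thesis
        using V_conj_stable[OF that diag_level_core_level[OF Phi_core_level[OF f]]]
        by (simp add: cond_exp_def)
    qed
    then have "(\<lambda>m. cond_exp m (munit \<alpha> \<beta>)) \<longlonglongrightarrow> V k * \<Phi> f * star (V k)"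
      by (intro tendsto_eventually) (auto simp: eventually_sequentially)
    then show ?thesis
      using V_conj_diag_in_A[OF Phi_core_level[OF f]] by blast
  qed
qed

text \<open>\<open>a\<close> may be rewritten with \<open>V m'\<close> in place of
  \<open>V m\<close>; then \<open>V m'\<close> cycles around because it lies in the centralizer, and
  \<open>\<Phi>\<close> preserves \<open>\<psi>\<close> and is linear over the diagonal.\<close>

lemma psi_mult_cond_exp:
  assumes d: "d \<in> diag_level n S (R (Suc m))" and "m \<le> m'"
  defines "a \<equiv> V m * d * star (V m)"
  shows "\<psi> (a * cond_exp m' x) = \<psi> (a * x)"
proof -
  define y where "y = star (V m') * x * V m'"
  have a: "a = V m' * d * star (V m')"
    unfolding a_def by (rule V_conj_stable[OF \<open>m \<le> m'\<close> diag_level_core_level[OF d], symmetric])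
  have "a * cond_exp m' x = V m' * (d * \<Phi> y * star (V m'))"
    by (simp add: a cond_exp_def y_def mult.assoc unitary_cancel[OF unitary_V])
  then have "\<psi> (a * cond_exp m' x) = \<psi> (d * \<Phi> y)"
    by (simp add: psi_Deg0_commute[OF V_Deg] mult.assoc unitary_cancel[OF unitary_V])
  also have "\<dots> = \<psi> (d * y)"
    unfolding Phi_mult_left[OF d, symmetric] by (rule psi_Phi)
  also have "\<dots> = \<psi> (V m' * (d * star (V m') * x))"
    by (simp add: psi_Deg0_commute[OF V_Deg] y_def mult.assoc)
  finally show ?thesis by (simp add: a mult.assoc)
qed

lemma commutant_A_subset:
  assumes x: "\<And>a. a \<in> A \<Longrightarrow> x * a = a * x"
  shows "x \<in> A"
proof -
  obtain c where c: "c \<in> A" and lim: "(\<lambda>m. cond_exp m x) \<longlonglongrightarrow> c"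
    using cond_exp_convergent by blast
  have cA: "c * a = a * c" if "a \<in> A" for a
    using abelian_A c that by (simp add: abelian_def)
  \<comment> \<open>Stated for every element commuting with \<open>A\<close>, since it is applied to
    \<open>x\<close> and to its limit \<open>c\<close>.\<close>
  have nonzero_degree: "\<psi> (munit \<alpha> \<beta> * y) = 0"
    if W: "\<alpha> \<in> W" "\<beta> \<in> W" "length \<alpha> \<noteq> length \<beta>" and y: "\<And>a. a \<in> A \<Longrightarrow> y * a = a * y" for \<alpha> \<beta> y
  proof -
    have "\<psi> (star (Sw \<beta>) * y * Sw \<alpha>) = 0"
    proof (rule fourier_coefficient_vanishes)
      fix m0
      have "y * block (Suc m0) d = block (Suc m0) d * y" if "d \<in> diag_level n S (r (Suc m0))" for d
        using that by (intro y block_in_A) simp_all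
      then show "\<exists>R\<ge>m0. \<exists>r\<ge>1. \<exists>u\<in>core_level n S r. unitary u \<and>
          (\<forall>d\<in>diag_level n S r. y * \<sigma> R (u * d * star u) = \<sigma> R (u * d * star u) * y)"
        unfolding block_def using R_ge[of m0] r_pos[of "Suc m0"] u_core[of "Suc m0"] u_unitary[of "Suc m0"]
        by (intro exI[of _ "R (Suc m0)"] conjI exI[of _ "r (Suc m0)"] bexI[of _ "u (Suc m0)"]) auto
    qed (use W in auto)
    then show ?thesis
      using psi_Sw_mult[OF W(1), of "star (Sw \<beta>) * y"] by (simp add: mult.assoc)
  qed
  have "\<psi> (y * (x - c)) = 0" for y
  proof (induction y rule: density_induct)
    case closed
    show ?case
      by (intro closed_Collect_eq continuous_on_psi continuous_intros)
  next
    case subspace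
    show ?case
      by (simp add: complex_vector.subspace_def distrib_right scaleC_mult_left psi_add psi_scaleC)
  next
    case (munit \<alpha> \<beta>)
    have "\<psi> (munit \<alpha> \<beta> * x) = \<psi> (munit \<alpha> \<beta> * c)"
    proof (cases "length \<alpha> = length \<beta>")
      case False
      then show ?thesis using nonzero_degree[OF munit False] x cA by simp
    next
      case True
      define k where "k = length \<alpha>"
      define f where "f = star (V k) * munit \<alpha> \<beta> * V k"
      have level: "munit \<alpha> \<beta> \<in> core_level n S (R (Suc k))"
        using munit True by (intro core_level_mono[OF R_ge] munit_core_level)
          (simp_all add: words_of_length_def k_def)
      have f: "f \<in> core_level n S (R (Suc k))"
        unfolding f_def by (rule core_level_mult[OF core_level_mult[OF core_level_star[OF V_core] level] V_core])
      have d: "\<Phi> f \<in> diag_level n S (R (Suc k))" by (rule Phi_core_level[OF f])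
      define a where "a = V k * \<Phi> f * star (V k)"
      \<comment> \<open>Within the finite level, off-diagonal matrix units are invisible to elements
        commuting with \<open>A\<close>, so the monomial may be replaced by its expectation
        \<open>a\<close>.\<close>
      have reduce: "\<psi> (munit \<alpha> \<beta> * y) = \<psi> (a * y)" if y: "\<And>a. a \<in> A \<Longrightarrow> y * a = a * y" for y
      proof -
        define y' where "y' = star (V k) * y * V k"
        have comm: "e * y' = y' * e" if "e \<in> diag_level n S (R (Suc k))" for e
        proof -
          define b where "b = V k * e * star (V k)"
          have "e * y' = star (V k) * (b * y) * V k" "y' * e = star (V k) * (y * b) * V k"
            by (simp_all add: y'_def b_def mult.assoc unitary_cancel[OF unitary_V])
          then show ?thesis using y[OF V_conj_diag_in_A[OF that]] by (simp add: b_def)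
        qed
        have conj: "\<psi> (V k * g * star (V k) * y) = \<psi> (g * y')" for g
          using psi_Deg0_commute[OF V_Deg, of k "g * star (V k) * y"] by (simp add: y'_def mult.assoc)
        have "munit \<alpha> \<beta> = V k * f * star (V k)"
          by (simp add: f_def mult.assoc unitary_cancel[OF unitary_V])
        then have "\<psi> (munit \<alpha> \<beta> * y) = \<psi> (f * y')" using conj by simp
        also have "\<dots> = \<psi> (\<Phi> f * y')" by (rule psi_core_level_Phi[OF f comm])
        also have "\<dots> = \<psi> (a * y)" unfolding a_def conj ..
        finally show ?thesis .
      qed
      \<comment> \<open>The sequence tends to \<open>\<psi> (a * c)\<close> by continuity but is
        eventually the constant \<open>\<psi> (a * x)\<close>.\<close>
      have "(\<lambda>m. \<psi> (a * cond_exp m x)) \<longlonglongrightarrow> \<psi> (a * c)"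
        by (intro tendsto_psi tendsto_mult tendsto_const lim)
      moreover have "(\<lambda>m. \<psi> (a * cond_exp m x)) \<longlonglongrightarrow> \<psi> (a * x)"
        using psi_mult_cond_exp[OF d] by (intro tendsto_eventually) (auto simp: a_def eventually_sequentially)
      ultimately have "\<psi> (a * c) = \<psi> (a * x)" by (rule LIMSEQ_unique)
      then show ?thesis using reduce[OF x] reduce[OF cA] by simp
    qed
    then show ?case by (simp add: right_diff_distrib psi_diff)
  qed
  then have "x - c = 0" by (rule psi_faithful)
  then show ?thesis using c by simp
qed

lemma masa_A: "masa A"
  unfolding masa_def
proof (intro conjI allI impI cstar_subalgebra_A abelian_A)
  fix B assume B: "cstar_subalgebra B \<and> abelian B \<and> A \<subseteq> B"
  have "B \<subseteq> A"
  proof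
    fix x assume "x \<in> B"
    then show "x \<in> A"
      using B by (intro commutant_A_subset) (auto simp: abelian_def)
  qed
  with B show "B = A" by blast
qed

end

section \<open>Inner conjugacy\<close>

context cuntz_system
begin

text \<open>The square of \<open>two_norm\<close> with \<open>\<psi>\<close> in place of the trace,
  so that it also applies to elements outside the core.\<close>

definition sq_norm :: "'a \<Rightarrow> real" where
  "sq_norm x = Re (\<psi> (star x * x))"

lemma sq_norm_nonneg: "0 \<le> sq_norm x"
  unfolding sq_norm_def by (rule psi_positive)

lemma psi_star_mult_self: "\<psi> (star x * x) = complex_of_real (sq_norm x)"
  by (simp add: sq_norm_def complex_eq_iff psi_positive)

lemma sq_norm_le: "sq_norm x \<le> (norm x)\<^sup>2"
  unfolding sq_norm_def
  using complex_Re_le_cmod[of "\<psi> (star x * x)"] norm_psi[of "star x * x"] cstar_identity[of x] by simp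

text \<open>The parallelogram law, used instead of a triangle inequality for the 2-norm.\<close>

lemma sq_norm_add_le: "sq_norm (x + y) \<le> 2 * sq_norm x + 2 * sq_norm y"
proof -
  have "sq_norm (x + y) + sq_norm (x - y) = 2 * sq_norm x + 2 * sq_norm y"
    by (simp add: sq_norm_def star_add star_diff distrib_left distrib_right left_diff_distrib
        right_diff_distrib psi_add psi_diff)
  then show ?thesis using sq_norm_nonneg[of "x - y"] by linarith
qed

lemma sq_norm_scaleC: "sq_norm (c *\<^sub>C x) = (cmod c)\<^sup>2 * sq_norm x"
proof -
  have "complex_of_real (sq_norm (c *\<^sub>C x)) = (c * cnj c) * complex_of_real (sq_norm x)"
    unfolding psi_star_mult_self[symmetric]
    by (simp add: star_scaleC scaleC_mult_left scaleC_mult_right psi_scaleC)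
  also have "\<dots> = complex_of_real ((cmod c)\<^sup>2 * sq_norm x)"
    unfolding complex_norm_square[symmetric] by simp
  finally show ?thesis by (simp only: of_real_eq_iff)
qed

lemma sq_norm_unitary: "unitary x \<Longrightarrow> sq_norm x = 1"
  by (simp add: sq_norm_def unitary_def)

lemma sq_norm_zero [simp]: "sq_norm 0 = 0"
  by (simp add: sq_norm_def)

lemma sq_norm_shift_pow: "sq_norm (\<sigma> k x) = sq_norm x"
  by (simp add: sq_norm_def psi_shift_pow flip: shift_pow_star shift_pow_mult)

lemma sq_norm_core_shift:
  assumes f: "f \<in> core_level n S k"
  shows "sq_norm (f * \<sigma> k x) = sq_norm f * sq_norm x"
proof -
  have ff: "star f * f \<in> core_level n S k"
    by (rule core_level_mult[OF core_level_star[OF f] f])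
  have "star (f * \<sigma> k x) * (f * \<sigma> k x) = \<sigma> k (star x) * (star f * f) * \<sigma> k x"
    by (simp add: star_mult shift_pow_star mult.assoc)
  also have "\<sigma> k (star x) * (star f * f) = star f * f * \<sigma> k (star x)"
    by (rule core_level_shift_pow_commute[OF ff, symmetric])
  finally have "star (f * \<sigma> k x) * (f * \<sigma> k x) = star f * f * \<sigma> k (star x * x)"
    by (simp add: shift_pow_mult mult.assoc)
  then have "\<psi> (star (f * \<sigma> k x) * (f * \<sigma> k x)) = \<psi> (star f * f) * \<psi> (star x * x)"
    using psi_core_shift[OF ff] by simp
  then show ?thesis by (simp only: psi_star_mult_self of_real_mult[symmetric] of_real_eq_iff)
qed

lemma sq_norm_Sw_conj_le:
  assumes "\<alpha> \<in> W"
  shows "sq_norm (Sw \<alpha> * x * star (Sw \<alpha>)) \<le> sq_norm x"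
proof -
  have "star (Sw \<alpha> * x * star (Sw \<alpha>)) * (Sw \<alpha> * x * star (Sw \<alpha>))
      = Sw \<alpha> * (star x * (star (Sw \<alpha>) * Sw \<alpha>) * x) * star (Sw \<alpha>)"
    by (simp add: star_mult star_star mult.assoc)
  also have "\<dots> = Sw \<alpha> * (star x * x) * star (Sw \<alpha>)" using assms by simp
  finally have "sq_norm (Sw \<alpha> * x * star (Sw \<alpha>)) = Re (\<psi> (star x * x) / of_nat n ^ length \<alpha>)"
    unfolding sq_norm_def using psi_Sw_conj[of \<alpha> "length \<alpha>" \<alpha>] assms by (simp add: words_of_length_def)
  also have "\<dots> = sq_norm x / real n ^ length \<alpha>"
    unfolding sq_norm_def by (metis Re_divide_of_real of_real_of_nat_eq of_real_power)
  also have "\<dots> \<le> sq_norm x / 1"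
    using n_pos sq_norm_nonneg by (intro divide_left_mono) (auto simp: Suc_le_eq)
  finally show ?thesis by simp
qed

end

section \<open>Bounding diagonal parts of two-sided products\<close>

context cuntz_diagonal
begin

text \<open>Words of different length leave a nonzero degree, which \<open>\<Phi>\<close> kills, and
  distinct words of equal length give 0. What remains is conjugation of a shift of
  \<open>\<Phi> v\<close> by one word, which does not increase the 2-norm.\<close>

lemma sq_norm_Phi_compress:
  assumes W: "\<alpha> \<in> W" "\<gamma> \<in> W" and v: "v \<in> Deg 0"
  shows "sq_norm (\<Phi> (Sw \<alpha> * \<sigma> k v * star (Sw \<gamma>))) \<le> sq_norm (\<Phi> v)"
proof (cases "length \<alpha> = length \<gamma>")
  case True
  have "\<Phi> (Sw \<alpha> * \<sigma> k v * star (Sw \<gamma>)) = (if \<alpha> = \<gamma> then Sw \<alpha> * \<sigma> k (\<Phi> v) * star (Sw \<alpha>) else 0)"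
    using Phi_Sw_conj[of \<alpha> "length \<alpha>" \<gamma>] True W by (simp add: words_of_length_def Phi_shift_pow)
  then show ?thesis
    using sq_norm_Sw_conj_le[OF W(1), of "\<sigma> k (\<Phi> v)"] sq_norm_nonneg
    by (auto simp: sq_norm_shift_pow)
next
  case False
  have "Sw \<alpha> * \<sigma> k v * star (Sw \<gamma>) \<in> Deg (int (length \<alpha>) + 0 + - int (length \<gamma>))"
    by (intro Deg_mult shift_pow_Deg v Sw_Deg star_Sw_Deg W)
  then show ?thesis using False by (simp add: Phi_Deg sq_norm_nonneg)
qed

text \<open>After \<open>\<sigma> m v\<close> crosses the inner words, their product is 0 or a
  single leftover word or its adjoint, which joins the outer word on its side.\<close>

lemma sq_norm_Phi_munit:
  assumes W: "\<alpha> \<in> W" "\<beta> \<in> W" "\<gamma> \<in> W" "\<delta> \<in> W" and m: "length \<beta> \<le> m" "length \<delta> \<le> m" and v: "v \<in> Deg 0"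
  shows "sq_norm (\<Phi> (munit \<alpha> \<beta> * \<sigma> m v * star (munit \<gamma> \<delta>))) \<le> sq_norm (\<Phi> v)"
proof -
  have "munit \<alpha> \<beta> * \<sigma> m v * star (munit \<gamma> \<delta>) = Sw \<alpha> * (star (Sw \<beta>) * \<sigma> m v) * Sw \<delta> * star (Sw \<gamma>)"
    by (simp add: star_mult star_star mult.assoc)
  also have "\<dots> = Sw \<alpha> * \<sigma> (m - length \<beta>) v * (star (Sw \<beta>) * Sw \<delta>) * star (Sw \<gamma>)"
    by (simp add: star_Sw_shift_pow[OF W(2) m(1)] mult.assoc)
  finally have eq: "munit \<alpha> \<beta> * \<sigma> m v * star (munit \<gamma> \<delta>)
      = Sw \<alpha> * \<sigma> (m - length \<beta>) v * (star (Sw \<beta>) * Sw \<delta>) * star (Sw \<gamma>)" .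
  show ?thesis
  proof (rule star_Sw_Sw_cases[OF W(2,4)])
    assume "star (Sw \<beta>) * Sw \<delta> = 0"
    then show ?thesis by (simp add: eq sq_norm_nonneg)
  next
    fix \<epsilon> assume \<epsilon>: "\<epsilon> \<in> W" "\<delta> = \<beta> @ \<epsilon>" "star (Sw \<beta>) * Sw \<delta> = Sw \<epsilon>"
    have "munit \<alpha> \<beta> * \<sigma> m v * star (munit \<gamma> \<delta>)
        = Sw (\<alpha> @ \<epsilon>) * \<sigma> (m - length \<beta> - length \<epsilon>) v * star (Sw \<gamma>)"
      using shift_pow_Sw[OF \<epsilon>(1), of "m - length \<beta>" v] m(2) unfolding eq \<epsilon>(3)
      by (simp add: \<epsilon>(2) Sw_append mult.assoc)
    then show ?thesis
      using sq_norm_Phi_compress[of "\<alpha> @ \<epsilon>" \<gamma> v "m - length \<beta> - length \<epsilon>"] W \<epsilon>(1) v by simp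
  next
    fix \<epsilon> assume \<epsilon>: "\<epsilon> \<in> W" "\<beta> = \<delta> @ \<epsilon>" "star (Sw \<beta>) * Sw \<delta> = star (Sw \<epsilon>)"
    have "munit \<alpha> \<beta> * \<sigma> m v * star (munit \<gamma> \<delta>) = Sw \<alpha> * \<sigma> (m - length \<beta>) v * star (Sw (\<gamma> @ \<epsilon>))"
      unfolding eq \<epsilon>(3) by (simp add: Sw_append star_mult mult.assoc)
    then show ?thesis
      using sq_norm_Phi_compress[of \<alpha> "\<gamma> @ \<epsilon>" v "m - length \<beta>"] W \<epsilon>(1) v by simp
  qed
qed

text \<open>\<open>C\<close> and \<open>m0\<close> depend on \<open>F\<close> alone. The property is
  closed under linear combinations, so the bound for polynomials reduces to monomials by span
  induction in each factor.\<close>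

definition diag_dominated :: "(nat \<Rightarrow> 'a \<Rightarrow> 'a) \<Rightarrow> bool" where
  "diag_dominated F \<longleftrightarrow>
    (\<exists>C m0. 0 \<le> C \<and> (\<forall>m\<ge>m0. \<forall>v\<in>Deg 0. sq_norm (\<Phi> (F m v)) \<le> C * sq_norm (\<Phi> v)))"

lemma diag_dominated_zero: "diag_dominated (\<lambda>m v. 0)"
  unfolding diag_dominated_def by (auto intro!: exI[of _ 0])

lemma diag_dominated_scaleC:
  assumes "diag_dominated F"
  shows "diag_dominated (\<lambda>m v. c *\<^sub>C F m v)"
proof -
  obtain C m0 where C: "0 \<le> C"
    and le: "\<And>m v. m \<ge> m0 \<Longrightarrow> v \<in> Deg 0 \<Longrightarrow> sq_norm (\<Phi> (F m v)) \<le> C * sq_norm (\<Phi> v)"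
    using assms unfolding diag_dominated_def by blast
  have "sq_norm (\<Phi> (c *\<^sub>C F m v)) \<le> (cmod c)\<^sup>2 * C * sq_norm (\<Phi> v)" if "m \<ge> m0" "v \<in> Deg 0" for m v
    using mult_left_mono[OF le[OF that], of "(cmod c)\<^sup>2"] by (simp add: Phi_scaleC sq_norm_scaleC mult.assoc)
  moreover have "0 \<le> (cmod c)\<^sup>2 * C" using C by simp
  ultimately show ?thesis
    unfolding diag_dominated_def by blast
qed

lemma diag_dominated_add:
  assumes "diag_dominated F" "diag_dominated G"
  shows "diag_dominated (\<lambda>m v. F m v + G m v)"
proof -
  obtain C m0 where C: "0 \<le> C"
    and le: "\<And>m v. m \<ge> m0 \<Longrightarrow> v \<in> Deg 0 \<Longrightarrow> sq_norm (\<Phi> (F m v)) \<le> C * sq_norm (\<Phi> v)"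
    using assms(1) unfolding diag_dominated_def by blast
  obtain C' m0' where C': "0 \<le> C'"
    and le': "\<And>m v. m \<ge> m0' \<Longrightarrow> v \<in> Deg 0 \<Longrightarrow> sq_norm (\<Phi> (G m v)) \<le> C' * sq_norm (\<Phi> v)"
    using assms(2) unfolding diag_dominated_def by blast
  have "sq_norm (\<Phi> (F m v + G m v)) \<le> (2 * C + 2 * C') * sq_norm (\<Phi> v)"
    if "m \<ge> max m0 m0'" "v \<in> Deg 0" for m v
    using sq_norm_add_le[of "\<Phi> (F m v)" "\<Phi> (G m v)"] le[of m v] le'[of m v] that
    by (simp add: Phi_add algebra_simps)
  then show ?thesis
    unfolding diag_dominated_def using C C'
    by (intro exI[of _ "2 * C + 2 * C'"] exI[of _ "max m0 m0'"]) auto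
qed

lemma diag_dominated_cuntz_poly:
  assumes x: "x \<in> cuntz_poly" and y: "y \<in> cuntz_poly"
  shows "diag_dominated (\<lambda>m v. x * \<sigma> m v * star y)"
  using x unfolding cuntz_poly_def
proof (induction rule: complex_vector.span_induct)
  case base
  show ?case
    by (simp add: complex_vector.subspace_def distrib_right scaleC_mult_left
        diag_dominated_zero diag_dominated_add diag_dominated_scaleC)
next
  case (step x)
  show ?case using y unfolding cuntz_poly_def
  proof (induction rule: complex_vector.span_induct)
    case base
    show ?case
      by (simp add: complex_vector.subspace_def star_add star_scaleC distrib_left scaleC_mult_right
          diag_dominated_zero diag_dominated_add diag_dominated_scaleC)
  next
    case inner: (step y)
    obtain \<alpha> \<beta> \<gamma> \<delta> where W: "\<alpha> \<in> W" "\<beta> \<in> W" "\<gamma> \<in> W" "\<delta> \<in> W" and xy: "x = munit \<alpha> \<beta>" "y = munit \<gamma> \<delta>"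
      using step inner by auto
    show ?case
      unfolding diag_dominated_def xy
      by (intro exI[of _ 1] exI[of _ "max (length \<beta>) (length \<delta>)"])
        (use sq_norm_Phi_munit[OF W] in simp)
  qed
qed

end

section \<open>Tail products and the contradiction\<close>

context product_conjugate
begin

text \<open>\<open>v\<close> is the product of \<open>j\<close> conjugated unitaries starting with
  block \<open>k\<close>, shifted back to the origin. Prepending a block multiplies
  \<open>sq_norm\<close> of the diagonal part, because a core element is independent of elements
  shifted past its level.\<close>

lemma exists_tail_unitary:
  assumes d: "\<And>k. 1 \<le> k \<Longrightarrow> unitary (d k) \<and> d k \<in> diag_level n S (r k)"
    and bound: "\<And>k. 1 \<le> k \<Longrightarrow> sq_norm (\<Phi> (u k * d k * star (u k))) \<le> (c k)\<^sup>2"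
    and "1 \<le> k"
  shows "\<exists>v\<in>Deg 0. unitary v \<and> \<sigma> (R k) v \<in> A \<and> sq_norm (\<Phi> v) \<le> (\<Prod>i\<in>{k..<k + j}. c i)\<^sup>2"
  using \<open>1 \<le> k\<close>
proof (induction j arbitrary: k)
  case 0
  have "\<Phi> 1 = 1" using Phi_munit[of "[]" "[]"] by simp
  then show ?case
    by (intro bexI[of _ 1]) (simp_all add: one_Deg one_in_A unitary_def sq_norm_def)
next
  case (Suc j)
  obtain v where v: "v \<in> Deg 0" "unitary v" "\<sigma> (R (Suc k)) v \<in> A"
    and le: "sq_norm (\<Phi> v) \<le> (\<Prod>i\<in>{Suc k..<Suc k + j}. c i)\<^sup>2"
    using Suc.IH[of "Suc k"] by auto
  define b where "b = u k * d k * star (u k)"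
  have b_core: "b \<in> core_level n S (r k)"
    unfolding b_def using d[OF Suc.prems]
    by (intro core_level_mult core_level_star diag_level_core_level u_core Suc.prems) simp
  have b_unitary: "unitary b"
    unfolding b_def using d[OF Suc.prems] u_unitary[OF Suc.prems] by (simp add: unitary_mult unitary_star)
  define v' where "v' = b * \<sigma> (r k) v"
  have R: "R k + r k = R (Suc k)"
    using Suc.prems R_Suc[of "k - 1"] by simp
  have eq: "\<sigma> (R k) v' = block k (d k) * \<sigma> (R (Suc k)) v"
    by (simp add: v'_def b_def block_def shift_pow_mult shift_pow_pow R)
  have "v' \<in> Deg (0 + 0)"
    unfolding v'_def by (intro Deg_mult core_level_Deg[OF b_core] shift_pow_Deg v)
  moreover have "unitary v'"
    unfolding v'_def by (intro unitary_mult b_unitary unitary_shift_pow v)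
  moreover have "\<sigma> (R k) v' \<in> A"
    unfolding eq by (rule A_mult[OF block_in_A v(3)]) (use d Suc.prems in auto)
  moreover have "sq_norm (\<Phi> v') \<le> (\<Prod>i\<in>{k..<k + Suc j}. c i)\<^sup>2"
  proof -
    have "sq_norm (\<Phi> v') = sq_norm (\<Phi> b) * sq_norm (\<Phi> v)"
      unfolding v'_def Phi_core_shift[OF b_core]
      by (rule sq_norm_core_shift[OF diag_level_core_level[OF Phi_core_level[OF b_core]]])
    also have "\<dots> \<le> (c k)\<^sup>2 * (\<Prod>i\<in>{Suc k..<Suc k + j}. c i)\<^sup>2"
      using bound[OF Suc.prems] le by (intro mult_mono sq_norm_nonneg) (simp_all add: b_def)
    also have "\<dots> = (\<Prod>i\<in>{k..<k + Suc j}. c i)\<^sup>2"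
      by (simp add: prod.atLeast_Suc_lessThan power_mult_distrib)
    finally show ?thesis .
  qed
  ultimately show ?case by auto
qed

lemma not_inner_conjugate:
  assumes d: "\<And>k. 1 \<le> k \<Longrightarrow> unitary (d k) \<and> d k \<in> diag_level n S (r k)"
    and bound: "\<And>k. 1 \<le> k \<Longrightarrow> sq_norm (\<Phi> (u k * d k * star (u k))) \<le> (c k)\<^sup>2"
    and c: "\<And>k. 1 \<le> k \<Longrightarrow> 0 < c k"
    and c_prod: "(\<lambda>m. \<Prod>k=1..m. c k) \<longlonglongrightarrow> 0"
  shows "\<not> inner_conjugate A (diag_masa n S)"
proof
  assume "inner_conjugate A (diag_masa n S)"
  then obtain w where w: "unitary w" and image: "(\<lambda>a. w * a * star w) ` A = diag_masa n S"
    by (auto simp: inner_conjugate_def)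
  have "w \<in> closure cuntz_poly" by (simp add: closure_cuntz_poly)
  \<comment> \<open>The error 1/10 gives
    \<open>norm (y - y') \<le> 1/10 + 11/10 * 1/10 = 21/100\<close>, whose square is below
    1/10.\<close>
  then obtain w' where w': "w' \<in> cuntz_poly" and close: "norm (w' - w) < 1 / 10"
    unfolding closure_approachable dist_norm by (metis zero_less_divide_1_iff zero_less_numeral)
  obtain C m0 where C: "0 \<le> C" and dom: "\<And>m v. m \<ge> m0 \<Longrightarrow> v \<in> Deg 0 \<Longrightarrow>
      sq_norm (\<Phi> (w' * \<sigma> m v * star w')) \<le> C * sq_norm (\<Phi> v)"
    using diag_dominated_cuntz_poly[OF w' w'] unfolding diag_dominated_def by blast
  \<comment> \<open>With this start \<open>R k\<close> is at least \<open>m0\<close>, as the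
    domination bound requires.\<close>
  define k where "k = Suc m0"
  \<comment> \<open>\<open>C + 1\<close> instead of \<open>C\<close> avoids division by zero and
    makes \<open>e\<close> at most 1, so that \<open>C * e\<^sup>2\<close> stays below 1/10.\<close>
  define e where "e = 1 / (10 * (C + 1))"
  have e: "0 < e" "C * e\<^sup>2 \<le> 1 / 10"
  proof -
    show "0 < e" using C by (simp add: e_def)
    have "C * e \<le> 1 / 10" "e \<le> 1" using C by (simp_all add: e_def divide_simps)
    then have "(C * e) * e \<le> 1 / 10 * 1" using \<open>0 < e\<close> C by (intro mult_mono) auto
    then show "C * e\<^sup>2 \<le> 1 / 10" by (simp add: power2_eq_square mult.assoc)
  qed
  \<comment> \<open>The part of the product before the block is a fixed positive number; once the
    whole product is below \<open>e * P\<close>, the block itself is below \<open>e\<close>.\<close>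
  define P where "P = (\<Prod>i\<in>{1..<k}. c i)"
  have "P > 0" unfolding P_def by (rule prod_pos) (use c in auto)
  then obtain M where M: "\<And>m. m \<ge> M \<Longrightarrow> \<bar>\<Prod>i=1..m. c i\<bar> < e * P"
    using LIMSEQ_D[OF c_prod, of "e * P"] e(1) by auto
  define j where "j = Suc M"
  have "(\<Prod>i\<in>{1..<k + j}. c i) = P * (\<Prod>i\<in>{k..<k + j}. c i)"
    unfolding P_def by (rule prod.atLeastLessThan_concat[symmetric]) (simp_all add: k_def)
  moreover have "{1..<k + j} = {1..k + M}" by (auto simp: j_def)
  ultimately have "\<bar>P * (\<Prod>i\<in>{k..<k + j}. c i)\<bar> < e * P"
    using M[of "k + M"] by simp
  moreover have tail_pos: "0 < (\<Prod>i\<in>{k..<k + j}. c i)"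
    by (rule prod_pos) (use c in \<open>auto simp: k_def\<close>)
  ultimately have tail: "(\<Prod>i\<in>{k..<k + j}. c i) < e"
    using \<open>P > 0\<close> by (simp add: abs_mult mult.commute)
  obtain v where v: "v \<in> Deg 0" "unitary v" "\<sigma> (R k) v \<in> A"
    and v_le: "sq_norm (\<Phi> v) \<le> (\<Prod>i\<in>{k..<k + j}. c i)\<^sup>2"
    using exists_tail_unitary[OF d bound, of k j] by (auto simp: k_def)
  define V where "V = \<sigma> (R k) v"
  have V: "unitary V" unfolding V_def by (rule unitary_shift_pow[OF v(2)])
  define y y' where "y = w * V * star w" and "y' = w' * V * star w'"
  have "y \<in> diag_masa n S"
    using image v(3) by (auto simp: y_def V_def)
  then have "\<Phi> y = y" by (rule Phi_diag_masa)
  moreover have "unitary y"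
    unfolding y_def by (intro unitary_mult unitary_star w V)
  ultimately have one: "sq_norm (\<Phi> y) = 1" by (simp add: sq_norm_unitary)
  have "norm (y - y') \<le> 21 / 100"
  proof -
    have "y - y' = (w - w') * (V * star w) + (w' * V) * star (w - w')"
      by (simp add: y_def y'_def left_diff_distrib right_diff_distrib star_diff mult.assoc)
    also have "norm \<dots> \<le> norm (w - w') * norm (V * star w) + norm (w' * V) * norm (star (w - w'))"
      by (intro norm_triangle_le add_mono norm_mult_ineq)
    also have "\<dots> \<le> 1 / 10 * 1 + (11 / 10) * (1 / 10)"
    proof (intro add_mono mult_mono)
      show "norm (w - w') \<le> 1 / 10" "norm (star (w - w')) \<le> 1 / 10"
        using close by (simp_all add: norm_minus_commute)
      show "norm (V * star w) \<le> 1"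
        using norm_unitary[OF unitary_mult[OF V unitary_star[OF w]]] by simp
      have "norm w' \<le> 11 / 10"
        using norm_triangle_sub[of w' w] close norm_unitary[OF w] by simp
      then show "norm (w' * V) \<le> 11 / 10"
        using norm_mult_ineq[of w' V] norm_unitary[OF V] by simp
    qed simp_all
    finally show ?thesis by simp
  qed
  then have "(norm (\<Phi> (y - y')))\<^sup>2 \<le> (21 / 100)\<^sup>2"
    using norm_Phi[of "y - y'"] by (intro power_mono) auto
  then have diff: "sq_norm (\<Phi> (y - y')) \<le> 1 / 10"
    using sq_norm_le[of "\<Phi> (y - y')"] by (simp add: power2_eq_square)
  have "sq_norm (\<Phi> y') \<le> C * sq_norm (\<Phi> v)"
    unfolding y'_def V_def by (rule dom[OF _ v(1)]) (use R_ge[of m0] in \<open>simp add: k_def\<close>)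
  also have "\<dots> \<le> C * e\<^sup>2"
    using v_le tail tail_pos C by (intro mult_left_mono) (auto intro: order_trans[OF _ power_mono])
  finally have "sq_norm (\<Phi> y') \<le> 1 / 10" using e(2) by simp
  moreover have "\<Phi> y = \<Phi> (y - y') + \<Phi> y'" by (simp add: Phi_diff)
  \<comment> \<open>The sum bound would give \<open>1 \<le> 2 * (1/10) + 2 * (1/10)\<close>.\<close>
  ultimately show False
    using sq_norm_add_le[of "\<Phi> (y - y')" "\<Phi> y'"] one diff by simp
qed

end

section \<open>From the hypotheses of the theorem to the locales\<close>

lemma cuntz_systemI:
  assumes "2 \<le> n" "cuntz_algebra n S"
  shows "cuntz_system n S"
  using assms by (auto simp: cuntz_algebra_def intro!: cuntz_system.intro)

lemma (in cuntz_system) canonical_trace_eq_psi: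
  assumes tau: "canonical_trace n S \<tau>" and x: "x \<in> core_level n S k"
  shows "\<tau> x = \<psi> x"
proof -
  have core: "y \<in> core n S" if "y \<in> core_level n S k" for y
    unfolding core_def by (rule subsetD[OF closure_subset]) (use that in blast)
  have add: "\<tau> (a + b) = \<tau> a + \<tau> b" if "a \<in> core n S" "b \<in> core n S" for a b
    using tau that by (simp add: canonical_trace_def)
  have scale: "\<tau> (c *\<^sub>C a) = c * \<tau> a" if "a \<in> core n S" for a c
    using tau that by (simp add: canonical_trace_def)
  have tau_munit: "\<tau> (munit \<alpha> \<beta>) = (if \<alpha> = \<beta> then 1 / of_nat n ^ k else 0)" if "\<alpha> \<in> Wl k" "\<beta> \<in> Wl k" for \<alpha> \<beta>
    using tau that by (simp add: canonical_trace_def)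
  \<comment> \<open>Membership is carried through the induction because \<open>\<tau>\<close> is
    linear only on the core.\<close>
  have "x \<in> core_level n S k \<and> \<tau> x = \<psi> x"
    using x
  proof (induction rule: core_level_induct)
    case subspace
    have zero: "0 \<in> core_level n S k" by (rule complex_vector.subspace_0[OF subspace_core_level])
    then have "\<tau> 0 = 0" using scale[of 0 0] core by simp
    then show ?case
      using zero core
      by (auto simp: complex_vector.subspace_def add scale psi_add psi_scaleC
          intro: complex_vector.subspace_add[OF subspace_core_level]
            complex_vector.subspace_scale[OF subspace_core_level])
  next
    case (munit \<alpha> \<beta>)
    then show ?case
      using munit[THEN words_of_lengthD(1)] words_of_lengthD(2)[OF munit(1)]
      by (auto simp: tau_munit munit_core_level psi_munit)
  qed
  then show ?thesis ..
qed

theorem theorem5p2: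
  fixes n :: nat
    and S :: "nat \<Rightarrow> 'a::cstar_algebra"
    and \<Phi> :: "'a \<Rightarrow> 'a"
    and \<tau> :: "'a \<Rightarrow> complex"
    and r R :: "nat \<Rightarrow> nat"
    and c :: "nat \<Rightarrow> real"
    and d U :: "nat \<Rightarrow> 'a"
    and A :: "'a set"
  assumes n: "2 \<le> n"
    and cuntz: "cuntz_algebra n S"
    and Phi: "diag_expectation n S \<Phi>"
    and tau: "canonical_trace n S \<tau>"
    and r: "\<And>k. 1 \<le> k \<Longrightarrow> 0 < r k"
    and R: "\<And>k. 1 \<le> k \<Longrightarrow> R k = (\<Sum>j\<in>{1..<k}. r j)"
    and c: "\<And>k. 1 \<le> k \<Longrightarrow> 0 < c k \<and> c k < 1"
    and c_prod: "(\<lambda>m. \<Prod>k=1..m. c k) \<longlonglongrightarrow> 0"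
    and d: "\<And>k. 1 \<le> k \<Longrightarrow>
      unitary (d k) \<and> d k \<in> (shift n S ^^ R k) ` diag_level n S (r k)"
    and U: "\<And>k. 1 \<le> k \<Longrightarrow>
      unitary (U k) \<and> U k \<in> (shift n S ^^ R k) ` core_level n S (r k)"
    and bound: "\<And>k. 1 \<le> k \<Longrightarrow> two_norm \<tau> (\<Phi> (U k * d k * star (U k))) \<le> c k"
    and A: "A = cstar_generated
      (\<Union>k\<in>{1..}. (\<lambda>x. U k * x * star (U k)) ` (shift n S ^^ R k) ` diag_level n S (r k))"
  shows "masa A \<and> \<not> inner_conjugate A (diag_masa n S)"
proof -
  interpret cuntz_system n S by (rule cuntz_systemI[OF n cuntz])
  interpret cuntz_diagonal n S \<Phi> by unfold_locales (rule Phi)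
  \<comment> \<open>Preimages under the shift are chosen, so that each unitary and each diagonal
    element sits in a level of size \<open>r k\<close> starting at the origin.\<close>
  have "\<forall>k\<in>{1..}. \<exists>v. U k = \<sigma> (R k) v \<and> v \<in> core_level n S (r k)" using U by blast
  then obtain u where "\<forall>k\<in>{1..}. U k = \<sigma> (R k) (u k) \<and> u k \<in> core_level n S (r k)"
    by (rule bchoice[THEN exE])
  then have u: "U k = \<sigma> (R k) (u k)" "u k \<in> core_level n S (r k)" if "1 \<le> k" for k using that by auto
  have "\<forall>k\<in>{1..}. \<exists>v. d k = \<sigma> (R k) v \<and> v \<in> diag_level n S (r k)" using d by blast
  then obtain e where "\<forall>k\<in>{1..}. d k = \<sigma> (R k) (e k) \<and> e k \<in> diag_level n S (r k)"
    by (rule bchoice[THEN exE])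
  then have e: "d k = \<sigma> (R k) (e k)" "e k \<in> diag_level n S (r k)" if "1 \<le> k" for k using that by auto
  interpret product_conjugate n S \<Phi> r R u A
  proof unfold_locales
    show "unitary (u k)" if "1 \<le> k" for k
      using U[OF that] by (simp add: u(1)[OF that] unitary_shift_pow_iff)
    show "A = cstar_generated (\<Union>k\<in>{1..}. (\<lambda>x. \<sigma> (R k) (u k) * x * star (\<sigma> (R k) (u k))) `
        \<sigma> (R k) ` diag_level n S (r k))"
      unfolding A using u(1) by (intro arg_cong[where f=cstar_generated] SUP_cong) auto
  qed (use r R u(2) in auto)
  have unitary_e: "unitary (e k) \<and> e k \<in> diag_level n S (r k)" if "1 \<le> k" for k
    using d[OF that] e[OF that] by (simp add: unitary_shift_pow_iff)
  \<comment> \<open>The bound survives unshifting: \<open>\<Phi>\<close> commutes with the shift,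
    \<open>sq_norm\<close> is shift invariant, and \<open>\<tau>\<close> agrees with
    \<open>\<psi>\<close> on the level \<open>R k + r k\<close> containing the shifted
    element.\<close>
  have bound_e: "sq_norm (\<Phi> (u k * e k * star (u k))) \<le> (c k)\<^sup>2" if k: "1 \<le> k" for k
  proof -
    define a where "a = \<Phi> (u k * e k * star (u k))"
    have "u k * e k * star (u k) \<in> core_level n S (r k)"
      by (intro core_level_mult core_level_star diag_level_core_level[OF e(2)[OF k]] u(2)[OF k])
    then have "\<sigma> (R k) a \<in> core_level n S (R k + r k)"
      unfolding a_def by (rule shift_pow_core_level[OF diag_level_core_level[OF Phi_core_level]])
    then have "star (\<sigma> (R k) a) * \<sigma> (R k) a \<in> core_level n S (R k + r k)"
      by (intro core_level_mult core_level_star)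
    then have "two_norm \<tau> (\<sigma> (R k) a) = sqrt (sq_norm (\<sigma> (R k) a))"
      using canonical_trace_eq_psi[OF tau] by (simp add: two_norm_def sq_norm_def)
    moreover have "\<Phi> (U k * d k * star (U k)) = \<sigma> (R k) a"
      by (simp add: u(1)[OF k] e(1)[OF k] a_def Phi_shift_pow flip: shift_pow_mult shift_pow_star)
    ultimately have "sqrt (sq_norm a) \<le> c k"
      using bound[OF k] by (simp add: sq_norm_shift_pow)
    then have "(sqrt (sq_norm a))\<^sup>2 \<le> (c k)\<^sup>2"
      by (intro power_mono) (simp_all add: sq_norm_nonneg)
    then show ?thesis by (simp add: a_def sq_norm_nonneg)
  qed
  show ?thesis
    using masa_A not_inner_conjugate[OF unitary_e bound_e] c c_prod by blast
qed

end
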